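(* Let $M$ be a compact connected complex manifold of complex dimension $n\geq 2$, let $\omega$ be a Hermitian metric on $M$ and let $f\in C^\infty(M;\mathbb{R})$. (1) Assume that $\partial\bar\partial(f\omega^{n-1})=0$. Then $f$ has constant sign. If moreover $f$ is not identically zero, then $f$ is a constant if and only if $\omega$ is a Gauduchon metric. (2) If $d(f\omega)=0$, then $f$ has constant sign. Namely, either $f\equiv 0$, or one of $f\omega$, $-f\omega$ is a Kähler metric.
   Context: A Hermitian metric is identified with its associated positive $(1,1)$-form $\omega$. It is Kähler if $d\omega=0$ and Gauduchon if $\partial\bar\partial\omega^{n-1}=0$. A real function $f$ on $M$ has constant sign if $f>0$ everywhere on $M$, or $f<0$ everywhere on $M$, or $f\equiv 0$ on $M$. *)

theory Defs
  imports "HOL-Analysis.Analysis" "HOL-Combinatorics.Permutations"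
begin

section \<open>Smooth and holomorphic maps on open sets\<close>

text \<open>The following two notions are used on open sets only.\<close>

primrec C_k_on :: "nat \<Rightarrow> 'a::euclidean_space set \<Rightarrow> ('a \<Rightarrow> 'b::real_normed_vector) \<Rightarrow> bool" where
  "C_k_on 0 S g \<longleftrightarrow> continuous_on S g"
| "C_k_on (Suc k) S g \<longleftrightarrow>
     g differentiable_on S \<and> (\<forall>u. C_k_on k S (\<lambda>x. frechet_derivative g (at x) u))"

definition smooth_on :: "'a::euclidean_space set \<Rightarrow> ('a \<Rightarrow> 'b::real_normed_vector) \<Rightarrow> bool" where
  "smooth_on S g \<longleftrightarrow> (\<forall>k. C_k_on k S g)"

definition holomorphic_map_on :: "(complex^'n) set \<Rightarrow> (complex^'n \<Rightarrow> complex^'n) \<Rightarrow> bool" where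
  "holomorphic_map_on S g \<longleftrightarrow>
     (\<forall>x\<in>S. \<exists>L. (g has_derivative L) (at x) \<and> (\<forall>u. L (\<i> *s u) = \<i> *s L u))"


section \<open>Complex manifolds\<close>

text \<open>A chart is a pair of its domain and its coordinate map.  The coordinate map is a total
  function; its values outside the domain are irrelevant.\<close>

type_synonym ('m, 'n) chart = "'m set \<times> ('m \<Rightarrow> complex^'n)"

definition chart_image :: "('m, 'n::finite) chart \<Rightarrow> (complex^'n) set" where
  "chart_image c = snd c ` fst c"

definition chart_inv :: "('m, 'n::finite) chart \<Rightarrow> complex^'n \<Rightarrow> 'm" where
  "chart_inv c = inv_into (fst c) (snd c)"

definition overlap :: "('m, 'n::finite) chart \<Rightarrow> ('m, 'n) chart \<Rightarrow> (complex^'n) set" where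
  "overlap c d = snd c ` (fst c \<inter> fst d)"

definition transition :: "('m, 'n::finite) chart \<Rightarrow> ('m, 'n) chart \<Rightarrow> complex^'n \<Rightarrow> complex^'n" where
  "transition c d = snd d \<circ> chart_inv c"

text \<open>The manifold is the whole type \<open>'m\<close> (Hausdorff by its sort; second countability is
  automatic for a compact space covered by charts).  The atlas need not be maximal.\<close>

definition complex_atlas :: "('m::t2_space, 'n::finite) chart set \<Rightarrow> bool" where
  "complex_atlas A \<longleftrightarrow>
     (\<Union>c\<in>A. fst c) = UNIV \<and>
     (\<forall>c\<in>A. open (fst c) \<and> open (chart_image c) \<and>
        homeomorphism (fst c) (chart_image c) (snd c) (chart_inv c)) \<and>
     (\<forall>c\<in>A. \<forall>d\<in>A. holomorphic_map_on (overlap c d) (transition c d))"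

definition smooth_function :: "('m, 'n::finite) chart set \<Rightarrow> ('m \<Rightarrow> real) \<Rightarrow> bool" where
  "smooth_function A f \<longleftrightarrow> (\<forall>c\<in>A. smooth_on (chart_image c) (f \<circ> chart_inv c))"


section \<open>Alternating forms on the vector space\<close>

text \<open>A complex-valued real-multilinear \<open>k\<close>-form on \<open>\<complex>\<^sup>n\<close> takes its arguments as a sequence of
  vectors, of which only those with indices \<open>0, \<dots>, k - 1\<close> matter.\<close>

type_synonym 'n multiform = "(nat \<Rightarrow> complex^'n) \<Rightarrow> complex"

definition alternating_form :: "nat \<Rightarrow> 'n::finite multiform \<Rightarrow> bool" where
  "alternating_form k \<eta> \<longleftrightarrow>
     (\<forall>v w. (\<forall>i<k. v i = w i) \<longrightarrow> \<eta> v = \<eta> w) \<and>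
     (\<forall>v. \<forall>i<k. linear (\<lambda>u. \<eta> (v(i := u)))) \<and>
     (\<forall>v i j. i < j \<longrightarrow> j < k \<longrightarrow> v i = v j \<longrightarrow> \<eta> v = 0)"

text \<open>Wedge product of a \<open>k\<close>-form and an \<open>l\<close>-form, normalised so that
  \<open>(\<alpha> \<and> \<beta>)(v\<^sub>0, v\<^sub>1) = \<alpha>(v\<^sub>0) \<beta>(v\<^sub>1) - \<alpha>(v\<^sub>1) \<beta>(v\<^sub>0)\<close> for 1-forms.\<close>

definition wedge :: "nat \<Rightarrow> nat \<Rightarrow> 'n::finite multiform \<Rightarrow> 'n multiform \<Rightarrow> 'n multiform" where
  "wedge k l \<alpha> \<beta> = (\<lambda>v.
     (\<Sum>\<sigma> | \<sigma> permutes {..<k+l}.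
        of_int (sign \<sigma>) * \<alpha> (\<lambda>i. v (\<sigma> i)) * \<beta> (\<lambda>i. v (\<sigma> (k + i)))) / (fact k * fact l))"

primrec wedge_power :: "'n::finite multiform \<Rightarrow> nat \<Rightarrow> 'n multiform"
  \<comment> \<open>powers of a 2-form\<close>
where
  "wedge_power \<eta> 0 = (\<lambda>v. 1)"
| "wedge_power \<eta> (Suc k) = wedge 2 (2 * k) \<eta> (wedge_power \<eta> k)"

definition dz :: "'n::finite \<Rightarrow> 'n multiform" where
  "dz j = (\<lambda>v. v 0 $ j)"

definition dzbar :: "'n::finite \<Rightarrow> 'n multiform" where
  "dzbar j = (\<lambda>v. cnj (v 0 $ j))"

text \<open>Positive (1,1)-forms: \<open>\<i> \<Sum> h\<^sub>j\<^sub>k dz\<^sub>j \<and> dzbar\<^sub>k\<close> with \<open>h\<close> a positive definite Hermitian matrix.\<close>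

definition positive_11_form :: "'n::finite multiform \<Rightarrow> bool" where
  "positive_11_form \<eta> \<longleftrightarrow>
     (\<exists>h :: complex^'n^'n.
        (\<forall>j k. h $ k $ j = cnj (h $ j $ k)) \<and>
        (\<forall>u. u \<noteq> 0 \<longrightarrow> 0 < Re (\<Sum>j\<in>UNIV. \<Sum>k\<in>UNIV. h $ j $ k * (u $ j) * cnj (u $ k))) \<and>
        \<eta> = (\<lambda>v. \<i> * (\<Sum>j\<in>UNIV. \<Sum>k\<in>UNIV. h $ j $ k * wedge 1 1 (dz j) (dzbar k) v)))"


section \<open>Differential operators on forms in coordinates\<close>

type_synonym 'n local_form = "complex^'n \<Rightarrow> 'n multiform"

text \<open>The complex-linear and the antilinear part of a real-linear functional.  Applied to the
  differential of a function \<open>g\<close> they give \<open>\<Sum> (\<partial>g/\<partial>z\<^sub>j) dz\<^sub>j\<close> and \<open>\<Sum> (\<partial>g/\<partial>zbar\<^sub>j) dzbar\<^sub>j\<close>.\<close>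

definition linear_part :: "(complex^'n \<Rightarrow> complex) \<Rightarrow> complex^'n \<Rightarrow> complex" where
  "linear_part L u = (L u - \<i> * L (\<i> *s u)) / 2"

definition antilinear_part :: "(complex^'n \<Rightarrow> complex) \<Rightarrow> complex^'n \<Rightarrow> complex" where
  "antilinear_part L u = (L u + \<i> * L (\<i> *s u)) / 2"

definition omit :: "nat \<Rightarrow> (nat \<Rightarrow> 'a) \<Rightarrow> nat \<Rightarrow> 'a" where
  "omit i v = (\<lambda>j. if j < i then v j else v (Suc j))"

definition coeff_differential :: "'n::finite local_form \<Rightarrow> complex^'n \<Rightarrow> (nat \<Rightarrow> complex^'n) \<Rightarrow> complex^'n \<Rightarrow> complex" where
  "coeff_differential \<alpha> x w = frechet_derivative (\<lambda>y. \<alpha> y w) (at x)"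

text \<open>For a \<open>k\<close>-form \<open>\<alpha> = \<Sum> a\<^sub>I\<^sub>J dz\<^sub>I \<and> dzbar\<^sub>J\<close> the three operators below are
  \<open>\<Sum> da\<^sub>I\<^sub>J \<and> dz\<^sub>I \<and> dzbar\<^sub>J\<close>, with \<open>da\<^sub>I\<^sub>J\<close> replaced by its complex-linear part for \<open>\<partial>\<close> and by its
  antilinear part for \<open>\<partial>bar\<close>; the wedge product of a 1-form with a \<open>k\<close>-form is written out.\<close>

definition ext_d :: "nat \<Rightarrow> 'n::finite local_form \<Rightarrow> 'n local_form" where
  "ext_d k \<alpha> x v = (\<Sum>i\<le>k. (-1) ^ i * coeff_differential \<alpha> x (omit i v) (v i))"

definition del :: "nat \<Rightarrow> 'n::finite local_form \<Rightarrow> 'n local_form" where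
  "del k \<alpha> x v = (\<Sum>i\<le>k. (-1) ^ i * linear_part (coeff_differential \<alpha> x (omit i v)) (v i))"

definition delbar :: "nat \<Rightarrow> 'n::finite local_form \<Rightarrow> 'n local_form" where
  "delbar k \<alpha> x v = (\<Sum>i\<le>k. (-1) ^ i * antilinear_part (coeff_differential \<alpha> x (omit i v)) (v i))"


section \<open>Differential forms on a complex manifold\<close>

text \<open>A form on the manifold is given by its expressions in all charts of the atlas, related by
  pullback under the transition maps; only the values on the chart images matter.\<close>

type_synonym ('m, 'n) form = "('m, 'n) chart \<Rightarrow> 'n local_form"

definition smooth_form :: "('m, 'n::finite) chart set \<Rightarrow> nat \<Rightarrow> ('m, 'n) form \<Rightarrow> bool" where
  "smooth_form A k \<alpha> \<longleftrightarrow>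
     (\<forall>c\<in>A. \<forall>x\<in>chart_image c. alternating_form k (\<alpha> c x)) \<and>
     (\<forall>c\<in>A. \<forall>v. smooth_on (chart_image c) (\<lambda>x. \<alpha> c x v)) \<and>
     (\<forall>c\<in>A. \<forall>d\<in>A. \<forall>x\<in>overlap c d. \<forall>v.
        \<alpha> c x v = \<alpha> d (transition c d x)
                    (\<lambda>i. frechet_derivative (transition c d) (at x) (v i)))"

definition vanishes :: "('m, 'n::finite) chart set \<Rightarrow> ('m, 'n) form \<Rightarrow> bool" where
  "vanishes A \<alpha> \<longleftrightarrow> (\<forall>c\<in>A. \<forall>x\<in>chart_image c. \<forall>v. \<alpha> c x v = 0)"

definition scale_form :: "('m \<Rightarrow> real) \<Rightarrow> ('m, 'n::finite) form \<Rightarrow> ('m, 'n) form" where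
  "scale_form f \<alpha> c x v = of_real (f (chart_inv c x)) * \<alpha> c x v"

definition form_power :: "('m, 'n::finite) form \<Rightarrow> nat \<Rightarrow> ('m, 'n) form" where
  "form_power \<omega> k c x = wedge_power (\<omega> c x) k"

definition d_form :: "nat \<Rightarrow> ('m, 'n::finite) form \<Rightarrow> ('m, 'n) form" where
  "d_form k \<alpha> c = ext_d k (\<alpha> c)"

definition del_delbar_form :: "nat \<Rightarrow> ('m, 'n::finite) form \<Rightarrow> ('m, 'n) form" where
  "del_delbar_form k \<alpha> c = del (Suc k) (delbar k (\<alpha> c))"


section \<open>Hermitian, Kaehler and Gauduchon metrics\<close>

definition hermitian_metric :: "('m, 'n::finite) chart set \<Rightarrow> ('m, 'n) form \<Rightarrow> bool" where
  "hermitian_metric A \<omega> \<longleftrightarrow>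
     smooth_form A 2 \<omega> \<and> (\<forall>c\<in>A. \<forall>x\<in>chart_image c. positive_11_form (\<omega> c x))"

definition kaehler_metric :: "('m, 'n::finite) chart set \<Rightarrow> ('m, 'n) form \<Rightarrow> bool" where
  "kaehler_metric A \<omega> \<longleftrightarrow> hermitian_metric A \<omega> \<and> vanishes A (d_form 2 \<omega>)"

definition gauduchon_metric :: "('m, 'n::finite) chart set \<Rightarrow> ('m, 'n) form \<Rightarrow> bool" where
  "gauduchon_metric A \<omega> \<longleftrightarrow> hermitian_metric A \<omega> \<and>
     vanishes A (del_delbar_form (2 * (CARD('n) - 1)) (form_power \<omega> (CARD('n) - 1)))"

definition constant_sign :: "('m \<Rightarrow> real) \<Rightarrow> bool" where
  "constant_sign f \<longleftrightarrow> (\<forall>x. f x > 0) \<or> (\<forall>x. f x < 0) \<or> (\<forall>x. f x = 0)"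

end

theory Submission
  imports Defs "HOL-Complex_Analysis.Cauchy_Integral_Formula" "HOL-Library.Numeral_Type"
begin

text \<open>Tested against a function \<open>u\<close>, the form \<open>\<i>\<partial>\<partial>bar (f \<omega>\<^sup>n\<^sup>-\<^sup>1)\<close> gives \<open>\<integral> f L u\<close>, where \<open>L u = \<i>\<partial>\<partial>bar u \<and> \<omega>\<^sup>n\<^sup>-\<^sup>1\<close> is
  elliptic and annihilates constants.  If it vanishes, then \<open>\<integral> \<bar>f\<bar> L u \<ge> 0\<close> for \<open>u \<ge> 0\<close> by Kato's inequality.
  Summing over a partition of unity gives \<open>\<integral> \<bar>f\<bar> L 1 = 0\<close>, so \<open>\<integral> \<bar>f\<bar> L u = 0\<close> for every such \<open>u\<close>,
  and hence \<open>\<integral> max 0 f L u = 0\<close>.  If \<open>f\<close> changed sign, a Hopf barrier \<open>u\<close> at a ball that touches the closure of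
  \<open>{f > 0}\<close> from outside would make this integral positive.  So \<open>f \<ge> 0\<close> or \<open>f \<le> 0\<close>, and the Hopf lemma excludes
  interior zeros unless \<open>f\<close> is zero.  A nonconstant solution on a Gauduchon manifold is excluded by
  subtracting one of its values.

  For the second part, \<open>df \<and> \<omega> = - f d\<omega>\<close> bounds \<open>df\<close> by a multiple of \<open>f\<close> because \<open>n \<ge> 2\<close>, so the zero set
  of \<open>f\<close> is open by Gronwall's inequality.\<close>

section \<open>Functions of class \<open>C\<^sup>k\<close>\<close>

text \<open>The zeroth-order coefficient of \<open>f \<mapsto> \<i>\<partial>\<partial>bar (f
  \<omega>\<^sup>n\<^sup>-\<^sup>1)\<close> has unknown sign, so the maximum principle says nothing
  about \<open>f\<close> directly. The adjoint \<open>L\<close> has no such term; hence the sign of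
  \<open>f\<close> is studied through integrals against \<open>L u\<close>. Moreover |f| and max 0 f
  are not twice differentiable, so the derivatives must fall on \<open>u\<close>, and the first Hopf
  argument becomes the positivity of an integral. Once \<open>f \<ge> 0\<close>, a zero of
  \<open>f\<close> makes the sign of that coefficient harmless, and the pointwise Hopf lemma
  applies. No global measure is set up: an integral is computed in one chart, the integrand being
  the value of a form of top degree on the standard real basis. Two facts make it independent of the
  chart: second derivatives of holomorphic transitions drop out of \<i>\<partial>\<partial>bar, and
  their Jacobian determinants are nonnegative. Ellipticity is linear algebra at a point, in a basis
  orthogonal for \<omega>. In the second part auxiliary vectors are chosen at a single point, and
  the estimate on a whole neighbourhood follows by absorbing the error.\<close>

definition dder :: "('a::real_normed_vector \<Rightarrow> 'b::real_normed_vector) \<Rightarrow> 'a \<Rightarrow> 'a \<Rightarrow> 'b" where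
  "dder g u x = frechet_derivative g (at x) u"

text \<open>With the point as its last argument, \<open>dder g u\<close> is again a function on the
  space; the recursion of \<open>C_k_on\<close> and all iterated derivatives are then nested
  \<open>dder\<close>.\<close>

lemma C_k_on_Suc: "C_k_on (Suc k) S g \<longleftrightarrow> g differentiable_on S \<and> (\<forall>u. C_k_on k S (dder g u))"
  by (simp add: dder_def[abs_def])

declare C_k_on.simps(2)[simp del]

lemma dder_eq: "(g has_derivative g') (at x) \<Longrightarrow> dder g u x = g' u"
  by (simp add: dder_def frechet_derivative_at[symmetric])

lemma has_derivative_dder: "g differentiable (at x) \<Longrightarrow> (g has_derivative (\<lambda>u. dder g u x)) (at x)"
  by (simp add: dder_def[abs_def] frechet_derivative_works)

lemma dder_cong:
  assumes "open S" "x \<in> S" "\<And>y. y \<in> S \<Longrightarrow> f y = g y"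
  shows "dder f u x = dder g u x"
proof -
  have "(f has_derivative D) (at x) \<longleftrightarrow> (g has_derivative D) (at x)" for D
    using has_derivative_transform_within_open[OF _ assms(1,2)] assms(3) by metis
  then show ?thesis by (simp add: dder_def frechet_derivative_def)
qed

lemma C_k_on_imp_differentiable: "C_k_on (Suc k) S g \<Longrightarrow> open S \<Longrightarrow> x \<in> S \<Longrightarrow> g differentiable (at x)"
  by (metis C_k_on_Suc differentiable_on_eq_differentiable_at)

lemma C_k_on_imp_has_derivative:
  "C_k_on (Suc k) S g \<Longrightarrow> open S \<Longrightarrow> x \<in> S \<Longrightarrow> (g has_derivative (\<lambda>u. dder g u x)) (at x)"
  by (rule has_derivative_dder, rule C_k_on_imp_differentiable)

lemma C_k_on_dder: "C_k_on (Suc k) S g \<Longrightarrow> C_k_on k S (dder g u)"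
  by (simp add: C_k_on_Suc)

lemma C_k_on_SucI:
  assumes "open S" "\<And>x. x \<in> S \<Longrightarrow> (g has_derivative g' x) (at x)" "\<And>u. C_k_on k S (dder g u)"
  shows "C_k_on (Suc k) S g"
  using assms by (auto simp: C_k_on_Suc differentiable_on_def differentiable_def intro: has_derivative_at_withinI)

lemma C_k_on_imp_continuous: "C_k_on k S g \<Longrightarrow> continuous_on S g"
  by (cases k) (auto simp: C_k_on_Suc differentiable_imp_continuous_on)

lemma C_k_on_lower: "C_k_on (Suc k) S g \<Longrightarrow> C_k_on k S g"
proof (induction k arbitrary: g)
  case 0 then show ?case by (simp add: C_k_on_imp_continuous)
next
  case (Suc k) then show ?case by (subst C_k_on_Suc) (simp add: C_k_on_Suc[of "Suc k"])
qed

lemma C_k_on_cong: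
  assumes "open S" "\<And>x. x \<in> S \<Longrightarrow> f x = g x"
  shows "C_k_on k S f \<longleftrightarrow> C_k_on k S g"
  using assms(2)
proof (induction k arbitrary: f g)
  case 0 then show ?case by (simp cong: continuous_on_cong)
next
  case (Suc k)
  have "f differentiable_on S \<longleftrightarrow> g differentiable_on S"
    unfolding differentiable_on_def differentiable_def
    using Suc.prems by (metis has_derivative_transform)
  moreover have "C_k_on k S (dder f u) \<longleftrightarrow> C_k_on k S (dder g u)" for u
    using Suc.prems by (intro Suc.IH dder_cong[OF assms(1)])
  ultimately show ?case by (simp add: C_k_on_Suc)
qed

lemma C_k_on_subset: "C_k_on k S g \<Longrightarrow> T \<subseteq> S \<Longrightarrow> C_k_on k T g"
  by (induction k arbitrary: g) (auto simp: C_k_on_Suc intro: continuous_on_subset differentiable_on_subset)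

lemma C_k_on_local:
  assumes "open S" "\<And>x. x \<in> S \<Longrightarrow> \<exists>T. open T \<and> x \<in> T \<and> C_k_on k T g"
  shows "C_k_on k S g"
  using assms(2)
proof (induction k arbitrary: g)
  case 0
  have "continuous (at x) g" if "x \<in> S" for x
    using 0[OF that] by (auto simp: continuous_on_eq_continuous_at)
  then show ?case by (simp add: continuous_at_imp_continuous_on)
next
  case (Suc k)
  have "g differentiable (at x)" if "x \<in> S" for x
    using Suc.prems[OF that] C_k_on_imp_differentiable by blast
  moreover have "C_k_on k S (dder g u)" for u
    using Suc.prems by (intro Suc.IH) (meson C_k_on_dder)
  ultimately show ?case
    by (auto simp: C_k_on_Suc differentiable_on_def intro: differentiable_at_withinI)
qed

lemma C_k_on_const [simp]: "C_k_on k S (\<lambda>x. c)"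
proof (induction k arbitrary: c)
  case (Suc k)
  have "dder (\<lambda>x. c) u = (\<lambda>x. 0)" for u :: 'a by (rule ext) (rule dder_eq[OF has_derivative_const])
  with Suc show ?case by (simp add: C_k_on_Suc)
qed simp

lemma C_k_on_add:
  assumes "open S" "C_k_on k S f" "C_k_on k S g"
  shows "C_k_on k S (\<lambda>x. f x + g x)"
  using assms(2,3)
proof (induction k arbitrary: f g)
  case (Suc k)
  have d: "((\<lambda>x. f x + g x) has_derivative (\<lambda>u. dder f u x + dder g u x)) (at x)" if "x \<in> S" for x
    using Suc.prems assms(1) that by (intro has_derivative_add C_k_on_imp_has_derivative[where k=k])
  have "C_k_on k S (dder (\<lambda>x. f x + g x) u)" for u
  proof (subst C_k_on_cong[OF assms(1)])
    show "dder (\<lambda>x. f x + g x) u x = dder f u x + dder g u x" if "x \<in> S" for x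
      using d[OF that] by (rule dder_eq)
    show "C_k_on k S (\<lambda>x. dder f u x + dder g u x)"
      by (rule Suc.IH) (use Suc.prems C_k_on_dder in blast)+
  qed
  with d show ?case by (rule C_k_on_SucI[OF assms(1)])
qed (auto intro: continuous_intros)

lemma C_k_on_sum:
  assumes "open S" "\<And>i. i \<in> I \<Longrightarrow> C_k_on k S (f i)"
  shows "C_k_on k S (\<lambda>x. \<Sum>i\<in>I. f i x)"
  using assms(2) by (induction I rule: infinite_finite_induct) (auto intro: C_k_on_add[OF assms(1)])

lemma C_k_on_bilinear:
  assumes "bounded_bilinear p" "open S" "C_k_on k S f" "C_k_on k S g"
  shows "C_k_on k S (\<lambda>x. p (f x) (g x))"
  using assms(3,4)
proof (induction k arbitrary: f g)
  case 0 then show ?case by (auto intro: bounded_bilinear.continuous_on[OF assms(1)])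
next
  case (Suc k)
  have d: "((\<lambda>x. p (f x) (g x)) has_derivative (\<lambda>u. p (f x) (dder g u x) + p (dder f u x) (g x))) (at x)"
    if "x \<in> S" for x
    using Suc.prems assms(2) that by (intro bounded_bilinear.FDERIV[OF assms(1)] C_k_on_imp_has_derivative[where k=k])
  have "C_k_on k S (dder (\<lambda>x. p (f x) (g x)) u)" for u
  proof (subst C_k_on_cong[OF assms(2)])
    show "dder (\<lambda>x. p (f x) (g x)) u x = p (f x) (dder g u x) + p (dder f u x) (g x)" if "x \<in> S" for x
      using d[OF that] by (rule dder_eq)
    show "C_k_on k S (\<lambda>x. p (f x) (dder g u x) + p (dder f u x) (g x))"
      by (intro C_k_on_add[OF assms(2)] Suc.IH) (use Suc.prems C_k_on_dder C_k_on_lower in blast)+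
  qed
  with d show ?case by (rule C_k_on_SucI[OF assms(2)])
qed

lemma C_k_on_linear:
  assumes "bounded_linear h" "open S" "C_k_on k S g"
  shows "C_k_on k S (\<lambda>x. h (g x))"
  using assms(3)
proof (induction k arbitrary: g)
  case 0 then show ?case by (auto intro: bounded_linear.continuous_on[OF assms(1)])
next
  case (Suc k)
  have d: "((\<lambda>x. h (g x)) has_derivative (\<lambda>u. h (dder g u x))) (at x)" if "x \<in> S" for x
    using Suc.prems assms(2) that by (intro bounded_linear.has_derivative[OF assms(1)] C_k_on_imp_has_derivative[where k=k])
  have "C_k_on k S (dder (\<lambda>x. h (g x)) u)" for u
  proof (subst C_k_on_cong[OF assms(2)])
    show "dder (\<lambda>x. h (g x)) u x = h (dder g u x)" if "x \<in> S" for x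
      using d[OF that] by (rule dder_eq)
    show "C_k_on k S (\<lambda>x. h (dder g u x))"
      by (intro Suc.IH) (use Suc.prems C_k_on_dder in blast)
  qed
  with d show ?case by (rule C_k_on_SucI[OF assms(2)])
qed

lemmas C_k_on_mult = C_k_on_bilinear[OF bounded_bilinear_mult]
lemmas C_k_on_scaleR = C_k_on_bilinear[OF bounded_bilinear_scaleR]

lemma C_k_on_id:
  assumes "open S" shows "C_k_on k S (\<lambda>x. x)"
proof (cases k)
  case (Suc j)
  have "C_k_on j S (dder (\<lambda>x. x) u)" for u :: 'a
    by (subst C_k_on_cong[OF assms, of _ "\<lambda>x. u"]) (auto intro: dder_eq)
  then show ?thesis unfolding Suc by (intro C_k_on_SucI[OF assms has_derivative_ident])
qed (auto intro: continuous_intros)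

lemma has_derivative_euclidean_sum:
  fixes g :: "'a::euclidean_space \<Rightarrow> 'b::real_normed_vector"
  assumes "(g has_derivative g') (at y)"
  shows "g' v = (\<Sum>b\<in>Basis. (v \<bullet> b) *\<^sub>R dder g b y)"
proof -
  interpret bounded_linear g' using assms by (rule has_derivative_bounded_linear)
  have "g' v = g' (\<Sum>b\<in>Basis. (v \<bullet> b) *\<^sub>R b)" by (simp add: euclidean_representation)
  also have "\<dots> = (\<Sum>b\<in>Basis. (v \<bullet> b) *\<^sub>R g' b)" by (simp add: sum scale)
  finally show ?thesis by (simp add: dder_eq[OF assms])
qed

lemma dder_compose:
  fixes g :: "'a::euclidean_space \<Rightarrow> 'b::real_normed_vector"
  assumes "C_k_on (Suc k) S \<tau>" "C_k_on (Suc j) T g" "open S" "open T" "x \<in> S" "\<tau> x \<in> T"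
  shows "((\<lambda>x. g (\<tau> x)) has_derivative (\<lambda>u. dder g (dder \<tau> u x) (\<tau> x))) (at x)"
  using diff_chain_at[OF C_k_on_imp_has_derivative[OF assms(1,3,5)] C_k_on_imp_has_derivative[OF assms(2,4,6)]]
  by (simp add: o_def)

text \<open>The chain rule leaves a derivative of \<open>g\<close> in the moving direction
  \<open>dder \<tau> u x\<close>, to which the induction hypothesis does not apply. Expanding this
  direction in the standard basis gives a sum of products with derivatives of \<open>g\<close> in
  fixed directions.\<close>

lemma C_k_on_compose:
  fixes \<tau> :: "'c::euclidean_space \<Rightarrow> 'a::euclidean_space" and g :: "'a \<Rightarrow> 'b::real_normed_vector"
  assumes "open S" "open T" "C_k_on k S \<tau>" "C_k_on k T g" "\<tau> ` S \<subseteq> T"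
  shows "C_k_on k S (\<lambda>x. g (\<tau> x))"
  using assms(3,4)
proof (induction k arbitrary: g)
  case 0 then show ?case using assms(5) by (auto intro: continuous_on_compose2)
next
  case (Suc k)
  have T: "x \<in> S \<Longrightarrow> \<tau> x \<in> T" for x using assms(5) by auto
  note d = dder_compose[OF Suc.prems assms(1,2) _ T]
  have "C_k_on k S (dder (\<lambda>x. g (\<tau> x)) u)" for u
  proof (subst C_k_on_cong[OF assms(1)])
    show "dder (\<lambda>x. g (\<tau> x)) u x = (\<Sum>b\<in>Basis. (dder \<tau> u x \<bullet> b) *\<^sub>R dder g b (\<tau> x))" if "x \<in> S" for x
      unfolding dder_eq[OF d[OF that that]]
      by (rule has_derivative_euclidean_sum[OF C_k_on_imp_has_derivative[OF Suc.prems(2) assms(2) T[OF that]]])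
    show "C_k_on k S (\<lambda>x. \<Sum>b\<in>Basis. (dder \<tau> u x \<bullet> b) *\<^sub>R dder g b (\<tau> x))"
      using Suc.prems
      by (intro C_k_on_sum C_k_on_scaleR assms(1) Suc.IH C_k_on_linear[OF bounded_linear_inner_left])
         (auto intro: C_k_on_dder C_k_on_lower)
  qed
  with d show ?case by (intro C_k_on_SucI[OF assms(1)])
qed

section \<open>Integration by parts\<close>

lemma absolutely_integrable_compact_support:
  fixes F :: "'a::euclidean_space \<Rightarrow> real"
  assumes "continuous_on S F" "compact K" "K \<subseteq> S" "\<And>x. x \<in> S - K \<Longrightarrow> F x = 0"
  shows "F absolutely_integrable_on S"
proof -
  have "continuous_on K F" using assms(1,3) by (rule continuous_on_subset)
  then have "integrable lborel (\<lambda>x. indicator K x *\<^sub>R F x)"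
    by (rule borel_integrable_compact[OF assms(2)])
  moreover have "(\<lambda>x. indicator K x *\<^sub>R F x) = (\<lambda>x. indicator S x *\<^sub>R F x)"
    using assms(3,4) by (auto simp: indicator_def fun_eq_iff)
  ultimately show ?thesis
    unfolding set_integrable_def by (simp add: integrable_completion borel_measurable_integrable)
qed

lemma integrable_compact_support:
  fixes F :: "'a::euclidean_space \<Rightarrow> real"
  assumes "continuous_on S F" "compact K" "K \<subseteq> S" "\<And>x. x \<in> S - K \<Longrightarrow> F x = 0"
  shows "F integrable_on S"
  using absolutely_integrable_compact_support[OF assms] set_lebesgue_integral_eq_integral(1) by blast

lemma integral_compact_support_subset:
  fixes F :: "'a::euclidean_space \<Rightarrow> real"
  assumes "T \<subseteq> S" "\<And>x. x \<in> S - T \<Longrightarrow> F x = 0"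
  shows "integral S F = integral T F"
proof -
  have "(\<lambda>x. if x \<in> S then F x else 0) = (\<lambda>x. if x \<in> T then F x else 0)"
    using assms by (auto simp: fun_eq_iff)
  then show ?thesis using integral_restrict_UNIV[of S F] integral_restrict_UNIV[of T F] by simp
qed

lemma integral_pos_continuous:
  fixes F :: "'a::euclidean_space \<Rightarrow> real"
  assumes "open S" "continuous_on S F" "F integrable_on S" "\<And>x. x \<in> S \<Longrightarrow> 0 \<le> F x" "p \<in> S" "0 < F p"
  shows "0 < integral S F"
proof -
  have "isCont F p" using assms(1,2,5) by (simp add: continuous_on_eq_continuous_at)
  then have "eventually (\<lambda>x. F p / 2 < F x) (nhds p)"
    using assms(6) by (intro order_tendstoD(1)[of F "F p"]) (simp_all add: isCont_def tendsto_at_iff_tendsto_nhds)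
  moreover have "eventually (\<lambda>x. x \<in> S) (nhds p)" using assms(1,5) by (rule eventually_nhds_in_open)
  ultimately have "eventually (\<lambda>x. x \<in> S \<and> F p / 2 < F x) (nhds p)" by eventually_elim auto
  then obtain T where T: "open T" "p \<in> T" "\<And>x. x \<in> T \<Longrightarrow> x \<in> S \<and> F p / 2 < F x"
    by (auto simp: eventually_nhds)
  then obtain a b where ab: "p \<in> box a b" "cbox a b \<subseteq> T" by (meson open_contains_cbox)
  have pos: "0 < measure lborel (cbox a b)" using ab(1) by (auto simp: mem_box content_pos_lt_eq intro: less_trans)
  have "measure lborel (cbox a b) * (F p / 2) = integral (cbox a b) (\<lambda>x. F p / 2)" by simp
  also have "\<dots> \<le> integral (cbox a b) F"
  proof (rule integral_le)
    show "F integrable_on cbox a b"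
      using T ab(2) by (intro integrable_continuous continuous_on_subset[OF assms(2)]) auto
    show "(\<lambda>x. F p / 2) integrable_on cbox a b" by (rule integrable_const)
  qed (use T ab(2) in force)
  also have "\<dots> \<le> integral S F"
    using T ab(2) assms(2,3,4)
    by (intro integral_subset_le integrable_continuous continuous_on_subset[OF assms(2)]) blast+
  finally show ?thesis using mult_pos_pos[OF pos, of "F p / 2"] assms(6) by linarith
qed

text \<open>The integrals of the translates of \<open>F\<close> do not depend on the translation; differentiate.\<close>

lemma integral_dder_UNIV:
  fixes F :: "'a::euclidean_space \<Rightarrow> real"
  assumes F: "C_k_on (Suc 0) UNIV F" and K: "compact K" "\<And>x. x \<notin> K \<Longrightarrow> F x = 0"
  shows "integral UNIV (dder F u) = 0"
proof -
  \<comment> \<open>This set contains all translates of \<open>K\<close> by \<open>r u\<close> with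
    |r| at most 1. One box around it supports every translated function, so the Leibniz rule on a
    box applies.\<close>
  let ?K = "(\<lambda>(x, r). x + r *\<^sub>R u) ` (K \<times> {-1..1})"
  have "compact ?K"
    by (intro compact_continuous_image compact_Times K compact_Icc)
       (auto intro!: continuous_intros simp: split_beta)
  then obtain a where a: "?K \<subseteq> cbox (-a) a"
    using bounded_subset_cbox_symmetric[OF compact_imp_bounded] by blast
  have sub: "x + r *\<^sub>R u \<notin> K" if "x \<notin> cbox (-a) a" "\<bar>r\<bar> \<le> 1" for x r
  proof
    assume "x + r *\<^sub>R u \<in> K"
    then have "(\<lambda>(x, r). x + r *\<^sub>R u) (x + r *\<^sub>R u, - r) \<in> ?K" using that(2) by (intro imageI) auto
    with a that(1) show False by auto
  qed
  have dz: "dder F u x = 0" if "x \<notin> K" for x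
  proof -
    have "dder F u x = dder (\<lambda>x. 0) u x"
      using K that by (intro dder_cong[of "- K"]) (auto simp: compact_imp_closed)
    then show ?thesis using dder_eq[OF has_derivative_const] by metis
  qed
  have K_box: "x \<in> K \<Longrightarrow> x \<in> cbox (-a) a" for x using sub[of x 0] by auto
  have d: "(F has_derivative (\<lambda>u. dder F u x)) (at x)" for x
    using F by (rule C_k_on_imp_has_derivative) auto
  have "((\<lambda>r. F (x + r *\<^sub>R u)) has_vector_derivative dder F u (x + r *\<^sub>R u)) (at r within T)" for x r T
  proof -
    have "((\<lambda>r. F (x + r *\<^sub>R u)) has_derivative (\<lambda>h. dder F (h *\<^sub>R u) (x + r *\<^sub>R u))) (at r within T)"
      by (rule has_derivative_compose[OF _ d]) (auto intro!: derivative_eq_intros)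
    then show ?thesis
      using linear_scale[OF has_derivative_linear[OF d]] by (simp add: has_vector_derivative_def)
  qed
  moreover have contF: "continuous_on UNIV F" using C_k_on_imp_continuous[OF F] .
  moreover have contD: "continuous_on UNIV (dder F u)" using F by (simp add: C_k_on_Suc)
  ultimately have D: "((\<lambda>r. integral (cbox (-a) a) (\<lambda>x. F (x + r *\<^sub>R u))) has_vector_derivative
      integral (cbox (-a) a) (\<lambda>x. dder F u (x + 0 *\<^sub>R u))) (at 0 within {-1..1})"
    by (intro leibniz_rule_vector_derivative[where f="\<lambda>r x. F (x + r *\<^sub>R u)" and fx = "\<lambda>r x. dder F u (x + r *\<^sub>R u)"])
       (auto intro!: integrable_continuous continuous_intros continuous_on_compose2[of UNIV F]
         continuous_on_compose2[of UNIV "dder F u"] simp: split_beta)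
  have E: "integral UNIV F = integral (cbox (-a) a) (\<lambda>x. F (x + r *\<^sub>R u))" if "r \<in> {-1..1}" for r
  proof -
    have "F integrable_on cbox (- a + r *\<^sub>R u) (a + r *\<^sub>R u)"
      by (intro integrable_continuous continuous_on_subset[OF contF]) auto
    then have "integral (cbox (-a) a) (\<lambda>x. F (x + r *\<^sub>R u)) = integral (cbox (- a + r *\<^sub>R u) (a + r *\<^sub>R u)) F"
      using has_integral_shift_cbox_iff[of F "r *\<^sub>R u" _ "- a" a]
      by (intro integral_unique) (simp add: has_integral_integral o_def add.commute)
    also have "\<dots> = integral UNIV F"
    proof (rule integral_compact_support_subset[symmetric])
      fix x assume x: "x \<in> UNIV - cbox (- a + r *\<^sub>R u) (a + r *\<^sub>R u)"
      then have "x - r *\<^sub>R u \<notin> cbox (-a) a"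
        by (auto simp: mem_box algebra_simps)
      then have "(x - r *\<^sub>R u) + r *\<^sub>R u \<notin> K" using that by (intro sub) auto
      then show "F x = 0" using K(2) by simp
    qed auto
    finally show ?thesis by simp
  qed
  have "((\<lambda>r::real. integral UNIV F) has_vector_derivative integral (cbox (-a) a) (\<lambda>x. dder F u (x + 0 *\<^sub>R u)))
      (at 0 within {-1..1})"
    by (rule has_vector_derivative_transform[OF _ E D]) simp_all
  then have "integral (cbox (-a) a) (\<lambda>x. dder F u (x + 0 *\<^sub>R u)) = 0"
    using has_vector_derivative_const
    by (rule vector_derivative_unique_within_closed_interval[of "-1" 1, unfolded box_real, rotated 2]) auto
  then have "integral (cbox (-a) a) (dder F u) = 0" by simp
  moreover have "integral UNIV (dder F u) = integral (cbox (-a) a) (dder F u)"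
    using dz K_box by (intro integral_compact_support_subset) auto
  ultimately show ?thesis by simp
qed

text \<open>The open sets \<open>S\<close> and \<open>- K\<close> cover the space; the extended
  function equals \<open>F\<close> on the first and 0 on the second.\<close>

lemma C_k_on_extend_zero:
  fixes F :: "'a::euclidean_space \<Rightarrow> 'b::real_normed_vector"
  assumes "open S" "C_k_on k S F" "closed K" "K \<subseteq> S" "\<And>x. x \<in> S - K \<Longrightarrow> F x = 0"
  shows "C_k_on k UNIV (\<lambda>x. if x \<in> S then F x else 0)"
proof (rule C_k_on_local[OF open_UNIV])
  fix x
  show "\<exists>T. open T \<and> x \<in> T \<and> C_k_on k T (\<lambda>x. if x \<in> S then F x else 0)"
  proof (cases "x \<in> S")
    case True
    have "C_k_on k S (\<lambda>x. if x \<in> S then F x else 0)"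
      by (subst C_k_on_cong[OF assms(1), where g=F]) (use assms in auto)
    with True assms(1) show ?thesis by blast
  next
    case False
    have o: "open (- K)" using assms(3) by auto
    have "C_k_on k (- K) (\<lambda>x. if x \<in> S then F x else 0)"
      by (subst C_k_on_cong[OF o, where g="\<lambda>x. 0"]) (use assms in auto)
    with False assms(4) o show ?thesis by blast
  qed
qed

lemma integral_dder_compact_support:
  fixes F :: "'a::euclidean_space \<Rightarrow> real"
  assumes "open S" "C_k_on (Suc 0) S F" "compact K" "K \<subseteq> S" "\<And>x. x \<in> S - K \<Longrightarrow> F x = 0"
  shows "integral S (dder F u) = 0"
proof -
  let ?F = "\<lambda>x. if x \<in> S then F x else 0"
  have "C_k_on (Suc 0) UNIV ?F"
    using assms by (intro C_k_on_extend_zero[OF _ _ compact_imp_closed]) auto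
  then have "integral UNIV (dder ?F u) = 0"
    using assms(3-5) by (intro integral_dder_UNIV[where K=K]) auto
  also have "integral UNIV (dder ?F u) = integral S (dder ?F u)"
  proof (rule integral_compact_support_subset)
    fix x assume "x \<in> UNIV - S"
    then have "dder ?F u x = dder (\<lambda>x. 0) u x"
      using assms by (intro dder_cong[of "- K"]) (auto simp: compact_imp_closed)
    then show "dder ?F u x = 0" using dder_eq[OF has_derivative_const] by metis
  qed auto
  also have "\<dots> = integral S (dder F u)"
    by (intro integral_cong dder_cong[OF assms(1)]) auto
  finally show ?thesis .
qed

lemma dder_mult:
  fixes f g :: "'a::euclidean_space \<Rightarrow> 'b::real_normed_algebra"
  assumes "open S" "x \<in> S" "C_k_on (Suc k) S f" "C_k_on (Suc k) S g"
  shows "dder (\<lambda>x. f x * g x) u x = f x * dder g u x + dder f u x * g x"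
  by (rule dder_eq) (intro has_derivative_mult C_k_on_imp_has_derivative[where k=k, OF _ assms(1,2)] assms)

lemma dder_zero_off_support:
  assumes "open S" "closed K" "\<And>x. x \<in> S - K \<Longrightarrow> F x = 0" "x \<in> S - K"
  shows "dder F u x = 0"
proof -
  have "dder F u x = dder (\<lambda>x. 0) u x"
    using assms by (intro dder_cong[of "S - K"]) auto
  then show ?thesis using dder_eq[OF has_derivative_const] by metis
qed

lemma integral_by_parts_compact_support:
  fixes f g :: "'a::euclidean_space \<Rightarrow> real"
  assumes "open S" "C_k_on (Suc 0) S f" "C_k_on (Suc 0) S g" "compact K" "K \<subseteq> S"
    "\<And>x. x \<in> S - K \<Longrightarrow> f x = 0"
  shows "integral S (\<lambda>x. f x * dder g u x) = - integral S (\<lambda>x. dder f u x * g x)"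
proof -
  have dz: "x \<in> S - K \<Longrightarrow> dder f u x = 0" for x
    using dder_zero_off_support[of S K f] assms compact_imp_closed by blast
  note c = C_k_on_imp_continuous[OF assms(2)] C_k_on_imp_continuous[OF assms(3)]
     C_k_on_dder[OF assms(2), simplified] C_k_on_dder[OF assms(3), simplified]
  have i: "(\<lambda>x. f x * dder g u x) integrable_on S" "(\<lambda>x. dder f u x * g x) integrable_on S"
    using assms dz by (auto intro!: integrable_compact_support[where K=K] continuous_intros c)
  have "0 = integral S (dder (\<lambda>x. f x * g x) u)"
    using assms by (subst integral_dder_compact_support[where K=K]) (auto intro: C_k_on_mult)
  also have "\<dots> = integral S (\<lambda>x. f x * dder g u x + dder f u x * g x)"
    using assms by (intro integral_cong dder_mult[where k=0]) auto
  finally show ?thesis using i by (simp add: integral_add)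
qed

section \<open>Elliptic operators in double-divergence form\<close>

lemma dder_linear:
  assumes "C_k_on (Suc k) S g" "open S" "x \<in> S"
  shows "linear (\<lambda>u. dder g u x)"
  using C_k_on_imp_has_derivative[OF assms] by (rule has_derivative_linear)

lemma bilinear_dder2:
  assumes g: "C_k_on (Suc (Suc 0)) S g" and "open S" "x \<in> S"
  shows "bilinear (\<lambda>u v. dder (dder g v) u x)"
  unfolding bilinear_def
proof safe
  fix v show "linear (\<lambda>u. dder (dder g v) u x)"
    using C_k_on_dder[OF g] assms(2,3) by (rule dder_linear)
next
  fix u
  show "linear (\<lambda>v. dder (dder g v) u x)"
  proof (rule linearI)
    fix v w
    have "dder (dder g (v + w)) u x = dder (\<lambda>y. dder g v y + dder g w y) u x"
      by (intro dder_cong[OF assms(2,3)] linear_add[OF dder_linear[OF g assms(2)]])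
    also have "\<dots> = dder (dder g v) u x + dder (dder g w) u x"
      by (rule dder_eq) (intro has_derivative_add C_k_on_imp_has_derivative[OF C_k_on_dder[OF g] assms(2,3)])
    finally show "dder (dder g (v + w)) u x = dder (dder g v) u x + dder (dder g w) u x" .
  next
    fix c v
    have "dder (dder g (c *\<^sub>R v)) u x = dder (\<lambda>y. c *\<^sub>R dder g v y) u x"
      by (intro dder_cong[OF assms(2,3)] linear_scale[OF dder_linear[OF g assms(2)]])
    also have "\<dots> = c *\<^sub>R dder (dder g v) u x"
      by (rule dder_eq) (intro has_derivative_scaleR_right C_k_on_imp_has_derivative[OF C_k_on_dder[OF g] assms(2,3)])
    finally show "dder (dder g (c *\<^sub>R v)) u x = c *\<^sub>R dder (dder g v) u x" .
  qed
qed

lemma dder2_mult: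
  fixes f g :: "'a::euclidean_space \<Rightarrow> real"
  assumes f: "C_k_on (Suc (Suc 0)) S f" and g: "C_k_on (Suc (Suc 0)) S g" and S: "open S" "x \<in> S"
  shows "dder (dder (\<lambda>y. f y * g y) v) u x =
    f x * dder (dder g v) u x + dder f u x * dder g v x + dder f v x * dder g u x + dder (dder f v) u x * g x"
proof -
  have "dder (dder (\<lambda>y. f y * g y) v) u x = dder (\<lambda>y. f y * dder g v y + dder f v y * g y) u x"
    by (intro dder_cong[OF S] dder_mult[OF S(1) _ f g])
  also have "\<dots> = (f x * dder (dder g v) u x + dder f u x * dder g v x) +
      (dder f v x * dder g u x + dder (dder f v) u x * g x)"
    using f g by (intro dder_eq has_derivative_add has_derivative_mult C_k_on_imp_has_derivative[OF _ S])
      (auto intro: C_k_on_dder)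
  finally show ?thesis by (simp add: algebra_simps)
qed

lemma C_2_real:
  fixes \<psi> :: "real \<Rightarrow> real"
  assumes "open T" "\<And>r. r \<in> T \<Longrightarrow> (\<psi> has_real_derivative \<psi>' r) (at r)"
    "\<And>r. r \<in> T \<Longrightarrow> (\<psi>' has_real_derivative \<psi>'' r) (at r)" "continuous_on T \<psi>''"
  shows "C_k_on (Suc (Suc 0)) T \<psi>"
proof -
  have 1: "C_k_on (Suc 0) T \<psi>'"
  proof (rule C_k_on_SucI[OF assms(1)])
    show "(\<psi>' has_derivative (*) (\<psi>'' r)) (at r)" if "r \<in> T" for r
      using assms(3)[OF that] by (simp add: has_field_derivative_def)
    then show "C_k_on 0 T (dder \<psi>' u)" for u
      using assms(4) by (subst C_k_on_cong[OF assms(1), where g="\<lambda>r. \<psi>'' r * u"])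
        (auto intro!: continuous_intros dder_eq)
  qed
  show ?thesis
  proof (rule C_k_on_SucI[OF assms(1)])
    show "(\<psi> has_derivative (*) (\<psi>' r)) (at r)" if "r \<in> T" for r
      using assms(2)[OF that] by (simp add: has_field_derivative_def)
    then show "C_k_on (Suc 0) T (dder \<psi> u)" for u
      using 1 assms(1) by (subst C_k_on_cong[OF assms(1), where g="\<lambda>r. \<psi>' r * u"])
        (auto intro!: C_k_on_mult dder_eq)
  qed
qed

lemma dder_compose_real:
  fixes \<psi> :: "real \<Rightarrow> real"
  assumes "(g has_derivative (\<lambda>u. dder g u x)) (at x)" "(\<psi> has_real_derivative d) (at (g x))"
  shows "((\<lambda>y. \<psi> (g y)) has_derivative (\<lambda>u. d * dder g u x)) (at x)"
  using has_derivative_compose[OF assms(1), of \<psi> "(*) d"] assms(2) by (simp add: has_field_derivative_def)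

lemma dder2_compose_real:
  fixes \<psi> :: "real \<Rightarrow> real" and g :: "'a::euclidean_space \<Rightarrow> real"
  assumes g: "C_k_on (Suc (Suc 0)) S g" and S: "open S" "x \<in> S"
    and "open T" "g ` S \<subseteq> T" "\<And>r. r \<in> T \<Longrightarrow> (\<psi> has_real_derivative \<psi>' r) (at r)"
    "\<And>r. r \<in> T \<Longrightarrow> (\<psi>' has_real_derivative \<psi>'' r) (at r)"
  shows "dder (dder (\<lambda>y. \<psi> (g y)) v) u x = \<psi>'' (g x) * dder g u x * dder g v x + \<psi>' (g x) * dder (dder g v) u x"
proof -
  have T: "y \<in> S \<Longrightarrow> g y \<in> T" for y using assms by auto
  note d = C_k_on_imp_has_derivative[OF g S(1)]
  have "dder (dder (\<lambda>y. \<psi> (g y)) v) u x = dder (\<lambda>y. \<psi>' (g y) * dder g v y) u x"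
    using T by (intro dder_cong[OF S] dder_eq[OF dder_compose_real[OF d]] assms)
  also have "\<dots> = \<psi>' (g x) * dder (dder g v) u x + \<psi>'' (g x) * dder g u x * dder g v x"
    using T S by (intro dder_eq has_derivative_mult dder_compose_real[OF d]
      C_k_on_imp_has_derivative[OF C_k_on_dder[OF g] S] assms) auto
  finally show ?thesis by simp
qed

text \<open>Along the line through \<open>x\<close> in direction \<open>u\<close> the first
  derivative vanishes at 0. A negative second derivative would make it negative just to the right,
  so \<open>w\<close> would drop below its minimum.\<close>

lemma second_derivative_test_min:
  fixes w :: "'a::euclidean_space \<Rightarrow> real"
  assumes w: "C_k_on (Suc (Suc 0)) S w" and S: "open S" "x \<in> S" and min: "\<And>y. y \<in> S \<Longrightarrow> w x \<le> w y"
  shows "dder w u x = 0" "0 \<le> dder (dder w u) u x"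
proof -
  note d = C_k_on_imp_has_derivative[OF w S(1)]
  have z: "dder w v x = 0" for v
  proof -
    have "(\<lambda>u. dder w u x) = (\<lambda>u. 0)"
      using S min eventually_nhds_in_open[OF S]
      by (intro differential_zero_maxmin[OF S(2,1) d[OF S(2)]]) auto
    then show ?thesis by meson
  qed
  then show "dder w u x = 0" .
  show "0 \<le> dder (dder w u) u x"
  proof (rule ccontr)
    assume neg: "\<not> 0 \<le> dder (dder w u) u x"
    let ?\<gamma> = "\<lambda>r::real. x + r *\<^sub>R u"
    have \<gamma>: "(?\<gamma> has_derivative (\<lambda>h. h *\<^sub>R u)) (at r)" for r by (auto intro!: derivative_eq_intros)
    have sc: "(\<lambda>h. dder f (h *\<^sub>R u) y) = (*) (dder f u y)" if "C_k_on (Suc k) S f" "y \<in> S" for f k y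
      using linear_scale[OF dder_linear[OF that(1) S(1) that(2)]] by (simp add: fun_eq_iff)
    have 1: "((\<lambda>r. w (?\<gamma> r)) has_real_derivative dder w u (?\<gamma> r)) (at r)" if "?\<gamma> r \<in> S" for r
      using has_derivative_compose[OF \<gamma> d[OF that]] sc[OF w that] by (simp add: has_field_derivative_def)
    have 2: "((\<lambda>r. dder w u (?\<gamma> r)) has_real_derivative dder (dder w u) u x) (at 0)"
      using has_derivative_compose[OF \<gamma>[of 0], of "dder w u" "\<lambda>v. dder (dder w u) v x"] C_k_on_imp_has_derivative[OF C_k_on_dder[OF w] S]
        sc[OF C_k_on_dder[OF w] S(2)]
      by (simp add: has_field_derivative_def)
    obtain \<delta> where \<delta>: "\<delta> > 0" "\<And>h. 0 < h \<Longrightarrow> h < \<delta> \<Longrightarrow> dder w u (?\<gamma> h) < 0"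
      using DERIV_neg_dec_right[OF 2] neg z[of u] by auto
    obtain e where e: "e > 0" "ball x e \<subseteq> S" using S openE by blast
    define h where "h = min (\<delta> / 2) (e / (2 * (norm u + 1)))"
    have n: "0 < norm u + 1" by (simp add: add_nonneg_pos)
    have h: "0 < h" "h < \<delta>" "h * (norm u + 1) \<le> e / 2"
    proof -
      show "0 < h" "h < \<delta>" using \<delta>(1) e(1) n by (auto simp: h_def)
      have "h \<le> (e / 2) / (norm u + 1)" by (simp add: h_def)
      then show "h * (norm u + 1) \<le> e / 2" using n pos_le_divide_eq by blast
    qed
    have "r * norm u \<le> h * (norm u + 1)" if "0 \<le> r" "r \<le> h" for r
      using that by (intro mult_mono) auto
    then have inS: "?\<gamma> r \<in> S" if "0 \<le> r" "r \<le> h" for r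
      using that h(3) e by (force simp: dist_norm subset_iff)
    have "w (?\<gamma> h) < w (?\<gamma> 0)"
    proof (rule DERIV_neg_imp_decreasing_open[OF h(1)])
      show "\<exists>y. ((\<lambda>r. w (?\<gamma> r)) has_real_derivative y) (at r) \<and> y < 0" if "0 < r" "r < h" for r
        using 1[OF inS[of r]] \<delta>(2)[of r] that h by auto
      show "continuous_on {0..h} (\<lambda>r. w (?\<gamma> r))"
        using 1 inS by (intro DERIV_continuous_on[where D="\<lambda>r. dder w u (?\<gamma> r)"])
          (auto intro: has_field_derivative_at_within)
    qed
    with min[OF inS[of h]] h show False by simp
  qed
qed

text \<open>The index set \<open>Q\<close> lists constant directions \<open>s q\<close>,
  \<open>t q\<close> with variable coefficients \<open>b q\<close>, so the operator is kept as it
  comes out of \<partial>\<partial>bar and no coefficient matrix is formed.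
  \<open>symbol_pos\<close> serves Kato's inequality and the barriers; \<open>trace_nonneg\<close>
  is applied to the Hessian at a minimum.\<close>

locale elliptic =
  fixes S :: "'a::euclidean_space set" and Q :: "'q set" and s t :: "'q \<Rightarrow> 'a" and b :: "'q \<Rightarrow> 'a \<Rightarrow> real"
  assumes open_S: "open S" and finite_Q: "finite Q"
    and b_smooth: "q \<in> Q \<Longrightarrow> C_k_on (Suc (Suc 0)) S (b q)"
    and symbol_pos: "x \<in> S \<Longrightarrow> linear \<xi> \<Longrightarrow> \<xi> z \<noteq> (0::real) \<Longrightarrow> 0 < (\<Sum>q\<in>Q. b q x * (\<xi> (s q) * \<xi> (t q)))"
    and trace_nonneg: "x \<in> S \<Longrightarrow> bilinear h \<Longrightarrow> (\<And>z. (0::real) \<le> h z z) \<Longrightarrow> 0 \<le> (\<Sum>q\<in>Q. b q x * h (s q) (t q))"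
begin

definition P :: "('a \<Rightarrow> real) \<Rightarrow> 'a \<Rightarrow> real" where
  "P g x = (\<Sum>q\<in>Q. dder (dder (\<lambda>y. b q y * g y) (t q)) (s q) x)"

text \<open>The formal adjoint of \<open>P\<close>. Each integration by parts moves the outermost
  derivative, so the directions \<open>s q\<close> and \<open>t q\<close> appear in reversed order.
  There is no term without derivatives.\<close>

definition L :: "('a \<Rightarrow> real) \<Rightarrow> 'a \<Rightarrow> real" where
  "L v x = (\<Sum>q\<in>Q. b q x * dder (dder v (s q)) (t q) x)"

definition symbol :: "('a \<Rightarrow> real) \<Rightarrow> 'a \<Rightarrow> real" where
  "symbol g x = (\<Sum>q\<in>Q. b q x * (dder g (s q) x * dder g (t q) x))"

abbreviation C2 :: "('a \<Rightarrow> real) \<Rightarrow> bool" where "C2 \<equiv> C_k_on (Suc (Suc 0)) S"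

lemmas b_cont = C_k_on_imp_continuous[OF b_smooth]
lemmas dder_cont = C_k_on_imp_continuous[OF C_k_on_dder[where k="Suc 0"]]
lemmas dder2_cont = C_k_on_imp_continuous[OF C_k_on_dder[OF C_k_on_dder[where k="Suc 0"]]]

lemma C2_mult: "q \<in> Q \<Longrightarrow> C2 g \<Longrightarrow> C2 (\<lambda>y. b q y * g y)"
  by (intro C_k_on_mult open_S b_smooth)

lemma P_continuous: "C2 g \<Longrightarrow> continuous_on S (P g)"
  unfolding P_def[abs_def] by (intro continuous_on_sum dder2_cont C2_mult)

lemma L_continuous: "C2 v \<Longrightarrow> continuous_on S (L v)"
  unfolding L_def[abs_def] by (intro continuous_on_sum continuous_on_mult dder2_cont b_cont)

lemma symbol_continuous: "C2 g \<Longrightarrow> continuous_on S (symbol g)"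
  unfolding symbol_def[abs_def] by (intro continuous_on_sum continuous_on_mult dder_cont b_cont)

lemma L_off_support:
  assumes "closed K" "\<And>x. x \<in> S - K \<Longrightarrow> v x = 0" "x \<in> S - K"
  shows "L v x = 0"
proof -
  have "dder v u y = 0" if "y \<in> S - K" for u y
    using dder_zero_off_support[OF open_S assms(1,2) that] .
  then have "dder (dder v u) w x = 0" for u w
    using dder_zero_off_support[OF open_S assms(1) _ assms(3)] by blast
  then show ?thesis by (simp add: L_def)
qed

text \<open>Two integrations by parts. The compact support is that of \<open>v\<close>;
  \<open>g\<close> will be a global function read in a chart, which need not vanish near the
  boundary of the chart image.\<close>

lemma integral_P_eq_integral_L:
  assumes v: "C2 v" and g: "C2 g" and K: "compact K" "K \<subseteq> S" "\<And>x. x \<in> S - K \<Longrightarrow> v x = 0"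
  shows "integral S (\<lambda>x. v x * P g x) = integral S (\<lambda>x. g x * L v x)"
proof -
  have z1: "dder v u x = 0" if "x \<in> S - K" for u x
    using dder_zero_off_support[OF open_S compact_imp_closed[OF K(1)] K(3) that] .
  have z2: "dder (dder v u) w x = 0" if "x \<in> S - K" for u w x
    using dder_zero_off_support[OF open_S compact_imp_closed[OF K(1)] z1 that] .
  note cont = C_k_on_imp_continuous[OF v] C_k_on_imp_continuous[OF g]
  have "integral S (\<lambda>x. v x * P g x) = (\<Sum>q\<in>Q. integral S (\<lambda>x. v x * dder (dder (\<lambda>y. b q y * g y) (t q)) (s q) x))"
    unfolding P_def sum_distrib_left using K
    by (intro integral_sum finite_Q integrable_compact_support[OF _ K(1,2)] continuous_on_mult dder2_cont cont C2_mult g) auto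
  also have "\<dots> = (\<Sum>q\<in>Q. integral S (\<lambda>x. g x * (b q x * dder (dder v (s q)) (t q) x)))"
  proof (rule sum.cong[OF refl])
    fix q assume q: "q \<in> Q"
    have "integral S (\<lambda>x. v x * dder (dder (\<lambda>y. b q y * g y) (t q)) (s q) x) =
        - integral S (\<lambda>x. dder v (s q) x * dder (\<lambda>y. b q y * g y) (t q) x)"
      using K q by (intro integral_by_parts_compact_support open_S C_k_on_dder C2_mult g C_k_on_lower[OF v])
    also have "\<dots> = integral S (\<lambda>x. dder (dder v (s q)) (t q) x * (b q x * g x))"
      using K q z1 by (subst integral_by_parts_compact_support[where K=K])
        (auto intro: open_S C_k_on_dder[OF v] C_k_on_lower[OF C2_mult] g)
    finally show "integral S (\<lambda>x. v x * dder (dder (\<lambda>y. b q y * g y) (t q)) (s q) x) =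
      integral S (\<lambda>x. g x * (b q x * dder (dder v (s q)) (t q) x))" by (simp add: mult_ac)
  qed
  also have "\<dots> = integral S (\<lambda>x. g x * L v x)"
    unfolding L_def sum_distrib_left using z2
    by (intro integral_sum[symmetric] finite_Q integrable_compact_support[OF _ K(1,2)] continuous_on_mult dder2_cont cont b_cont v) auto
  finally show ?thesis .
qed

lemma P_expand:
  assumes "C2 g" "x \<in> S"
  shows "P g x = (\<Sum>q\<in>Q. b q x * dder (dder g (t q)) (s q) x + dder (b q) (s q) x * dder g (t q) x +
      dder (b q) (t q) x * dder g (s q) x) + P (\<lambda>_. 1) x * g x"
  unfolding P_def using dder2_mult[OF b_smooth assms(1) open_S assms(2)]
  by (simp add: sum.distrib sum_distrib_right)

text \<open>The zeroth-order coefficient of \<open>P\<close> is \<open>P\<close> of the constant 1.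
  It adds to the usual chain rule the factor \<open>\<psi> (g x) - \<psi>' (g x) * g x\<close>, the
  defect of \<psi> from being homogeneous of degree one. This defect is small for a smoothed
  absolute value.\<close>

lemma P_compose:
  assumes g: "C2 g" "x \<in> S" and \<psi>: "open T" "g ` S \<subseteq> T" "\<And>r. r \<in> T \<Longrightarrow> (\<psi> has_real_derivative \<psi>' r) (at r)"
    "\<And>r. r \<in> T \<Longrightarrow> (\<psi>' has_real_derivative \<psi>'' r) (at r)" "continuous_on T \<psi>''"
  shows "P (\<lambda>y. \<psi> (g y)) x = \<psi>' (g x) * P g x + \<psi>'' (g x) * symbol g x + P (\<lambda>_. 1) x * (\<psi> (g x) - \<psi>' (g x) * g x)"
proof -
  have C: "C2 (\<lambda>y. \<psi> (g y))"
    by (rule C_k_on_compose[OF open_S \<psi>(1) g(1) C_2_real[OF \<psi>(1,3,4,5)] \<psi>(2)])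
  have d1: "dder (\<lambda>y. \<psi> (g y)) u x = \<psi>' (g x) * dder g u x" for u
    using \<psi> g(2) by (intro dder_eq[OF dder_compose_real] C_k_on_imp_has_derivative[OF g(1) open_S]) auto
  have d2: "dder (dder (\<lambda>y. \<psi> (g y)) v) u x = \<psi>'' (g x) * dder g u x * dder g v x + \<psi>' (g x) * dder (dder g v) u x" for u v
    by (rule dder2_compose_real[OF g(1) open_S g(2) \<psi>(1,2,3,4)])
  show ?thesis
    unfolding P_expand[OF C g(2)] P_expand[OF g] symbol_def d1 d2
    by (simp add: algebra_simps sum.distrib sum_distrib_left)
qed

lemma L_compose:
  assumes g: "C2 g" "x \<in> S" and \<psi>: "open T" "g ` S \<subseteq> T" "\<And>r. r \<in> T \<Longrightarrow> (\<psi> has_real_derivative \<psi>' r) (at r)"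
    "\<And>r. r \<in> T \<Longrightarrow> (\<psi>' has_real_derivative \<psi>'' r) (at r)"
  shows "L (\<lambda>y. \<psi> (g y)) x = \<psi>' (g x) * L g x + \<psi>'' (g x) * symbol g x"
proof -
  have d2: "dder (dder (\<lambda>y. \<psi> (g y)) v) u x = \<psi>'' (g x) * dder g u x * dder g v x + \<psi>' (g x) * dder (dder g v) u x" for u v
    by (rule dder2_compose_real[OF g(1) open_S g(2) \<psi>])
  show ?thesis
    unfolding L_def symbol_def d2 by (simp add: algebra_simps sum.distrib sum_distrib_left)
qed

lemma symbol_nonneg:
  assumes "C2 g" "x \<in> S" shows "0 \<le> symbol g x"
proof (cases "\<forall>z. dder g z x = 0")
  case True then show ?thesis by (simp add: symbol_def)
next
  case False then show ?thesis
    using symbol_pos[OF assms(2) dder_linear[OF assms(1) open_S assms(2)]] unfolding symbol_def by (blast intro: less_imp_le)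
qed

end

section \<open>Kato's inequality and barrier functions\<close>

lemma dder_linear_combination:
  fixes f g :: "'a::euclidean_space \<Rightarrow> real"
  assumes "open S" "x \<in> S" "C_k_on (Suc k) S f" "C_k_on (Suc k) S g"
  shows "dder (\<lambda>y. f y + c * g y) u x = dder f u x + c * dder g u x"
  by (rule dder_eq) (intro has_derivative_add has_derivative_mult_right
    C_k_on_imp_has_derivative[OF assms(3,1,2)] C_k_on_imp_has_derivative[OF assms(4,1,2)])

lemma dder2_linear_combination:
  fixes f g :: "'a::euclidean_space \<Rightarrow> real"
  assumes "open S" "x \<in> S" "C_k_on (Suc (Suc 0)) S f" "C_k_on (Suc (Suc 0)) S g"
  shows "dder (dder (\<lambda>y. f y + c * g y) v) u x = dder (dder f v) u x + c * dder (dder g v) u x"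
proof -
  have "dder (dder (\<lambda>y. f y + c * g y) v) u x = dder (\<lambda>y. dder f v y + c * dder g v y) u x"
    by (intro dder_cong[OF assms(1,2)] dder_linear_combination[OF assms(1) _ assms(3,4)])
  also have "\<dots> = dder (dder f v) u x + c * dder (dder g v) u x"
    by (rule dder_linear_combination[OF assms(1,2) C_k_on_dder[OF assms(3)] C_k_on_dder[OF assms(4)]])
  finally show ?thesis .
qed

lemma abs_le_sqrt_square_plus: "\<bar>a\<bar> \<le> sqrt (a\<^sup>2 + e\<^sup>2)"
  by (rule real_le_rsqrt) simp

lemma sqrt_square_plus_le: "0 \<le> e \<Longrightarrow> sqrt (a\<^sup>2 + e\<^sup>2) \<le> \<bar>a\<bar> + e"
  by (rule real_le_lsqrt) (auto simp: power2_eq_square algebra_simps)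

lemma C_k_on_norm_square: "C_k_on k UNIV (\<lambda>x::'a::euclidean_space. (x - y) \<bullet> (x - y))"
proof -
  have "C_k_on k UNIV (\<lambda>x::'a. x + (- y))"
    by (intro C_k_on_add C_k_on_id C_k_on_const) auto
  then have "C_k_on k UNIV (\<lambda>x::'a. x - y)" by simp
  then show ?thesis by (intro C_k_on_bilinear[OF bounded_bilinear_inner]) auto
qed

lemma dder_norm_square: "dder (\<lambda>x::'a::euclidean_space. (x - y) \<bullet> (x - y)) u x = 2 * ((x - y) \<bullet> u)"
  by (rule dder_eq[THEN trans]) (auto intro!: derivative_eq_intros simp: inner_commute)

lemma compact_continuous_abs_le:
  fixes f :: "'a::topological_space \<Rightarrow> real"
  assumes "compact K" "continuous_on K f"
  obtains C where "0 \<le> C" "\<And>x. x \<in> K \<Longrightarrow> \<bar>f x\<bar> \<le> C"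
proof -
  have "bounded (f ` K)" using assms by (intro compact_imp_bounded compact_continuous_image)
  then obtain C where "\<And>x. x \<in> K \<Longrightarrow> \<bar>f x\<bar> \<le> C" by (auto simp: bounded_iff)
  then show thesis using that[of "\<bar>C\<bar>"] by force
qed

text \<open>Used for exponents 3 and 2: the cube of the positive part is of class C^2, which is the
  regularity asked of all cutoffs and barriers below.\<close>

lemma DERIV_max_0_power:
  "((\<lambda>r::real. (max 0 r) ^ Suc (Suc k)) has_real_derivative real (Suc (Suc k)) * (max 0 x) ^ Suc k) (at x)"
proof -
  consider "x < 0" | "x = 0" | "x > 0" by linarith
  then show ?thesis
  proof cases
    case 1
    have "((\<lambda>r::real. 0) has_real_derivative 0) (at x)" by simp
    then have "((\<lambda>r::real. (max 0 r) ^ Suc (Suc k)) has_real_derivative 0) (at x)"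
      by (rule has_field_derivative_transform_within_open[where S="{..<0}"]) (use 1 in auto)
    then show ?thesis using 1 by simp
  next
    case 2
    have "((\<lambda>h. (max 0 h) ^ Suc (Suc k) / h) \<longlongrightarrow> 0) (at (0::real))"
    proof (rule Lim_null_comparison)
      show "((\<lambda>h::real. \<bar>h\<bar> ^ Suc k) \<longlongrightarrow> 0) (at 0)"
        by (rule tendsto_eq_intros refl | simp)+
      show "\<forall>\<^sub>F h in at (0::real). norm ((max 0 h) ^ Suc (Suc k) / h) \<le> \<bar>h\<bar> ^ Suc k"
        by (rule always_eventually) (auto simp: max_def abs_mult power_abs mult_nonpos_nonneg)
    qed
    then show ?thesis using 2 by (simp add: DERIV_def)
  next
    case 3
    have "((\<lambda>r::real. r ^ Suc (Suc k)) has_real_derivative real (Suc (Suc k)) * x ^ Suc k) (at x)"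
      by (rule DERIV_cong[OF DERIV_pow]) simp
    then have "((\<lambda>r::real. (max 0 r) ^ Suc (Suc k)) has_real_derivative real (Suc (Suc k)) * x ^ Suc k) (at x)"
      by (rule has_field_derivative_transform_within_open[where S="{0<..}"]) (use 3 in auto)
    then show ?thesis using 3 by simp
  qed
qed

context elliptic
begin

text \<open>Kato's inequality: \<open>\<bar>f\<bar>\<close> is approximated by \<open>sqrt (f\<^sup>2 + \<epsilon>\<^sup>2)\<close>, a convex function of \<open>f\<close>.\<close>

lemma Kato:
  assumes f: "C2 f" "\<And>x. x \<in> S \<Longrightarrow> P f x = 0" and v: "C2 v" "\<And>x. x \<in> S \<Longrightarrow> 0 \<le> v x"
    and K: "compact K" "K \<subseteq> S" "\<And>x. x \<in> S - K \<Longrightarrow> v x = 0"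
  shows "0 \<le> integral S (\<lambda>x. \<bar>f x\<bar> * L v x)"
proof -
  let ?c = "P (\<lambda>_. 1)"
  \<comment> \<open>The two errors of order \<epsilon>: the first integral comes from the
    zeroth-order term of \<open>P\<close>, the second from replacing the smoothed absolute value by
    |f|.\<close>
  define C where "C = integral S (\<lambda>x. v x * \<bar>?c x\<bar>) + integral S (\<lambda>x. \<bar>L v x\<bar>)"
  note cont = C_k_on_imp_continuous[OF f(1)] C_k_on_imp_continuous[OF v(1)] L_continuous[OF v(1)]
    P_continuous[OF C_k_on_const]
  have zL: "x \<in> S - K \<Longrightarrow> L v x = 0" for x
    using L_off_support[OF compact_imp_closed[OF K(1)] K(3)] .
  have bound: "- \<epsilon> * C \<le> integral S (\<lambda>x. \<bar>f x\<bar> * L v x)" if \<epsilon>: "\<epsilon> > 0" for \<epsilon>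
  proof -
    let ?\<psi> = "\<lambda>r::real. sqrt (r\<^sup>2 + \<epsilon>\<^sup>2)"
    have pos: "0 < r\<^sup>2 + \<epsilon>\<^sup>2" for r using \<epsilon> by (simp add: add_nonneg_pos)
    have \<psi>1: "(?\<psi> has_real_derivative r / ?\<psi> r) (at r)" for r
      using pos[of r] by (auto intro!: derivative_eq_intros simp: field_simps)
    have \<psi>2: "((\<lambda>r. r / ?\<psi> r) has_real_derivative \<epsilon>\<^sup>2 / (?\<psi> r) ^ 3) (at r)" for r
    proof -
      let ?q = "?\<psi> r"
      have "0 < ?q" using pos[of r] by (rule real_sqrt_gt_zero)
      then have q: "?q * ?q = r\<^sup>2 + \<epsilon>\<^sup>2" "?q \<noteq> 0"
        using pos[of r] by (simp, linarith)
      have "(1 * ?q - r * (r / ?q)) / (?q * ?q) = (?q * ?q - r * r) / ?q ^ 3"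
        using q(2) by (simp add: field_simps power3_eq_cube)
      also have "?q * ?q - r * r = \<epsilon>\<^sup>2" unfolding q(1) by (simp add: power2_eq_square)
      finally show ?thesis using DERIV_divide[OF DERIV_ident \<psi>1[of r] q(2)] by simp
    qed
    have \<psi>3: "continuous_on UNIV (\<lambda>r. \<epsilon>\<^sup>2 / (?\<psi> r) ^ 3)"
      using pos by (intro continuous_intros) (auto simp: less_imp_neq[symmetric])
    let ?g = "\<lambda>x. ?\<psi> (f x)"
    have g: "C2 ?g"
      by (rule C_k_on_compose[OF open_S open_UNIV f(1) C_2_real[OF open_UNIV \<psi>1 \<psi>2 \<psi>3]]) auto
    have Pg: "- \<epsilon> * \<bar>?c x\<bar> \<le> P ?g x" if x: "x \<in> S" for x
    proof -
      have Pg: "P ?g x = \<epsilon>\<^sup>2 / (?\<psi> (f x)) ^ 3 * symbol f x + ?c x * (?\<psi> (f x) - f x / ?\<psi> (f x) * f x)"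
        using P_compose[OF f(1) x open_UNIV _ \<psi>1 \<psi>2 \<psi>3] f(2)[OF x] by simp
      have nn: "0 \<le> \<epsilon>\<^sup>2 / (?\<psi> (f x)) ^ 3 * symbol f x"
        using symbol_nonneg[OF f(1) x] by simp
      \<comment> \<open>The homogeneity defect of the smoothed absolute value; it is at most
        \<epsilon> because the square root is at least \<epsilon>.\<close>
      have eq: "?\<psi> (f x) - f x / ?\<psi> (f x) * f x = \<epsilon>\<^sup>2 / ?\<psi> (f x)"
      proof -
        have "?\<psi> (f x) * ?\<psi> (f x) = (f x)\<^sup>2 + \<epsilon>\<^sup>2" using pos[of "f x"] by simp
        moreover have "?\<psi> (f x) \<noteq> 0" using pos[of "f x"] real_sqrt_gt_zero by fastforce
        ultimately show ?thesis by (simp add: divide_simps power2_eq_square)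
      qed
      have "\<bar>\<epsilon>\<^sup>2 / ?\<psi> (f x)\<bar> \<le> \<epsilon>"
      proof -
        have "\<epsilon> \<le> ?\<psi> (f x)" using \<epsilon> by (intro real_le_rsqrt) simp
        then have "\<epsilon> * \<epsilon> \<le> \<epsilon> * ?\<psi> (f x)" using \<epsilon> by simp
        then show ?thesis using pos[of "f x"] by (simp add: field_simps power2_eq_square)
      qed
      then have "\<bar>?c x * (\<epsilon>\<^sup>2 / ?\<psi> (f x))\<bar> \<le> \<epsilon> * \<bar>?c x\<bar>"
        unfolding abs_mult by (metis abs_ge_zero mult.commute mult_left_mono)
      then have "- (\<epsilon> * \<bar>?c x\<bar>) \<le> ?c x * (\<epsilon>\<^sup>2 / ?\<psi> (f x))" by linarith
      with nn show ?thesis unfolding Pg eq mult_minus_left by linarith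
    qed
    have "- \<epsilon> * integral S (\<lambda>x. v x * \<bar>?c x\<bar>) = integral S (\<lambda>x. v x * (- \<epsilon> * \<bar>?c x\<bar>))"
      by (simp add: mult.left_commute flip: integral_mult_right)
    also have "\<dots> \<le> integral S (\<lambda>x. v x * P ?g x)"
      using K(3) by (intro integral_le integrable_compact_support[OF _ K(1,2)] continuous_intros cont mult_left_mono v(2) Pg
        P_continuous g) auto
    also have "\<dots> = integral S (\<lambda>x. ?g x * L v x)"
      by (rule integral_P_eq_integral_L[OF v(1) g K])
    also have "\<dots> \<le> integral S (\<lambda>x. \<bar>f x\<bar> * L v x + \<epsilon> * \<bar>L v x\<bar>)"
    proof (intro integral_le integrable_compact_support[OF _ K(1,2)] continuous_intros cont C_k_on_imp_continuous[OF g])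
      fix x
      have "\<bar>?g x - \<bar>f x\<bar>\<bar> \<le> \<epsilon>"
        using abs_le_sqrt_square_plus[of "f x" \<epsilon>] sqrt_square_plus_le[of \<epsilon> "f x"] \<epsilon> by linarith
      then have "\<bar>(?g x - \<bar>f x\<bar>) * L v x\<bar> \<le> \<epsilon> * \<bar>L v x\<bar>"
        unfolding abs_mult by (rule mult_right_mono) simp
      then show "?g x * L v x \<le> \<bar>f x\<bar> * L v x + \<epsilon> * \<bar>L v x\<bar>" by (simp add: algebra_simps)
    qed (use zL in auto)
    also have "\<dots> = integral S (\<lambda>x. \<bar>f x\<bar> * L v x) + \<epsilon> * integral S (\<lambda>x. \<bar>L v x\<bar>)"
      using zL by (subst integral_add) (auto intro!: integrable_compact_support[OF _ K(1,2)] continuous_intros cont)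
    finally show ?thesis by (simp add: C_def algebra_simps)
  qed
  show ?thesis
  proof (rule ccontr)
    assume neg: "\<not> 0 \<le> integral S (\<lambda>x. \<bar>f x\<bar> * L v x)"
    let ?I = "integral S (\<lambda>x. \<bar>f x\<bar> * L v x)"
    \<comment> \<open>Chosen so that \<open>\<epsilon> * C\<close> is at most half the absolute
      value of the supposedly negative integral.\<close>
    define \<epsilon> where "\<epsilon> = - ?I / (2 * (\<bar>C\<bar> + 1))"
    have "\<epsilon> > 0" using neg by (auto simp: \<epsilon>_def intro!: divide_neg_pos)
    have "\<epsilon> * C \<le> \<epsilon> * (\<bar>C\<bar> + 1)" using \<open>\<epsilon> > 0\<close> by (intro mult_left_mono) auto
    also have "\<dots> = - ?I / 2" by (simp add: \<epsilon>_def field_simps add_nonneg_eq_0_iff)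
    finally show False using bound[OF \<open>\<epsilon> > 0\<close>] neg by linarith
  qed
qed

lemma P_linear:
  assumes "C2 f" "C2 g" "x \<in> S"
  shows "P (\<lambda>y. f y + c * g y) x = P f x + c * P g x"
proof -
  have C: "C2 (\<lambda>y. f y + c * g y)"
    by (intro C_k_on_add C_k_on_mult C_k_on_const open_S assms)
  show ?thesis
    unfolding P_expand[OF C assms(3)] P_expand[OF assms(1,3)] P_expand[OF assms(2,3)]
      dder_linear_combination[OF open_S assms(3,1,2)] dder2_linear_combination[OF open_S assms(3,1,2)]
    by (simp add: algebra_simps sum.distrib sum_distrib_left)
qed

lemma symbol_norm_square_pos:
  assumes "x \<in> S" "x \<noteq> y" shows "0 < symbol (\<lambda>x. (x - y) \<bullet> (x - y)) x"
proof -
  have "linear (\<lambda>u. 2 * ((x - y) \<bullet> u))" by (auto intro!: linearI simp: inner_simps algebra_simps)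
  from symbol_pos[OF assms(1) this, of "x - y"] assms(2)
  show ?thesis by (simp add: symbol_def dder_norm_square)
qed

text \<open>The barrier is \<open>v x = max 0 (R\<^sup>2 - \<bar>x - y\<bar>\<^sup>2)\<^sup>3\<close>; if \<open>R\<close> is only slightly larger than \<open>r\<close>, its second-order
  terms dominate where \<open>r \<le> \<bar>x - y\<bar> < R\<close>.\<close>

lemma weak_Hopf:
  assumes g: "continuous_on S g" "\<And>x. x \<in> S \<Longrightarrow> 0 \<le> g x"
    and r: "0 < r" "r < R0" "cball y R0 \<subseteq> S" "\<And>x. dist y x < r \<Longrightarrow> g x = 0"
    and p: "dist y p = r" "\<And>e. 0 < e \<Longrightarrow> \<exists>x. dist p x < e \<and> x \<in> S \<and> 0 < g x"
  obtains v K where "C2 v" "\<And>x. 0 \<le> v x" "compact K" "K \<subseteq> S" "\<And>x. x \<notin> K \<Longrightarrow> v x = 0"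
    "0 < integral S (\<lambda>x. g x * L v x)"
proof -
  let ?m = "\<lambda>x. (x - y) \<bullet> (x - y)"
  have m: "C2 ?m" by (rule C_k_on_subset[OF C_k_on_norm_square]) simp
  have md: "?m x = (dist y x)\<^sup>2" for x by (simp add: dist_norm dot_square_norm norm_minus_commute)
  define K0 where "K0 = cball y R0 - ball y r"
  have K0: "compact K0" "K0 \<subseteq> S" "p \<in> K0" using r p(1) by (auto simp: K0_def compact_diff)
  obtain p0 where p0: "p0 \<in> K0" "\<And>x. x \<in> K0 \<Longrightarrow> symbol ?m p0 \<le> symbol ?m x"
    using continuous_attains_inf[OF K0(1) _ continuous_on_subset[OF symbol_continuous[OF m] K0(2)]] K0(3) by blast
  define \<kappa> where "\<kappa> = symbol ?m p0"
  have \<kappa>: "0 < \<kappa>" unfolding \<kappa>_def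
    using p0(1) K0(2) r(1) by (intro symbol_norm_square_pos) (auto simp: K0_def)
  obtain C where C0: "0 \<le> C" and C: "\<And>x. x \<in> K0 \<Longrightarrow> \<bar>L ?m x\<bar> \<le> C"
    by (rule compact_continuous_abs_le[OF K0(1) continuous_on_subset[OF L_continuous[OF m] K0(2)]]) blast
  \<comment> \<open>Write \<open>w\<close> for \<open>max 0 (R\<^sup>2 - ?m x)\<close>. Then
    \<open>L v = w * (6 * symbol ?m x - 3 * w * L ?m x)\<close>, and \<open>w \<le> d\<close>
    outside the inner ball. The second bound on \<open>d\<close> gives
    \<open>d * C < 2 * \<kappa>\<close>, which makes the bracket positive; the first keeps
    \<open>R \<le> R0\<close>.\<close>
  define d where "d = min (R0\<^sup>2 - r\<^sup>2) (\<kappa> / (C + 1))"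
  have "0 < R0\<^sup>2 - r\<^sup>2" using r(1,2) by (simp add: power_strict_mono)
  then have d: "0 < d" "d \<le> R0\<^sup>2 - r\<^sup>2" "d * C < 2 * \<kappa>"
  proof -
    show "0 < d" using \<open>0 < R0\<^sup>2 - r\<^sup>2\<close> \<kappa> C0 by (auto simp: d_def)
    show "d \<le> R0\<^sup>2 - r\<^sup>2" by (simp add: d_def)
    have "d * C \<le> \<kappa> / (C + 1) * C" using C0 by (intro mult_right_mono) (auto simp: d_def)
    also have "\<dots> \<le> \<kappa>" using C0 \<kappa> by (simp add: field_simps)
    finally show "d * C < 2 * \<kappa>" using \<kappa> by linarith
  qed
  define R where "R = sqrt (r\<^sup>2 + d)"
  have R2: "R\<^sup>2 = r\<^sup>2 + d" using d(1) by (simp add: R_def)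
  have R: "r < R" "R \<le> R0"
    unfolding R_def using d r by (auto intro!: real_less_rsqrt real_le_lsqrt)
  let ?\<psi> = "\<lambda>m. (max 0 (R\<^sup>2 - m)) ^ 3" and ?\<psi>' = "\<lambda>m. - 3 * (max 0 (R\<^sup>2 - m))\<^sup>2" and ?\<psi>'' = "\<lambda>m. 6 * max 0 (R\<^sup>2 - m)"
  have max_deriv: "((\<lambda>m. (max 0 (R\<^sup>2 - m)) ^ Suc (Suc k)) has_real_derivative
      - real (Suc (Suc k)) * (max 0 (R\<^sup>2 - m)) ^ Suc k) (at m)" for k and m :: real
    by (rule DERIV_cong[OF DERIV_chain2[OF DERIV_max_0_power, of _ "-1"]]) (auto intro!: derivative_eq_intros simp: algebra_simps)
  have \<psi>: "(?\<psi> has_real_derivative ?\<psi>' m) (at m)" "(?\<psi>' has_real_derivative ?\<psi>'' m) (at m)" for m :: real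
    using max_deriv[of 1 m] DERIV_cmult[OF max_deriv[of 0 m], of "-3"] by (simp_all add: numeral_3_eq_3 power2_eq_square)
  have \<psi>c: "continuous_on UNIV ?\<psi>''" by (intro continuous_intros)
  define v where "v = (\<lambda>x. ?\<psi> (?m x))"
  have v: "C2 v"
    unfolding v_def by (rule C_k_on_compose[OF open_S open_UNIV m C_2_real[OF open_UNIV \<psi> \<psi>c]]) auto
  have Lv: "L v x = max 0 (R\<^sup>2 - ?m x) * (6 * symbol ?m x - 3 * max 0 (R\<^sup>2 - ?m x) * L ?m x)" if "x \<in> S" for x
    using L_compose[OF m that open_UNIV _ \<psi>] unfolding v_def by (simp add: algebra_simps power2_eq_square)
  have pos: "0 < 6 * symbol ?m x - 3 * max 0 (R\<^sup>2 - ?m x) * L ?m x" if x: "x \<in> K0" for x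
  proof -
    have "r\<^sup>2 \<le> ?m x" unfolding md using x r(1) by (intro power_mono) (auto simp: K0_def)
    then have "max 0 (R\<^sup>2 - ?m x) \<le> d" using R2 d(1) by simp
    then have "max 0 (R\<^sup>2 - ?m x) * L ?m x \<le> d * C"
      using C[OF x] C0 by (intro order_trans[OF mult_left_mono[of "L ?m x" C] mult_right_mono]) auto
    moreover have "\<kappa> \<le> symbol ?m x" using p0(2)[OF x] by (simp add: \<kappa>_def)
    ultimately show ?thesis using d(3) unfolding mult.assoc by linarith
  qed
  have nonneg: "0 \<le> g x * L v x" if x: "x \<in> S" for x
  proof (cases "x \<in> K0")
    case True then show ?thesis using g(2)[OF x] pos[OF True] by (simp add: Lv[OF x])
  next
    case False
    then consider "dist y x < r" | "R0 < dist y x" by (force simp: K0_def)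
    then show ?thesis
    proof cases
      case 2
      then have "R < dist y x" using R(2) by simp
      then have "R\<^sup>2 \<le> ?m x" unfolding md using R(1) r(1) by (intro power_mono) auto
      then show ?thesis by (simp add: Lv[OF x])
    qed (simp add: r(4))
  qed
  \<comment> \<open>This point lies in the ball of radius \<open>R\<close> by the triangle
    inequality, and outside the ball of radius \<open>r\<close> because \<open>g\<close> vanishes
    there; so the integrand is positive at it.\<close>
  obtain x where x: "dist p x < R - r" "x \<in> S" "0 < g x" using p(2)[of "R - r"] R(1) by auto
  have "dist y x < R" using dist_triangle[of y x p] x(1) p(1) by simp
  moreover have "\<not> dist y x < r" using r(4)[of x] x(3) by auto
  ultimately have xK: "x \<in> K0" "?m x < R\<^sup>2"
    using R(2) unfolding md by (auto simp: K0_def intro: power_strict_mono)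
  have v0: "v z = 0" if "z \<notin> cball y R" for z
  proof -
    have "R\<^sup>2 \<le> ?m z" unfolding md using R(1) r(1) that by (intro power_mono) auto
    then show ?thesis by (simp add: v_def)
  qed
  have sub: "cball y R \<subseteq> S" using R(2) r(3) by (meson order_trans subset_cball)
  have "0 < integral S (\<lambda>x. g x * L v x)"
  proof (rule integral_pos_continuous[OF open_S _ _ nonneg x(2)])
    show c: "continuous_on S (\<lambda>x. g x * L v x)" by (intro continuous_intros g L_continuous v)
    show "(\<lambda>x. g x * L v x) integrable_on S"
    proof (rule integrable_compact_support[OF c compact_cball sub])
      fix x assume "x \<in> S - cball y R"
      then have "L v x = 0" using v0 by (intro L_off_support[OF closed_cball]) auto
      then show "g x * L v x = 0" by simp
    qed
    show "0 < g x * L v x" using x(3) xK pos[OF xK(1)] by (simp add: Lv[OF x(2)])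
  qed
  then show thesis using that[of v "cball y R"] v v0 sub by (auto simp: v_def)
qed

text \<open>The barrier is \<open>v = q + k q\<^sup>2\<close> with \<open>q x = r\<^sup>2 - \<bar>x - y\<bar>\<^sup>2\<close>.  It is compared with \<open>f\<close> in a thin shell inside the sphere; the
  constant \<open>k\<close> makes its second-order terms dominate there.\<close>

lemma strong_Hopf:
  assumes f: "C2 f" "\<And>x. x \<in> S \<Longrightarrow> P f x = 0" "\<And>x. x \<in> S \<Longrightarrow> 0 \<le> f x"
    and r: "0 < r" "cball y r \<subseteq> S" "\<And>x. dist y x < r \<Longrightarrow> 0 < f x"
    and p: "dist y p = r" "f p = 0"
  shows False
proof -
  let ?m = "\<lambda>x. (x - y) \<bullet> (x - y)" and ?c = "P (\<lambda>_. 1)"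
  have m: "C2 ?m" by (rule C_k_on_subset[OF C_k_on_norm_square]) simp
  have md: "?m x = (dist y x)\<^sup>2" for x by (simp add: dist_norm dot_square_norm norm_minus_commute)
  have m_cont: "continuous_on UNIV ?m" by (intro continuous_intros)
  define A where "A = {x \<in> cball y r. r\<^sup>2 / 2 \<le> ?m x}"
  have "closed {x. r\<^sup>2 / 2 \<le> ?m x}" by (intro closed_Collect_le continuous_intros)
  then have A: "compact A" "A \<subseteq> S"
    using r(2) unfolding A_def Collect_conj_eq Collect_mem_eq by (auto intro: compact_Int_closed)
  have pA: "p \<in> A" using p(1) by (simp add: A_def md)
  have pS: "p \<in> S" using pA A by auto
  obtain p0 where p0: "p0 \<in> A" "\<And>x. x \<in> A \<Longrightarrow> symbol ?m p0 \<le> symbol ?m x"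
    using continuous_attains_inf[OF A(1) _ continuous_on_subset[OF symbol_continuous[OF m] A(2)]] pA by blast
  define \<kappa> where "\<kappa> = symbol ?m p0"
  have \<kappa>: "0 < \<kappa>" unfolding \<kappa>_def
    using p0(1) A(2) r(1) by (intro symbol_norm_square_pos) (auto simp: A_def)
  have c_cont: "continuous_on S ?c" by (intro P_continuous C_k_on_const)
  have "continuous_on S (\<lambda>x. P ?m x - ?c x * ?m x)"
    by (intro continuous_intros c_cont P_continuous m)
  from continuous_on_subset[OF this A(2)]
  obtain C1 where C1: "0 \<le> C1" "\<And>x. x \<in> A \<Longrightarrow> \<bar>P ?m x - ?c x * ?m x\<bar> \<le> C1"
    by (rule compact_continuous_abs_le[OF A(1)]) blast
  obtain D2 where D2: "0 \<le> D2" "\<And>x. x \<in> A \<Longrightarrow> \<bar>?c x\<bar> \<le> D2"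
    by (rule compact_continuous_abs_le[OF A(1) continuous_on_subset[OF c_cont A(2)]]) blast
  note C0 = C1(1) D2(1)
  \<comment> \<open>The summand 1 gives \<eta> at most 1; \<open>2 / r\<^sup>2\<close> keeps the
    shell of depth \<eta> inside \<open>A\<close>, where the symbol is at least \<kappa>. The last
    summand beats the lower-order terms: on the shell \<open>?\<psi>'\<close> is at most 3 in
    absolute value and \<open>v \<le> 2\<close>, so they are bounded by \<open>3 * C1\<close>, by
    \<open>2 * D2\<close> for the zeroth-order term and by another \<open>2 * D2\<close> for
    \<open>D2 * v\<close>.\<close>
  define k where "k = 1 + 2 / r\<^sup>2 + (3 * C1 + 4 * D2) / (2 * \<kappa>)"
  have k: "1 \<le> k" "2 / r\<^sup>2 \<le> k" "3 * C1 + 4 * D2 < k * (2 * \<kappa>)"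
    using C0 \<kappa> r(1) by (auto simp: k_def field_simps add_nonneg_pos)
  define \<eta> where "\<eta> = 1 / k"
  have \<eta>: "0 < \<eta>" "\<eta> \<le> 1" "\<eta> \<le> r\<^sup>2 / 2" "k * \<eta> = 1"
    using k r(1) by (auto simp: \<eta>_def field_simps)
  let ?\<psi> = "\<lambda>m. (r\<^sup>2 - m) + k * (r\<^sup>2 - m)\<^sup>2" and ?\<psi>' = "\<lambda>m. - 1 - 2 * k * (r\<^sup>2 - m)" and ?\<psi>'' = "\<lambda>m::real. 2 * k"
  have \<psi>: "(?\<psi> has_real_derivative ?\<psi>' m) (at m)" "(?\<psi>' has_real_derivative ?\<psi>'' m) (at m)" for m :: real
    by (auto intro!: derivative_eq_intros simp: algebra_simps)
  have \<psi>c: "continuous_on UNIV ?\<psi>''" by (intro continuous_intros)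
  define v where "v = (\<lambda>x. ?\<psi> (?m x))"
  have v: "C2 v"
    unfolding v_def by (rule C_k_on_compose[OF open_S open_UNIV m C_2_real[OF open_UNIV \<psi> \<psi>c]]) auto
  define B where "B = {x \<in> cball y r. r\<^sup>2 - \<eta> \<le> ?m x}"
  have BA: "B \<subseteq> A" using \<eta>(3) by (auto simp: A_def B_def)
  have mr: "?m x \<le> r\<^sup>2" if "x \<in> cball y r" for x
    unfolding md using that by (intro power_mono) auto
  \<comment> \<open>The zeroth-order coefficient \<open>?c\<close> has no known sign but is bounded
    by \<open>D2\<close>. Subtracting \<open>D2 * v\<close> compensates for it at a negative minimum
    of \<open>f - \<epsilon> v\<close>.\<close>
  have Lv: "0 < P v x - D2 * v x" if x: "x \<in> B" for x
  proof -
    have xS: "x \<in> S" and xA: "x \<in> A" using x BA A by auto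
    have w: "0 \<le> r\<^sup>2 - ?m x" "r\<^sup>2 - ?m x \<le> \<eta>" using x mr by (auto simp: B_def)
    have kw: "0 \<le> k * (r\<^sup>2 - ?m x)" "k * (r\<^sup>2 - ?m x) \<le> 1"
      using w k(1) \<eta>(4) mult_left_mono[OF w(2), of k] by auto
    have v01: "0 \<le> v x" "v x \<le> 2"
    proof -
      have "v x = (r\<^sup>2 - ?m x) + (k * (r\<^sup>2 - ?m x)) * (r\<^sup>2 - ?m x)"
        by (simp add: v_def power2_eq_square mult.assoc)
      moreover have "0 \<le> (k * (r\<^sup>2 - ?m x)) * (r\<^sup>2 - ?m x)" "(k * (r\<^sup>2 - ?m x)) * (r\<^sup>2 - ?m x) \<le> 1"
        using kw w \<eta>(2) by (auto intro: mult_nonneg_nonneg mult_le_one)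
      ultimately show "0 \<le> v x" "v x \<le> 2" using w \<eta>(2) by linarith+
    qed
    have "P v x = ?\<psi>' (?m x) * P ?m x + 2 * k * symbol ?m x + ?c x * (v x - ?\<psi>' (?m x) * ?m x)"
      unfolding v_def by (rule P_compose[OF m xS open_UNIV _ \<psi> \<psi>c]) simp
    also have "\<dots> = ?\<psi>' (?m x) * (P ?m x - ?c x * ?m x) + 2 * k * symbol ?m x + ?c x * v x"
      by (simp add: algebra_simps)
    finally have eq: "P v x = ?\<psi>' (?m x) * (P ?m x - ?c x * ?m x) + 2 * k * symbol ?m x + ?c x * v x" .
    have 1: "\<bar>?\<psi>' (?m x) * (P ?m x - ?c x * ?m x)\<bar> \<le> 3 * C1"
      unfolding abs_mult using C1(2)[OF xA] kw by (intro mult_mono) auto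
    have 2: "2 * k * \<kappa> \<le> 2 * k * symbol ?m x"
      using p0(2)[OF xA] k(1) by (simp add: \<kappa>_def)
    have 3: "\<bar>?c x * v x\<bar> \<le> D2 * 2" unfolding abs_mult using D2(2)[OF xA] v01 by (intro mult_mono) auto
    have 4: "D2 * v x \<le> D2 * 2" using C0 v01 by (intro mult_left_mono) auto
    have "k * (2 * \<kappa>) = 2 * k * \<kappa>" by simp
    then show ?thesis using eq 1 2 3 4 k(3) by linarith
  qed
  have B: "compact B"
  proof -
    have "closed {x. r\<^sup>2 - \<eta> \<le> ?m x}" by (intro closed_Collect_le continuous_intros)
    then show ?thesis unfolding B_def Collect_conj_eq Collect_mem_eq by (intro compact_Int_closed compact_cball)
  qed
  have pB: "p \<in> B" using p(1) \<eta>(1) by (simp add: B_def md)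
  define I where "I = {x \<in> cball y r. ?m x = r\<^sup>2 - \<eta>}"
  have I: "compact I"
  proof -
    have "closed {x. ?m x = r\<^sup>2 - \<eta>}" by (intro closed_Collect_eq continuous_intros)
    then show ?thesis unfolding I_def Collect_conj_eq Collect_mem_eq by (intro compact_Int_closed compact_cball)
  qed
  have fI: "0 < f x" if "x \<in> I" for x
  proof (rule r(3))
    have "(dist y x)\<^sup>2 < r\<^sup>2" using that \<eta>(1) by (simp add: I_def md)
    then show "dist y x < r" using r(1) by (simp add: power2_less_imp_less)
  qed
  have IB: "I \<subseteq> B" by (auto simp: I_def B_def)
  have f_cont: "continuous_on S f" using C_k_on_imp_continuous[OF f(1)] .
  have BS: "B \<subseteq> S" using BA A by auto
  obtain \<mu> where \<mu>: "0 < \<mu>" "\<And>x. x \<in> I \<Longrightarrow> \<mu> \<le> f x"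
  proof (cases "I = {}")
    case True with that[of 1] show ?thesis by auto
  next
    case False
    obtain x0 where "x0 \<in> I" "\<And>x. x \<in> I \<Longrightarrow> f x0 \<le> f x"
      using continuous_attains_inf[OF I False continuous_on_subset[OF f_cont]] IB BS by blast
    then show ?thesis using that[of "f x0"] fI by auto
  qed
  \<comment> \<open>On the inner boundary of the shell \<open>v \<le> 2\<close>, so
    \<open>\<epsilon> * v \<le> \<mu> \<le> f\<close> there.\<close>
  define \<epsilon> where "\<epsilon> = \<mu> / 2"
  have \<epsilon>: "0 < \<epsilon>" using \<mu> by (simp add: \<epsilon>_def)
  let ?w = "\<lambda>x. f x + (- \<epsilon>) * v x"
  have w: "C2 ?w" by (intro C_k_on_add C_k_on_mult C_k_on_const f v open_S)
  have w_nonneg: "0 \<le> ?w x" if x: "x \<in> B" for x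
  proof (rule ccontr)
    assume neg: "\<not> 0 \<le> ?w x"
    obtain z where z: "z \<in> B" "\<And>x. x \<in> B \<Longrightarrow> ?w z \<le> ?w x"
      using continuous_attains_inf[OF B _ continuous_on_subset[OF C_k_on_imp_continuous[OF w] BS]] pB by blast
    have wz: "?w z < 0" using z(2)[OF x] neg by linarith
    have zS: "z \<in> S" using z(1) BS by auto
    have "?m z \<noteq> r\<^sup>2"
    proof
      assume "?m z = r\<^sup>2" then have "?w z = f z" by (simp add: v_def)
      with f(3)[OF zS] wz show False by simp
    qed
    moreover have "?m z \<noteq> r\<^sup>2 - \<eta>"
    proof
      assume mz: "?m z = r\<^sup>2 - \<eta>"
      then have "z \<in> I" using z(1) by (auto simp: I_def B_def)
      then have "\<mu> \<le> f z" by (rule \<mu>(2))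
      moreover have "v z \<le> 2" using \<eta> mz by (simp add: v_def power2_eq_square flip: mult.assoc)
      moreover from this have "\<mu> * v z \<le> \<mu> * 2" using \<mu>(1) by (intro mult_left_mono) auto
      moreover have "f z < \<mu> / 2 * v z" using wz by (simp add: \<epsilon>_def)
      ultimately show False by linarith
    qed
    ultimately have zo: "r\<^sup>2 - \<eta> < ?m z" "?m z < r\<^sup>2"
      using z(1) mr[of z] by (auto simp: B_def)
    \<comment> \<open>A negative minimum over the shell lies on neither bounding sphere, hence in
      the open shell, where the second derivative test applies.\<close>
    define O' where "O' = {x. r\<^sup>2 - \<eta> < ?m x} \<inter> {x. ?m x < r\<^sup>2}"
    have O': "open O'" unfolding O'_def by (intro open_Int open_Collect_less continuous_intros)
    have O'B: "O' \<subseteq> B"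
    proof
      fix x assume "x \<in> O'"
      then have x: "(dist y x)\<^sup>2 < r\<^sup>2" "r\<^sup>2 - \<eta> < ?m x" by (auto simp: O'_def md)
      then have "dist y x < r" using r(1) by (simp add: power2_less_imp_less)
      with x show "x \<in> B" by (auto simp: B_def)
    qed
    have zO: "z \<in> O'" using zo by (simp add: O'_def)
    have wO: "C_k_on (Suc (Suc 0)) O' ?w" by (rule C_k_on_subset[OF w]) (use O'B BS in auto)
    note crit = second_derivative_test_min[OF wO O' zO z(2)]
    have "?w z * D2 \<le> P ?w z"
    proof -
      have h: "bilinear (\<lambda>u v. dder (dder ?w v) u z)" by (rule bilinear_dder2[OF wO O' zO])
      have "0 \<le> (\<Sum>q\<in>Q. b q z * dder (dder ?w (t q)) (s q) z)"
        by (rule trace_nonneg[OF zS h]) (use crit O'B in auto)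
      moreover have "P ?w z = (\<Sum>q\<in>Q. b q z * dder (dder ?w (t q)) (s q) z) + ?c z * ?w z"
        using crit(1) O'B by (subst P_expand[OF w zS]) (simp add: subset_iff)
      moreover have "D2 * ?w z \<le> ?c z * ?w z"
        using D2(2)[of z] z(1) BA wz by (intro mult_right_mono_neg) auto
      ultimately show ?thesis by (simp add: mult.commute)
    qed
    moreover have "P ?w z = P f z + (- \<epsilon>) * P v z"
      by (rule P_linear[OF f(1) v zS])
    ultimately have "\<epsilon> * (P v z - D2 * v z) \<le> - (D2 * f z)" using f(2)[OF zS] by (simp add: algebra_simps)
    moreover have "0 \<le> D2 * f z" using C0 f(3)[OF zS] by simp
    moreover have "0 < \<epsilon> * (P v z - D2 * v z)" using \<epsilon> Lv[OF z(1)] by simp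
    ultimately show False by linarith
  qed
  have fp: "dder f u p = 0" for u
    using f(3) p(2) by (intro second_derivative_test_min(1)[OF f(1) open_S pS]) auto
  have vp: "dder v u p = - 2 * ((p - y) \<bullet> u)" for u
  proof -
    have "dder v u p = ?\<psi>' (?m p) * dder ?m u p"
      unfolding v_def by (intro dder_eq[OF dder_compose_real] C_k_on_imp_has_derivative[OF m open_S pS] \<psi>)
    moreover have "?m p = r\<^sup>2" using p(1) by (simp add: md)
    ultimately show ?thesis by (simp add: dder_norm_square)
  qed
  \<comment> \<open>Since \<open>f\<close> has a minimum at \<open>p\<close>, its derivative
    vanishes there, whereas the barrier increases inwards at rate \<open>2 * r\<^sup>2\<close>. So
    \<open>?w\<close>, which is 0 at \<open>p\<close>, becomes negative on the way to the centre,
    against \<open>w_nonneg\<close>.\<close>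
  have "((\<lambda>h. ?w (p + h *\<^sub>R (y - p))) has_real_derivative (- \<epsilon>) * (2 * r\<^sup>2)) (at 0)"
  proof -
    have 1: "((\<lambda>h::real. p + h *\<^sub>R (y - p)) has_derivative (\<lambda>h. h *\<^sub>R (y - p))) (at 0)"
      by (auto intro!: derivative_eq_intros)
    have 2: "(?w has_derivative (\<lambda>u. dder f u p + (- \<epsilon>) * dder v u p)) (at (p + 0 *\<^sub>R (y - p)))"
      unfolding scaleR_zero_left add_0_right
      by (intro has_derivative_add has_derivative_mult_right
        C_k_on_imp_has_derivative[OF f(1) open_S pS] C_k_on_imp_has_derivative[OF v open_S pS])
    have "(p - y) \<bullet> (p - y) = r\<^sup>2" using p(1) md by simp
    then have "(p - y) \<bullet> (y - p) = - r\<^sup>2" by (metis inner_minus_right minus_diff_eq)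
    then show ?thesis
      unfolding has_field_derivative_def
      by (intro has_derivative_eq_rhs[OF has_derivative_compose[OF 1 2]]) (simp add: fp vp fun_eq_iff)
  qed
  then obtain \<delta> where \<delta>: "0 < \<delta>" "\<And>h. 0 < h \<Longrightarrow> h < \<delta> \<Longrightarrow> ?w (p + h *\<^sub>R (y - p)) < ?w (p + 0 *\<^sub>R (y - p))"
    using DERIV_neg_dec_right[of "\<lambda>h. ?w (p + h *\<^sub>R (y - p))" "(- \<epsilon>) * (2 * r\<^sup>2)" 0] \<epsilon> r(1) by (auto simp: mult_neg_pos)
  have w0: "?w p = 0" using p by (simp add: v_def md)
  \<comment> \<open>The second bound keeps the moved point in the shell: its squared distance from
    \<open>y\<close> is \<open>(1 - h)\<^sup>2 * r\<^sup>2\<close>, at least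
    \<open>r\<^sup>2 - h * (2 * r\<^sup>2)\<close>.\<close>
  define h where "h = min (\<delta> / 2) (\<eta> / (2 * r\<^sup>2))"
  have h: "0 < h" "h < \<delta>" "h * (2 * r\<^sup>2) \<le> \<eta>"
  proof -
    show "0 < h" "h < \<delta>" using \<delta>(1) \<eta>(1) r(1) by (auto simp: h_def)
    have "h * (2 * r\<^sup>2) \<le> \<eta> / (2 * r\<^sup>2) * (2 * r\<^sup>2)" by (intro mult_right_mono) (auto simp: h_def)
    then show "h * (2 * r\<^sup>2) \<le> \<eta>" using r(1) by simp
  qed
  have h1: "h \<le> 1 / 4"
  proof -
    have "h * (2 * r\<^sup>2) \<le> 1 / 4 * (2 * r\<^sup>2)" using h(3) \<eta>(3) by linarith
    then show ?thesis using r(1) by simp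
  qed
  let ?x = "p + h *\<^sub>R (y - p)"
  have mx: "?m ?x = (1 - h)\<^sup>2 * r\<^sup>2"
  proof -
    have "?x - y = (1 - h) *\<^sub>R (p - y)" by (simp add: algebra_simps)
    then have "?m ?x = (1 - h)\<^sup>2 * ?m p" by (simp only: inner_scaleR_left inner_scaleR_right power2_eq_square mult.assoc)
    then show ?thesis using p(1) by (simp add: md)
  qed
  have "r\<^sup>2 - \<eta> \<le> (1 - h)\<^sup>2 * r\<^sup>2"
  proof -
    have "(1 - h)\<^sup>2 * r\<^sup>2 = r\<^sup>2 - h * (2 * r\<^sup>2) + h\<^sup>2 * r\<^sup>2"
      by (simp add: power2_eq_square algebra_simps)
    moreover have "0 \<le> h\<^sup>2 * r\<^sup>2" by simp
    ultimately show ?thesis using h(3) by linarith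
  qed
  moreover have "(1 - h)\<^sup>2 * r\<^sup>2 \<le> r\<^sup>2"
    using h(1) h1 by (intro mult_left_le_one_le) (auto simp: power_le_one)
  then have "(dist y ?x)\<^sup>2 \<le> r\<^sup>2" using trans[OF md[of ?x, symmetric] mx] by simp
  then have "dist y ?x \<le> r" using r(1) by (rule power2_le_imp_le[OF _ less_imp_le])
  ultimately have "?x \<in> B" using mx by (simp add: B_def)
  from w_nonneg[OF this] \<delta>(2)[OF h(1,2)] w0 show False by simp
qed

end

section \<open>Alternating forms\<close>

text \<open>The conditions of \<open>alternating_form\<close> for arbitrary real vector spaces and
  values, so that real parts of forms and the real-valued sums \<open>contract2\<close> are covered
  too.\<close>

definition alt_form :: "nat \<Rightarrow> ((nat \<Rightarrow> 'a::real_vector) \<Rightarrow> 'b::real_vector) \<Rightarrow> bool" where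
  "alt_form k \<eta> \<longleftrightarrow>
     (\<forall>v w. (\<forall>i<k. v i = w i) \<longrightarrow> \<eta> v = \<eta> w) \<and>
     (\<forall>v. \<forall>i<k. linear (\<lambda>u. \<eta> (v(i := u)))) \<and>
     (\<forall>v i j. i < j \<longrightarrow> j < k \<longrightarrow> v i = v j \<longrightarrow> \<eta> v = 0)"

lemma alternating_form_eq: "alternating_form k \<eta> = alt_form k \<eta>"
  by (simp add: alternating_form_def alt_form_def)

lemma alt_form_cong: "alt_form k \<eta> \<Longrightarrow> (\<And>i. i < k \<Longrightarrow> v i = w i) \<Longrightarrow> \<eta> v = \<eta> w"
  by (simp add: alt_form_def)

lemma alt_form_linear: "alt_form k \<eta> \<Longrightarrow> i < k \<Longrightarrow> linear (\<lambda>u. \<eta> (v(i := u)))"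
  by (simp add: alt_form_def)

lemma alt_form_eq_0: "alt_form k \<eta> \<Longrightarrow> i < k \<Longrightarrow> j < k \<Longrightarrow> i \<noteq> j \<Longrightarrow> v i = v j \<Longrightarrow> \<eta> v = 0"
  unfolding alt_form_def by (metis linorder_neqE_nat)

lemma multilinear_swap:
  fixes \<eta> :: "(nat \<Rightarrow> 'a::real_vector) \<Rightarrow> 'b::real_vector"
  assumes "i \<noteq> j" "\<And>v. linear (\<lambda>u. \<eta> (v(i := u)))" "\<And>v. linear (\<lambda>u. \<eta> (v(j := u)))"
    "\<And>v. v i = v j \<Longrightarrow> \<eta> v = 0"
  shows "\<eta> (v \<circ> Transposition.transpose i j) = - \<eta> v"
proof -
  let ?f = "\<lambda>a b. \<eta> (v(i := a, j := b))"
  have z: "?f a a = 0" for a using assms(1) by (intro assms(4)) auto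
  have l1: "?f (a + a') b = ?f a b + ?f a' b" for a a' b
    using linear_add[OF assms(2)[of "v(j := b)"]] assms(1) by (simp add: fun_upd_twist)
  have l2: "?f a (b + b') = ?f a b + ?f a b'" for a b b'
    using linear_add[OF assms(3)[of "v(i := a)"]] by simp
  have "0 = ?f (v i + v j) (v i + v j)" using z by simp
  also have "\<dots> = ?f (v i) (v j) + ?f (v j) (v i)" by (simp only: l1 l2) (simp only: z add_0_left add_0_right add.commute)
  finally have "?f (v j) (v i) = - ?f (v i) (v j)" by (metis minus_unique)
  moreover have "v \<circ> Transposition.transpose i j = v(i := v j, j := v i)"
    by (auto simp: fun_eq_iff Transposition.transpose_def)
  ultimately show ?thesis by simp
qed

lemma alt_form_swap:
  "alt_form k \<eta> \<Longrightarrow> i < k \<Longrightarrow> j < k \<Longrightarrow> i \<noteq> j \<Longrightarrow> \<eta> (v \<circ> Transposition.transpose i j) = - \<eta> v"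
  by (rule multilinear_swap[where \<eta>=\<eta> and i=i and j=j and v=v])
    (blast intro: alt_form_linear alt_form_eq_0)+

text \<open>Transposing neighbours brings equal arguments at any distance next to each other, so
  vanishing on equal neighbours is enough. Sums over omitted arguments are easiest to test in this
  way.\<close>

lemma alt_formI:
  fixes \<eta> :: "(nat \<Rightarrow> 'a::real_vector) \<Rightarrow> 'b::real_vector"
  assumes "\<And>v w. (\<And>i. i < k \<Longrightarrow> v i = w i) \<Longrightarrow> \<eta> v = \<eta> w"
    and lin: "\<And>v i. i < k \<Longrightarrow> linear (\<lambda>u. \<eta> (v(i := u)))"
    and adj: "\<And>v i. Suc i < k \<Longrightarrow> v i = v (Suc i) \<Longrightarrow> \<eta> v = 0"
  shows "alt_form k \<eta>"
proof -
  have "\<eta> v = 0" if "i < j" "j < k" "v i = v j" for v i j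
    using that
  proof (induction "j - i" arbitrary: j v)
    case (Suc d)
    show ?case
    proof (cases "j = Suc i")
      case True with Suc.prems adj show ?thesis by auto
    next
      case False
      define l where "l = j - 1"
      have l: "j = Suc l" "i < l" "l < k" using Suc.prems False by (auto simp: l_def)
      have "\<eta> (v \<circ> Transposition.transpose l j) = 0"
        using Suc l by (intro Suc.hyps(1)[of l]) (auto simp: Transposition.transpose_def)
      moreover have "\<eta> (v \<circ> Transposition.transpose l j) = - \<eta> v"
      proof (rule multilinear_swap[where \<eta>=\<eta>])
        show "l \<noteq> j" using l by simp
        show "linear (\<lambda>u. \<eta> (w(l := u)))" for w by (rule lin[OF l(3)])
        show "linear (\<lambda>u. \<eta> (w(j := u)))" for w by (rule lin[OF Suc.prems(2)])
        show "\<eta> w = 0" if "w l = w j" for w using adj[of l w] that l(1) Suc.prems(2) by simp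
      qed
      ultimately show ?thesis by simp
    qed
  qed simp
  then show ?thesis unfolding alt_form_def using assms(1) lin by blast
qed

text \<open>The offset \<open>d\<close> fits the second factor of a wedge product, which reads the
  arguments from some position on.\<close>

lemma alt_form_permute:
  fixes \<eta> :: "(nat \<Rightarrow> 'a::real_vector) \<Rightarrow> 'b::real_algebra_1"
  assumes "alt_form m \<eta>" "p permutes {d..<d + m}"
  shows "\<eta> (\<lambda>i. x (p (d + i))) = of_int (sign p) * \<eta> (\<lambda>i. x (d + i))"
  using assms(2) finite_atLeastLessThan
proof (induction p arbitrary: x rule: permutes_induct)
  case id then show ?case by simp
next
  case (swap a b p)
  let ?x = "x \<circ> Transposition.transpose a b"
  have ab: "a - d < m" "b - d < m" "a - d \<noteq> b - d" "d \<le> a" "d \<le> b" using swap.hyps by auto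
  have "\<eta> (\<lambda>i. ?x (p (d + i))) = of_int (sign p) * \<eta> (\<lambda>i. ?x (d + i))" by (rule swap.IH)
  also have "(\<lambda>i. ?x (d + i)) = (\<lambda>i. x (d + i)) \<circ> Transposition.transpose (a - d) (b - d)"
    using ab by (auto simp: fun_eq_iff Transposition.transpose_def)
  also have "\<eta> \<dots> = - \<eta> (\<lambda>i. x (d + i))"
    by (rule alt_form_swap[OF assms(1) ab(1-3)])
  moreover have "sign (Transposition.transpose a b \<circ> p) = - sign p"
    using swap.hyps(3) sign_compose[OF permutation_swap_id permutes_imp_permutation[OF _ \<open>p permutes _\<close>]]
    by (simp add: sign_swap_id)
  ultimately show ?case by (simp add: o_def)
qed

lemma alt_form_add_multiple:
  assumes "alt_form k \<eta>" "i < k" "j < k" "i \<noteq> j"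
  shows "\<eta> (v(i := a + c *\<^sub>R v j)) = \<eta> (v(i := a))"
proof -
  have "\<eta> (v(i := v j)) = 0" by (rule alt_form_eq_0[OF assms]) (use assms in auto)
  moreover note lin = alt_form_linear[OF assms(1,2), of v]
  ultimately show ?thesis by (simp add: linear_add[OF lin] linear_scale[OF lin])
qed

lemma alt_form_zero_slot:
  assumes "alt_form k \<eta>" "i < k" "v i = 0"
  shows "\<eta> v = 0"
  using linear_0[OF alt_form_linear[OF assms(1,2), of v]] assms(3) by (metis fun_upd_triv)

lemma alt_form_compose_linear:
  assumes f: "linear f" and \<eta>: "alt_form k \<eta>"
  shows "alt_form k (\<lambda>w. f (\<eta> w))"
  unfolding alt_form_def
proof (intro conjI allI impI)
  show "f (\<eta> v) = f (\<eta> w)" if "\<forall>i<k. v i = w i" for v w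
    using alt_form_cong[OF \<eta>] that by metis
  show "linear (\<lambda>u. f (\<eta> (v(i := u))))" if "i < k" for v i
    using linear_compose[OF alt_form_linear[OF \<eta> that] f] by (simp add: o_def)
  show "f (\<eta> v) = 0" if "i < j" "j < k" "v i = v j" for v i j
    using alt_form_eq_0[OF \<eta>, of i j v] that linear_0[OF f] by simp
qed

lemma alt_form_scale_slots:
  assumes "alt_form k \<eta>" "m \<le> k"
  shows "\<eta> (\<lambda>i. if i < m then c i *\<^sub>R v i else v i) = (\<Prod>i<m. c i) *\<^sub>R \<eta> v"
  using assms(2)
proof (induction m)
  case (Suc m)
  let ?w = "\<lambda>i. if i < m then c i *\<^sub>R v i else v i"
  have "(\<lambda>i. if i < Suc m then c i *\<^sub>R v i else v i) = ?w(m := c m *\<^sub>R v m)"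
    by (auto simp: fun_eq_iff less_Suc_eq)
  then have "\<eta> (\<lambda>i. if i < Suc m then c i *\<^sub>R v i else v i) = c m *\<^sub>R \<eta> (?w(m := v m))"
    using linear_scale[OF alt_form_linear[OF assms(1)], of m ?w] Suc.prems by simp
  also have "?w(m := v m) = ?w" by auto
  finally show ?case using Suc by (simp add: mult.commute)
qed simp

text \<open>Both sides are multiplicative in the matrix, so elementary matrices suffice. For this
  the induction carries an arbitrary right factor \<open>B\<close>, set to the identity at the
  end.\<close>

lemma alt_form_det:
  fixes A :: "real^'N^'N" and \<eta> :: "(nat \<Rightarrow> 'a::real_vector) \<Rightarrow> real"
  assumes alt: "alt_form CARD('N) \<eta>" and e: "bij_betw e {..<CARD('N)} (UNIV :: 'N set)" and \<phi>: "linear \<phi>"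
  shows "\<eta> (\<lambda>i. \<phi> (row (e i) A)) = det A * \<eta> (\<lambda>i. \<phi> (axis (e i) 1))"
proof -
  let ?F = "\<lambda>B. \<eta> (\<lambda>i. \<phi> (row (e i) B))"
  have inj: "i < CARD('N) \<Longrightarrow> j < CARD('N) \<Longrightarrow> e i = e j \<longleftrightarrow> i = j" for i j
    using e by (auto simp: bij_betw_def inj_on_def)
  define e' where "e' n = inv_into {..<CARD('N)} e n" for n
  have e': "e' n < CARD('N)" "e (e' n) = n" for n
    using e inv_into_into[of n e "{..<CARD('N)}"] f_inv_into_f[of n e "{..<CARD('N)}"]
    by (auto simp: e'_def bij_betw_def)
  have e'_neq: "m \<noteq> n \<Longrightarrow> e' m \<noteq> e' n" for m n by (metis e'(2))
  have e'e: "i < CARD('N) \<Longrightarrow> e' (e i) = i" for i using inj e' by blast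
  have row_mult: "row i (A ** B) = (\<Sum>l\<in>UNIV. A $ i $ l *\<^sub>R row l B)" for i and A B :: "real^'N^'N"
    by (simp add: vec_eq_iff row_def matrix_matrix_mult_def)
  have "?F (A ** B) = det A * ?F B" for B
  proof (induction A arbitrary: B rule: induct_matrix_elementary_alt)
    case (1 A A')
    then show ?case by (simp add: det_mul flip: matrix_mul_assoc)
  next
    case (2 A n)
    then have "A $ n $ l = 0" for l by (simp add: row_def vec_eq_iff)
    then have "\<phi> (row (e (e' n)) (A ** B)) = 0"
      using linear_0[OF \<phi>] by (simp add: row_mult e')
    then have "?F (A ** B) = 0" by (rule alt_form_zero_slot[OF alt e'(1)])
    then show ?case using det_zero_row(1)[of n A] 2 by simp
  next
    case (3 A)
    have "row i (A ** B) = A $ i $ i *\<^sub>R row i B" for i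
    proof -
      have "(\<Sum>l\<in>UNIV. A $ i $ l *\<^sub>R row l B) = (\<Sum>l\<in>UNIV. if l = i then A $ i $ i *\<^sub>R row i B else 0)"
        using 3 by (intro sum.cong) auto
      then show ?thesis by (simp add: row_mult)
    qed
    then have "?F (A ** B) = \<eta> (\<lambda>i. if i < CARD('N) then A $ e i $ e i *\<^sub>R \<phi> (row (e i) B) else \<phi> (row (e i) B))"
      using \<phi> by (intro alt_form_cong[OF alt]) (simp add: linear_scale)
    also have "\<dots> = (\<Prod>i<CARD('N). A $ e i $ e i) * ?F B"
      by (subst alt_form_scale_slots[OF alt]) auto
    also have "(\<Prod>i<CARD('N). A $ e i $ e i) = (\<Prod>n\<in>UNIV. A $ n $ n)"
      by (rule prod.reindex_bij_betw[OF e])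
    finally show ?case using det_diagonal[of A] 3 by simp
  next
    case (4 m n)
    let ?A = "\<chi> i j. mat 1 $ i $ Transposition.transpose m n j :: real^'N^'N"
    have "i = Transposition.transpose m n l \<longleftrightarrow> l = Transposition.transpose m n i" for i l
      by (metis transpose_involutory)
    then have "?A $ i $ l = (if l = Transposition.transpose m n i then 1 else 0)" for i l
      by (simp add: mat_def)
    note A = this
    have r: "row i (?A ** B) = row (Transposition.transpose m n i) B" for i
    proof -
      have "row i (?A ** B) = (\<Sum>l\<in>UNIV. if l = Transposition.transpose m n i then row l B else 0)"
        unfolding row_mult A by (intro sum.cong) auto
      then show ?thesis by simp
    qed
    have "?F (?A ** B) = \<eta> ((\<lambda>i. \<phi> (row (e i) B)) \<circ> Transposition.transpose (e' m) (e' n))"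
      unfolding r by (intro alt_form_cong[OF alt]) (auto simp: Transposition.transpose_def e' e'e)
    also have "\<dots> = - ?F B"
      by (intro alt_form_swap[OF alt] e' e'_neq[OF 4])
    moreover have "det ?A = - 1"
    proof -
      have "det ?A = of_int (sign (Transposition.transpose m n)) * det (mat 1 :: real^'N^'N)"
        by (rule det_permute_columns) (simp add: permutes_swap_id)
      then show ?thesis using 4 by (simp add: sign_swap_id)
    qed
    ultimately show ?case by simp
  next
    case (5 m n)
    let ?A = "\<chi> i j. of_bool (i = m \<and> j = n \<or> i = j) :: real^'N^'N"
    have "row i (?A ** B) = (if i = m then row m B + row n B else row i B)" for i
    proof -
      have "?A $ i $ l *\<^sub>R row l B = (if l = i then row i B else 0) + (if l = n then if i = m then row n B else 0 else 0)" for l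
        using 5 by auto
      then show ?thesis by (simp add: row_mult sum.distrib)
    qed
    then have "?F (?A ** B) = \<eta> ((\<lambda>i. \<phi> (row (e i) B))(e' m := \<phi> (row m B) + 1 *\<^sub>R \<phi> (row (e (e' n)) B)))"
      using \<phi> by (intro alt_form_cong[OF alt]) (auto simp: linear_add e' e'e)
    also have "\<dots> = \<eta> ((\<lambda>i. \<phi> (row (e i) B))(e' m := \<phi> (row m B)))"
      using alt_form_add_multiple[OF alt e'(1)[of m] e'(1)[of n] e'_neq[OF 5], where c=1] by simp
    also have "\<dots> = ?F B" by (intro alt_form_cong[OF alt]) (auto simp: e' e'e)
    moreover have "det ?A = 1"
    proof -
      have "?A = (\<chi> k. if k = m then row m (mat 1) + 1 *s row n (mat 1) else row k (mat 1))"
        using 5 by (auto simp: vec_eq_iff row_def mat_def)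
      then show ?thesis using det_row_operation[OF 5, of "mat 1 :: real^'N^'N" 1] by simp
    qed
    ultimately show ?case by simp
  qed
  from this[of "mat 1"] have "?F A = det A * ?F (mat 1)" by simp
  also have "?F (mat 1) = \<eta> (\<lambda>i. \<phi> (axis (e i) 1))"
  proof -
    have "row i (mat 1 :: real^'N^'N) = axis i 1" for i by (auto simp: row_def mat_def axis_def vec_eq_iff)
    then show ?thesis by simp
  qed
  finally show ?thesis .
qed

text \<open>The images of the coordinate axes are the rows of the transposed matrix, which has the
  same determinant. This is how the Jacobian of a transition map will enter.\<close>

lemma alt_form_linear_image:
  fixes T :: "'a::euclidean_space \<Rightarrow> 'a" and \<eta> :: "(nat \<Rightarrow> 'a) \<Rightarrow> real" and \<phi> :: "real^'N \<Rightarrow> 'a"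
  assumes alt: "alt_form CARD('N) \<eta>" and e: "bij_betw e {..<CARD('N)} (UNIV :: 'N set)"
    and \<phi>: "linear \<phi>" "linear \<phi>'" "\<And>x. \<phi> (\<phi>' x) = x" and T: "linear T"
  shows "\<eta> (\<lambda>i. T (\<phi> (axis (e i) 1))) = det (matrix (\<lambda>y. \<phi>' (T (\<phi> y)))) * \<eta> (\<lambda>i. \<phi> (axis (e i) 1))"
proof -
  let ?M = "matrix (\<lambda>y. \<phi>' (T (\<phi> y)))"
  have l: "linear (\<lambda>y. \<phi>' (T (\<phi> y)))"
    using linear_compose[OF linear_compose[OF \<phi>(1) T] \<phi>(2)] by (simp add: o_def)
  have "row n (Finite_Cartesian_Product.transpose ?M) = \<phi>' (T (\<phi> (axis n 1)))" for n
    by (simp add: row_transpose column_def matrix_def vec_eq_iff)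
  then have "\<eta> (\<lambda>i. \<phi> (row (e i) (Finite_Cartesian_Product.transpose ?M))) = \<eta> (\<lambda>i. T (\<phi> (axis (e i) 1)))"
    by (simp add: \<phi>)
  then show ?thesis using alt_form_det[OF alt e \<phi>(1)] by (metis det_transpose)
qed

section \<open>Alternating sums over omitted arguments\<close>

lemma omit_upd:
  "omit i (v(l := u)) = (if l = i then omit i v else if l < i then (omit i v)(l := u) else (omit i v)(l - 1 := u))"
  by (auto simp: omit_def fun_eq_iff)

text \<open>If the arguments \<open>l\<close> and \<open>Suc l\<close> agree, every other summand
  still contains both and vanishes, while these two summands are equal up to opposite signs.\<close>

lemma alt_form_antisymmetrize:
  fixes \<Phi> :: "'a::real_vector \<Rightarrow> (nat \<Rightarrow> 'a) \<Rightarrow> real"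
  assumes lin: "\<And>w. linear (\<lambda>u. \<Phi> u w)" and alt: "\<And>u. alt_form m (\<Phi> u)"
  shows "alt_form (Suc m) (\<lambda>v. \<Sum>i\<le>m. (-1) ^ i * \<Phi> (v i) (omit i v))"
proof (rule alt_formI)
  fix v w :: "nat \<Rightarrow> 'a" assume eq: "\<And>i. i < Suc m \<Longrightarrow> v i = w i"
  have "\<Phi> (v i) (omit i v) = \<Phi> (w i) (omit i w)" if "i \<le> m" for i
    using eq that alt_form_cong[OF alt, of "omit i v" "omit i w" "w i"] by (auto simp: omit_def)
  then show "(\<Sum>i\<le>m. (-1) ^ i * \<Phi> (v i) (omit i v)) = (\<Sum>i\<le>m. (-1) ^ i * \<Phi> (w i) (omit i w))" by simp
next
  fix v :: "nat \<Rightarrow> 'a" and l assume l: "l < Suc m"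
  have "linear (\<lambda>u. (-1) ^ i * \<Phi> ((v(l := u)) i) (omit i (v(l := u))))" if "i \<le> m" for i
  proof (cases "i = l")
    case True
    have "linear (\<lambda>u. (-1) ^ i *\<^sub>R \<Phi> u (omit i v))" by (intro linear_compose_scale_right lin)
    with True show ?thesis by (simp add: omit_upd)
  next
    case False
    have "linear (\<lambda>u. (-1) ^ i *\<^sub>R \<Phi> (v i) ((omit i v)((if l < i then l else l - 1) := u)))"
      using l that False by (intro linear_compose_scale_right alt_form_linear[OF alt]) auto
    with False show ?thesis by (auto simp: omit_upd cong: if_cong split: if_splits)
  qed
  then show "linear (\<lambda>u. \<Sum>i\<le>m. (-1) ^ i * \<Phi> ((v(l := u)) i) (omit i (v(l := u))))"
    by (intro linear_compose_sum) auto
next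
  fix v :: "nat \<Rightarrow> 'a" and l assume l: "Suc l < Suc m" "v l = v (Suc l)"
  have z: "\<Phi> (v i) (omit i v) = 0" if "i \<le> m" "i \<noteq> l" "i \<noteq> Suc l" for i
  proof (cases "i < l")
    case True
    then show ?thesis using l that
      by (intro alt_form_eq_0[OF alt, of "l - 1" l]) (auto simp: omit_def)
  next
    case False
    then show ?thesis using l that
      by (intro alt_form_eq_0[OF alt, of l "Suc l"]) (auto simp: omit_def)
  qed
  have "omit l v = omit (Suc l) v" using l(2) by (auto simp: omit_def fun_eq_iff less_Suc_eq)
  moreover have "(\<Sum>i\<le>m. (-1) ^ i * \<Phi> (v i) (omit i v)) = (\<Sum>i\<in>{l, Suc l}. (-1) ^ i * \<Phi> (v i) (omit i v))"
    using l z by (intro sum.mono_neutral_right) auto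
  ultimately show "(\<Sum>i\<le>m. (-1) ^ i * \<Phi> (v i) (omit i v)) = 0" using l by simp
qed

section \<open>Wedge products and powers of a 2-form\<close>

lemma wedge_reindex:
  assumes "\<tau> permutes {..<k + l}"
  shows "wedge k l \<alpha> \<beta> (\<lambda>i. v (\<tau> i)) = of_int (sign \<tau>) * wedge k l \<alpha> \<beta> v"
proof -
  let ?S = "{\<sigma>. \<sigma> permutes {..<k + l}}"
  let ?f = "\<lambda>\<sigma>. of_int (sign \<sigma>) * \<alpha> (\<lambda>i. v (\<sigma> i)) * \<beta> (\<lambda>i. v (\<sigma> (k + i)))"
  have "(\<Sum>\<sigma>\<in>?S. ?f \<sigma>) = (\<Sum>\<sigma>\<in>?S. ?f (\<tau> \<circ> \<sigma>))"
    by (rule setum_permutations_compose_left[OF assms])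
  also have "\<dots> = of_int (sign \<tau>) * (\<Sum>\<sigma>\<in>?S. of_int (sign \<sigma>) * \<alpha> (\<lambda>i. v (\<tau> (\<sigma> i))) * \<beta> (\<lambda>i. v (\<tau> (\<sigma> (k + i)))))"
    unfolding sum_distrib_left
  proof (rule sum.cong[OF refl])
    fix \<sigma> assume "\<sigma> \<in> ?S"
    then have "permutation \<sigma>" "permutation \<tau>"
      using assms permutes_imp_permutation[OF finite_lessThan] by blast+
    then have "sign (\<tau> \<circ> \<sigma>) = sign \<tau> * sign \<sigma>" by (rule sign_compose[rotated])
    then show "?f (\<tau> \<circ> \<sigma>) = of_int (sign \<tau>) * (of_int (sign \<sigma>) * \<alpha> (\<lambda>i. v (\<tau> (\<sigma> i))) * \<beta> (\<lambda>i. v (\<tau> (\<sigma> (k + i)))))"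
      by (simp add: mult.assoc)
  qed
  finally have "of_int (sign \<tau>) * (\<Sum>\<sigma>\<in>?S. ?f \<sigma>) = (of_int (sign \<tau> * sign \<tau>)) *
     (\<Sum>\<sigma>\<in>?S. of_int (sign \<sigma>) * \<alpha> (\<lambda>i. v (\<tau> (\<sigma> i))) * \<beta> (\<lambda>i. v (\<tau> (\<sigma> (k + i)))))"
    by (simp only: of_int_mult mult.assoc)
  also have "sign \<tau> * sign \<tau> = 1" by (rule sign_idempotent)
  finally show ?thesis by (simp add: wedge_def)
qed

lemma alt_form_wedge:
  fixes \<alpha> \<beta> :: "'n::finite multiform"
  assumes \<alpha>: "alt_form k \<alpha>" and \<beta>: "alt_form l \<beta>"
  shows "alt_form (k + l) (wedge k l \<alpha> \<beta>)"
  unfolding alt_form_def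
proof (intro conjI allI impI)
  fix v w :: "nat \<Rightarrow> complex^'n" assume eq: "\<forall>i<k + l. v i = w i"
  have "\<alpha> (\<lambda>i. v (\<sigma> i)) = \<alpha> (\<lambda>i. w (\<sigma> i))" "\<beta> (\<lambda>i. v (\<sigma> (k + i))) = \<beta> (\<lambda>i. w (\<sigma> (k + i)))"
    if "\<sigma> permutes {..<k + l}" for \<sigma>
    using eq permutes_in_image[OF that]
      alt_form_cong[OF \<alpha>, of "\<lambda>i. v (\<sigma> i)" "\<lambda>i. w (\<sigma> i)"]
      alt_form_cong[OF \<beta>, of "\<lambda>i. v (\<sigma> (k + i))" "\<lambda>i. w (\<sigma> (k + i))"] by simp_all
  then show "wedge k l \<alpha> \<beta> v = wedge k l \<alpha> \<beta> w" by (simp add: wedge_def)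
next
  fix v :: "nat \<Rightarrow> complex^'n" and j assume j: "j < k + l"
  have "linear (\<lambda>u. of_int (sign \<sigma>) * \<alpha> (\<lambda>i. (v(j := u)) (\<sigma> i)) * \<beta> (\<lambda>i. (v(j := u)) (\<sigma> (k + i))))"
    if \<sigma>: "\<sigma> permutes {..<k + l}" for \<sigma>
  proof -
    \<comment> \<open>The only position at which slot \<open>j\<close> is read; it belongs to
      exactly one of the two factors, and the summand is linear through that factor.\<close>
    define r where "r = inv \<sigma> j"
    have r: "r < k + l" "\<sigma> i = j \<longleftrightarrow> i = r" for i
      using j permutes_in_image[OF permutes_inv[OF \<sigma>], of j] permutes_inverses[OF \<sigma>] by (auto simp: r_def)
    show ?thesis
    proof (cases "r < k")
      case True
      have "(\<lambda>i. (v(j := u)) (\<sigma> i)) = (\<lambda>i. v (\<sigma> i))(r := u)" "(\<lambda>i. (v(j := u)) (\<sigma> (k + i))) = (\<lambda>i. v (\<sigma> (k + i)))" for u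
        using r True by (auto simp: fun_eq_iff)
      moreover have "linear (\<lambda>u. of_int (sign \<sigma>) * \<alpha> ((\<lambda>i. v (\<sigma> i))(r := u)) * c)" for c
        using alt_form_linear[OF \<alpha> True, of "\<lambda>i. v (\<sigma> i)"]
        by (auto simp: linear_iff algebra_simps)
      ultimately show ?thesis by simp
    next
      case False
      have u2: "(\<lambda>i. (v(j := u)) (\<sigma> (k + i))) = (\<lambda>i. v (\<sigma> (k + i)))(r - k := u)" for u
        using r False by (auto simp: fun_eq_iff)
      have u1: "\<alpha> (\<lambda>i. (v(j := u)) (\<sigma> i)) = \<alpha> (\<lambda>i. v (\<sigma> i))" for u
        using r False by (intro alt_form_cong[OF \<alpha>]) auto
      have "r - k < l" using r False by auto
      then have "linear (\<lambda>u. c * \<beta> ((\<lambda>i. v (\<sigma> (k + i)))(r - k := u)))" for c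
        using alt_form_linear[OF \<beta>, of "r - k" "\<lambda>i. v (\<sigma> (k + i))"]
        by (auto simp: linear_iff algebra_simps)
      then show ?thesis unfolding u1 u2 .
    qed
  qed
  then have "linear (\<lambda>u. \<Sum>\<sigma> | \<sigma> permutes {..<k+l}.
      of_int (sign \<sigma>) * \<alpha> (\<lambda>i. (v(j := u)) (\<sigma> i)) * \<beta> (\<lambda>i. (v(j := u)) (\<sigma> (k + i))))"
    by (intro linear_compose_sum) auto
  from linear_compose[OF this bounded_linear.linear[OF bounded_linear_divide]]
  show "linear (\<lambda>u. wedge k l \<alpha> \<beta> (v(j := u)))"
    unfolding wedge_def o_def .
next
  fix v :: "nat \<Rightarrow> complex^'n" and i j assume ij: "i < j" "j < k + l" "v i = v j"
  have "(\<lambda>m. v (Transposition.transpose i j m)) = v" using ij by (auto simp: fun_eq_iff Transposition.transpose_def)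
  moreover have "Transposition.transpose i j permutes {..<k + l}" using ij by (intro permutes_swap_id) auto
  ultimately have "wedge k l \<alpha> \<beta> v = - wedge k l \<alpha> \<beta> v"
    using wedge_reindex[of "Transposition.transpose i j" k l \<alpha> \<beta> v] ij(1) by (simp add: sign_swap_id)
  then show "wedge k l \<alpha> \<beta> v = 0" by simp
qed

lemma alt_form_wedge_power:
  assumes "alt_form 2 \<eta>" shows "alt_form (2 * k) (wedge_power \<eta> k)"
proof (induction k)
  case 0 show ?case by (simp add: alt_form_def)
next
  case (Suc k) with alt_form_wedge[OF assms Suc.IH] show ?case by simp
qed

lemma wedge_pullback: "wedge k l (\<lambda>v. \<alpha> (\<lambda>i. T (v i))) (\<lambda>v. \<beta> (\<lambda>i. T (v i))) v = wedge k l \<alpha> \<beta> (\<lambda>i. T (v i))"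
  by (simp add: wedge_def)

lemma wedge_power_pullback: "wedge_power (\<lambda>v. \<eta> (\<lambda>i. T (v i))) k = (\<lambda>v. wedge_power \<eta> k (\<lambda>i. T (v i)))"
proof (induction k)
  case (Suc k)
  show ?case by (rule ext) (simp add: Suc wedge_pullback)
qed simp

lemma wedge_power_real:
  assumes "\<And>v. \<eta> v \<in> \<real>" shows "wedge_power \<eta> k v \<in> \<real>"
proof (induction k arbitrary: v)
  case (Suc k)
  have "(fact n :: complex) \<in> \<real>" for n by (metis Reals_of_nat of_nat_fact)
  then show ?case using assms Suc
    by (auto simp: wedge_def intro!: Reals_divide Reals_mult sum_in_Reals)
qed simp

lemma C_k_on_wedge_power:
  assumes "open S" "\<And>v. C_k_on r S (\<lambda>x. \<eta> x v)"
  shows "C_k_on r S (\<lambda>x. wedge_power (\<eta> x) k v)"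
proof (induction k arbitrary: v)
  case (Suc k)
  have "C_k_on r S (\<lambda>x. (\<Sum>\<sigma> | \<sigma> permutes {..<2 + 2 * k}. of_int (sign \<sigma>) * \<eta> x (\<lambda>i. v (\<sigma> i)) * wedge_power (\<eta> x) k (\<lambda>i. v (\<sigma> (2 + i)))) * (1 / (fact 2 * fact (2 * k))))"
    by (intro C_k_on_mult C_k_on_sum C_k_on_const assms Suc)
  then show ?case by (simp add: wedge_def)
qed simp

definition pair :: "'a \<Rightarrow> 'a \<Rightarrow> nat \<Rightarrow> 'a" where
  "pair a b = (\<lambda>i. if i = 0 then a else b)"

lemma alt_form_pair: "alt_form 2 \<eta> \<Longrightarrow> \<eta> v = \<eta> (pair (v 0) (v 1))"
  by (rule alt_form_cong) (auto simp: pair_def less_2_cases_iff)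

lemma alt_form_pair_swap: "alt_form 2 \<eta> \<Longrightarrow> \<eta> (pair b a) = - \<eta> (pair a b)"
  using alt_form_swap[of 2 \<eta> 0 1 "pair a b"] alt_form_pair[of \<eta> "pair a b \<circ> Transposition.transpose 0 1"]
  by (simp add: pair_def)

lemma alt_form_pair_same: "alt_form 2 \<eta> \<Longrightarrow> \<eta> (pair a a) = 0"
  by (rule alt_form_eq_0[of 2 \<eta> 0 1]) (auto simp: pair_def)

lemma wedge_power_Suc_eq:
  assumes "alt_form 2 \<eta>"
  shows "wedge_power \<eta> (Suc k) x = (\<Sum>\<sigma> | \<sigma> permutes {..<2 + 2 * k}. of_int (sign \<sigma>) * \<eta> (pair (x (\<sigma> 0)) (x (\<sigma> 1))) *
      wedge_power \<eta> k (\<lambda>i. x (\<sigma> (2 + i)))) / (fact 2 * fact (2 * k))"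
  using alt_form_pair[OF assms, of "\<lambda>i. x (_ i)"] by (simp add: wedge_def)

text \<open>In each summand of the expansion the vector \<open>x p\<close> is paired with another
  listed vector by the first factor, or passed on to the smaller power; either way the summand is
  0.\<close>

lemma wedge_power_eq_0:
  assumes alt: "alt_form 2 \<eta>" and p: "p < 2 * k" "\<And>q. q < 2 * k \<Longrightarrow> \<eta> (pair (x p) (x q)) = 0"
  shows "wedge_power \<eta> k x = 0"
  using p
proof (induction k arbitrary: x p)
  case (Suc k)
  have "\<eta> (pair (x (\<sigma> 0)) (x (\<sigma> 1))) * wedge_power \<eta> k (\<lambda>i. x (\<sigma> (2 + i))) = 0"
    if \<sigma>: "\<sigma> permutes {..<2 + 2 * k}" for \<sigma>
  proof -
    define r where "r = inv \<sigma> p"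
    have r: "\<sigma> r = p" "r < 2 + 2 * k"
      using Suc.prems(1) permutes_in_image[OF permutes_inv[OF \<sigma>], of p] permutes_inverses[OF \<sigma>] by (auto simp: r_def)
    have in': "\<sigma> i < 2 + 2 * k \<longleftrightarrow> i < 2 + 2 * k" for i using permutes_in_image[OF \<sigma>, of i] by simp
    show ?thesis
    proof (cases "r < 2")
      case True
      have z: "\<eta> (pair (x (\<sigma> r)) (x (\<sigma> i))) = 0" if "i < 2" for i
        unfolding r(1) using in'[of i] that by (intro Suc.prems(2)) simp
      from True consider "r = 0" | "r = 1" by linarith
      then have "\<eta> (pair (x (\<sigma> 0)) (x (\<sigma> 1))) = 0"
      proof cases
        case 1 then show ?thesis using z[of 1] by simp
      next
        case 2 then show ?thesis using z[of 0] alt_form_pair_swap[OF alt] by (metis neg_equal_0_iff_equal pos2)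
      qed
      then show ?thesis by simp
    next
      case False
      have "wedge_power \<eta> k (\<lambda>i. x (\<sigma> (2 + i))) = 0"
      proof (rule Suc.IH)
        show "r - 2 < 2 * k" using False r(2) by simp
        have "2 + (r - 2) = r" using False by simp
        then show "\<eta> (pair (x (\<sigma> (2 + (r - 2)))) (x (\<sigma> (2 + q)))) = 0" if "q < 2 * k" for q
          using in'[of "2 + q"] that by (simp only: r(1)) (intro Suc.prems(2), simp)
      qed
      then show ?thesis by simp
    qed
  qed
  then have "(\<Sum>\<sigma> | \<sigma> permutes {..<2 + 2 * k}. of_int (sign \<sigma>) * \<eta> (pair (x (\<sigma> 0)) (x (\<sigma> 1))) *
      wedge_power \<eta> k (\<lambda>i. x (\<sigma> (2 + i)))) = 0"
    unfolding mult.assoc by (intro sum.neutral) simp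
  then show ?case unfolding wedge_power_Suc_eq[OF alt] by simp
qed simp

lemma permutes_shift_pair:
  fixes \<sigma> :: "nat \<Rightarrow> nat"
  assumes "\<sigma> permutes {..<2 + m}" "\<sigma> 0 = 0" "\<sigma> 1 = 1"
  shows "\<sigma> permutes {2..<2 + m}"
proof (rule permutes_superset[OF assms(1)])
  have "\<sigma> x = x" if "x < 2" for x
    using that assms(2,3) by (auto dest: less_2_cases)
  then show "\<And>x. x \<in> {..<2 + m} - {2..<2 + m} \<Longrightarrow> \<sigma> x = x" by auto
qed

text \<open>A nonzero summand must feed a pair \<open>2 * m\<close>, \<open>2 * m + 1\<close> to the
  first factor. Moving that pair to the front is an even permutation, and the sign of what remains
  cancels the sign of the summand. So all summands are nonnegative, and the identity permutation
  contributes a positive one.\<close>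

lemma wedge_power_pos:
  assumes alt: "alt_form 2 \<eta>" and real: "\<And>v. \<eta> v \<in> \<real>"
    and x: "\<And>p q. p < 2 * k \<Longrightarrow> q < 2 * k \<Longrightarrow> p div 2 \<noteq> q div 2 \<Longrightarrow> \<eta> (pair (x p) (x q)) = 0"
      "\<And>m. m < k \<Longrightarrow> 0 < Re (\<eta> (pair (x (2 * m)) (x (2 * m + 1))))"
  shows "0 < Re (wedge_power \<eta> k x)"
  using x
proof (induction k arbitrary: x)
  case (Suc k)
  let ?S = "{\<sigma>. \<sigma> permutes {..<2 + 2 * k}}"
  let ?t = "\<lambda>\<sigma>. of_int (sign \<sigma>) * \<eta> (pair (x (\<sigma> 0)) (x (\<sigma> 1))) * wedge_power \<eta> k (\<lambda>i. x (\<sigma> (2 + i)))"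
  have pos: "0 < Re (?t \<sigma>)" if \<sigma>: "\<sigma> permutes {..<2 + 2 * k}" and eq: "\<sigma> 0 div 2 = \<sigma> 1 div 2" for \<sigma>
  proof -
    define m where "m = \<sigma> 0 div 2"
    \<comment> \<open>Exchanges pair 0 with pair \<open>m\<close>: two transpositions, hence
      even.\<close>
    define \<rho> where "\<rho> p = 2 * Transposition.transpose 0 m (p div 2) + p mod 2" for p :: nat
    have in': "\<sigma> i < 2 + 2 * k \<longleftrightarrow> i < 2 + 2 * k" for i using permutes_in_image[OF \<sigma>, of i] by simp
    have m: "m < Suc k" using in'[of 0] by (auto simp: m_def)
    have "\<sigma> 0 \<noteq> \<sigma> 1" using permutes_inj[OF \<sigma>] by (metis inj_eq zero_neq_one)
    then have \<sigma>01: "\<sigma> 0 = 2 * m \<and> \<sigma> 1 = 2 * m + 1 \<or> \<sigma> 0 = 2 * m + 1 \<and> \<sigma> 1 = 2 * m"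
      using eq unfolding m_def by presburger
    have \<rho>_eq: "\<rho> = Transposition.transpose 0 (2 * m) \<circ> Transposition.transpose 1 (2 * m + 1)"
    proof
      fix p :: nat
      have "p = 2 * (p div 2) + p mod 2" "p mod 2 = 0 \<or> p mod 2 = 1" by presburger+
      then show "\<rho> p = (Transposition.transpose 0 (2 * m) \<circ> Transposition.transpose 1 (2 * m + 1)) p"
        unfolding \<rho>_def o_def Transposition.transpose_def by (auto; presburger)
    qed
    have \<rho>_inv: "\<rho> (\<rho> p) = p" for p by (simp add: \<rho>_def)
    have \<rho>_perm: "\<rho> permutes {..<2 + 2 * k}"
      unfolding \<rho>_eq using m by (intro permutes_compose permutes_swap_id) auto
    have \<rho>_sign: "sign \<rho> = 1"
      unfolding \<rho>_eq by (simp add: sign_compose permutation_swap_id sign_swap_id)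
    define flip where "flip \<longleftrightarrow> \<sigma> 0 = 2 * m + 1"
    define \<phi> where "\<phi> = (if flip then Transposition.transpose 0 1 else id :: nat \<Rightarrow> nat)"
    \<comment> \<open>After the exchange of pairs and a possible flip, \<theta> fixes 0 and 1, hence
      permutes only the arguments of the remaining power. Its sign is that of \<sigma> up to the
      flip, and the flip is compensated by the antisymmetry of \<eta>.\<close>
    define \<theta> where "\<theta> = \<phi> \<circ> (\<rho> \<circ> \<sigma>)"
    have \<phi>: "\<phi> permutes {..<2 + 2 * k}" "sign \<phi> = (if flip then -1 else 1)" "\<phi> (\<phi> p) = p" "2 \<le> p \<Longrightarrow> \<phi> p = p" for p
      by (auto simp: \<phi>_def permutes_swap_id permutes_id sign_swap_id Transposition.transpose_def)
    have \<theta>_perm: "\<theta> permutes {..<2 + 2 * k}"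
      unfolding \<theta>_def by (intro permutes_compose \<sigma> \<rho>_perm \<phi>(1))
    have p: "permutation \<sigma>" "permutation \<rho>" "permutation \<phi>"
      using \<sigma> \<rho>_perm \<phi>(1) permutes_imp_permutation finite_lessThan by blast+
    have sign: "sign \<theta> = sign \<phi> * sign \<sigma>"
      unfolding \<theta>_def using p \<rho>_sign by (simp add: sign_compose permutation_compose)
    have \<sigma>_eq: "\<sigma> i = \<rho> (\<phi> (\<theta> i))" for i by (simp add: \<theta>_def \<rho>_inv \<phi>(3))
    have "\<rho> (2 * m) = 0" "\<rho> (2 * m + 1) = 1" by (simp_all add: \<rho>_def)
    then have "\<theta> 0 = 0" "\<theta> 1 = 1" using \<sigma>01 by (auto simp: \<theta>_def \<phi>_def flip_def)
    then have \<theta>2: "\<theta> permutes {2..<2 + 2 * k}" by (rule permutes_shift_pair[OF \<theta>_perm])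
    have "wedge_power \<eta> k (\<lambda>i. x (\<sigma> (2 + i))) = wedge_power \<eta> k (\<lambda>i. (\<lambda>p. x (\<rho> (\<phi> p))) (\<theta> (2 + i)))"
      by (simp add: \<sigma>_eq)
    also have "\<dots> = of_int (sign \<theta>) * wedge_power \<eta> k (\<lambda>i. x (\<rho> (\<phi> (2 + i))))"
      by (rule alt_form_permute[OF alt_form_wedge_power[OF alt] \<theta>2])
    also have "(\<lambda>i. x (\<rho> (\<phi> (2 + i)))) = (\<lambda>i. x (\<rho> (2 + i)))" by (simp add: \<phi>(4))
    finally have w: "wedge_power \<eta> k (\<lambda>i. x (\<sigma> (2 + i))) = of_int (sign \<theta>) * wedge_power \<eta> k (\<lambda>i. x (\<rho> (2 + i)))" .
    have IH: "0 < Re (wedge_power \<eta> k (\<lambda>i. x (\<rho> (2 + i))))"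
    proof (rule Suc.IH)
      have \<rho>_in: "\<rho> p < 2 * Suc k \<longleftrightarrow> p < 2 * Suc k" for p using permutes_in_image[OF \<rho>_perm, of p] by simp
      have \<rho>_div: "\<rho> p div 2 = Transposition.transpose 0 m (p div 2)" for p by (simp add: \<rho>_def)
      fix p q assume pq: "p < 2 * k" "q < 2 * k" "p div 2 \<noteq> q div 2"
      then have "(2 + p) div 2 \<noteq> (2 + q) div 2" by simp
      then have "\<rho> (2 + p) div 2 \<noteq> \<rho> (2 + q) div 2"
        unfolding \<rho>_div by (metis transpose_involutory)
      then show "\<eta> (pair (x (\<rho> (2 + p))) (x (\<rho> (2 + q)))) = 0" using pq \<rho>_in[of "2 + p"] \<rho>_in[of "2 + q"] by (intro Suc.prems) simp_all
    next
      fix l assume l: "l < k"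
      have "\<rho> (2 + 2 * l) = 2 * Transposition.transpose 0 m (Suc l)" "\<rho> (2 + (2 * l + 1)) = 2 * Transposition.transpose 0 m (Suc l) + 1"
        by (simp_all add: \<rho>_def)
      moreover have "Transposition.transpose 0 m (Suc l) < Suc k"
        using l m by (auto simp: Transposition.transpose_def)
      ultimately show "0 < Re (\<eta> (pair (x (\<rho> (2 + 2 * l))) (x (\<rho> (2 + (2 * l + 1))))))"
        using Suc.prems(2) by simp
    qed
    have ss: "(of_int (sign \<sigma>) :: complex) * of_int (sign \<sigma>) = 1"
      by (metis of_int_1 of_int_mult sign_idempotent)
    have "?t \<sigma> = (of_int (sign \<sigma>) * of_int (sign \<sigma>)) * (of_int (sign \<phi>) * \<eta> (pair (x (\<sigma> 0)) (x (\<sigma> 1)))) * wedge_power \<eta> k (\<lambda>i. x (\<rho> (2 + i)))"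
      unfolding w sign by (simp add: mult_ac)
    also have "of_int (sign \<phi>) * \<eta> (pair (x (\<sigma> 0)) (x (\<sigma> 1))) = \<eta> (pair (x (2 * m)) (x (2 * m + 1)))"
    proof (cases flip)
      case True
      then have "\<sigma> 0 = 2 * m + 1" "\<sigma> 1 = 2 * m" using \<sigma>01 by (auto simp: flip_def)
      moreover have "\<eta> (pair (x (2 * m + 1)) (x (2 * m))) = - \<eta> (pair (x (2 * m)) (x (2 * m + 1)))"
        by (rule alt_form_pair_swap[OF alt])
      ultimately show ?thesis using True by (simp add: \<phi>(2))
    next
      case False
      then have "\<sigma> 0 = 2 * m" "\<sigma> 1 = 2 * m + 1" using \<sigma>01 by (auto simp: flip_def)
      with False show ?thesis by (simp add: \<phi>(2))
    qed
    finally have "?t \<sigma> = \<eta> (pair (x (2 * m)) (x (2 * m + 1))) * wedge_power \<eta> k (\<lambda>i. x (\<rho> (2 + i)))"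
      unfolding ss by simp
    moreover have "Im (\<eta> (pair (x (2 * m)) (x (2 * m + 1)))) = 0" using real complex_is_Real_iff by blast
    ultimately show ?thesis using IH Suc.prems(2)[OF m] by simp
  qed
  have nonneg: "0 \<le> Re (?t \<sigma>)" if "\<sigma> \<in> ?S" for \<sigma>
  proof (cases "\<sigma> 0 div 2 = \<sigma> 1 div 2")
    case True with pos that show ?thesis by (intro less_imp_le) auto
  next
    case False
    moreover have "\<sigma> 0 < 2 * Suc k" "\<sigma> 1 < 2 * Suc k" using that permutes_in_image[of \<sigma> "{..<2 + 2 * k}"] by auto
    ultimately have "\<eta> (pair (x (\<sigma> 0)) (x (\<sigma> 1))) = 0" by (intro Suc.prems)
    then show ?thesis by simp
  qed
  have "0 < (\<Sum>\<sigma>\<in>?S. Re (?t \<sigma>))"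
    by (rule sum_pos2[where i=id]) (use pos[of id] nonneg in \<open>auto simp: permutes_id finite_permutations\<close>)
  then have "0 < Re (\<Sum>\<sigma>\<in>?S. ?t \<sigma>)" by simp
  then have "0 < Re (\<Sum>\<sigma>\<in>?S. ?t \<sigma>) / (fact 2 * fact (2 * k))" by simp
  also have "\<dots> = Re ((\<Sum>\<sigma>\<in>?S. ?t \<sigma>) / of_real (fact 2 * fact (2 * k)))" by (rule Re_divide_of_real[symmetric])
  finally show ?case unfolding wedge_power_Suc_eq[OF alt] by simp
qed simp

section \<open>Ellipticity of \<open>h \<mapsto> \<i>\<partial>\<partial>bar h \<and> \<omega>\<^sup>n\<^sup>-\<^sup>1\<close>\<close>

text \<open>The wedge product of the 2-form \<open>K a b - K b a\<close> with \<beta>, in the shape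
  that \<partial> after \<partial>bar produces: \<open>v i\<close> is the direction of the outer
  derivative, \<open>omit i v j\<close> that of the inner one, and the other arguments go to
  \<beta>.\<close>

definition contract2 :: "nat \<Rightarrow> ('a \<Rightarrow> 'a \<Rightarrow> real) \<Rightarrow> ((nat \<Rightarrow> 'a) \<Rightarrow> real) \<Rightarrow> (nat \<Rightarrow> 'a) \<Rightarrow> real" where
  "contract2 m K \<beta> v = (\<Sum>i\<le>Suc m. (-1) ^ i *
     (\<Sum>j\<le>m. (-1) ^ j * (K (v i) (omit i v j) * \<beta> (omit j (omit i v)))))"

lemma alt_form_contract2:
  fixes K :: "'a::real_vector \<Rightarrow> 'a \<Rightarrow> real"
  assumes K: "bilinear K" and \<beta>: "alt_form m \<beta>"
  shows "alt_form (Suc (Suc m)) (contract2 m K \<beta>)"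
proof -
  have l1: "linear (\<lambda>u. K u a)" and l2: "linear (\<lambda>a. K u a)" for u a
    using K by (auto simp: bilinear_def)
  have 1: "alt_form (Suc m) (\<lambda>w. \<Sum>j\<le>m. (-1) ^ j * (K u (w j) * \<beta> (omit j w)))" for u
  proof (rule alt_form_antisymmetrize)
    fix w :: "nat \<Rightarrow> 'a" show "linear (\<lambda>a. K u a * \<beta> w)"
      using l2[of u] by (auto simp: linear_iff algebra_simps)
  next
    fix a :: 'a
    show "alt_form m (\<lambda>w. K u a * \<beta> w)"
      using \<beta> unfolding alt_form_def by (auto simp: linear_iff algebra_simps)
  qed
  show ?thesis
    unfolding contract2_def[abs_def]
  proof (rule alt_form_antisymmetrize[OF _ 1])
    fix w :: "nat \<Rightarrow> 'a"
    show "linear (\<lambda>u. \<Sum>j\<le>m. (-1) ^ j * (K u (w j) * \<beta> (omit j w)))"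
      using l1 by (intro linear_compose_sum ballI) (auto simp: linear_iff algebra_simps)
  qed
qed

lemma contract2_pullback:
  "contract2 m (\<lambda>a b. K (T a) (T b)) (\<lambda>w. \<beta> (\<lambda>i. T (w i))) v = contract2 m K \<beta> (\<lambda>i. T (v i))"
proof -
  have o: "omit i (\<lambda>i. T (v i)) = (\<lambda>j. T (omit i v j))" for i and v :: "nat \<Rightarrow> 'a"
    by (auto simp: omit_def fun_eq_iff)
  show ?thesis by (simp add: contract2_def o)
qed

lemma alt_form_add_span:
  assumes alt: "alt_form k \<eta>" and i: "i < k" and I: "I \<subseteq> {..<k}" "i \<notin> I" and w: "w \<in> span (v ` I)"
  shows "\<eta> (v(i := a + w)) = \<eta> (v(i := a))"
proof -
  note lin = alt_form_linear[OF alt i, of v]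
  have "\<eta> (v(i := u)) = 0" if u: "u \<in> v ` I" for u
  proof -
    obtain l where l: "l \<in> I" "u = v l" using u by auto
    then show ?thesis using I i by (intro alt_form_eq_0[OF alt, of i l]) auto
  qed
  then have "\<eta> (v(i := w)) = 0" using linear_eq_0_on_span[OF lin _ w] by blast
  then show ?thesis by (simp add: linear_add[OF lin])
qed

definition J :: "complex^'n \<Rightarrow> complex^'n" where "J u = \<i> *s u"

lemma J_J [simp]: "J (J u) = - u"
  by (simp add: J_def vec_eq_iff)

lemma bounded_linear_J: "bounded_linear (J :: complex^'n::finite \<Rightarrow> _)"
proof -
  have "linear (J :: complex^'n \<Rightarrow> _)" by (rule linearI) (simp_all add: J_def vec_eq_iff algebra_simps)
  then show ?thesis by (simp add: linear_conv_bounded_linear)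
qed

lemma linear_J: "linear (J :: complex^'n::finite \<Rightarrow> _)"
  using bounded_linear_J by (rule bounded_linear.linear)

text \<open>The real list \<open>u 0\<close>, \<open>J (u 0)\<close>, \<open>u 1\<close>,
  \<open>J (u 1)\<close> and so on; its blocks of two are the pairs of
  \<open>wedge_power_pos\<close>, and for the standard complex basis it is the standard real
  one.\<close>

definition pairs :: "(nat \<Rightarrow> complex^'n) \<Rightarrow> nat \<Rightarrow> complex^'n" where
  "pairs u p = (if even p then u (p div 2) else J (u (p div 2)))"

lemma pairs_simps [simp]: "pairs u (2 * m) = u m" "pairs u (Suc (2 * m)) = J (u m)" "pairs u (2 * m + 1) = J (u m)"
  by (simp_all add: pairs_def)

lemma nat_pair_cases:
  obtains m where "p = 2 * m" | m where "p = 2 * m + (1::nat)"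
  by (metis oddE evenE)

text \<open>For the Hessian \<open>h\<close> of a real function this is the 2-form
  \<open>dd\<^sup>c\<close>, twice \<i>\<partial>\<partial>bar of the function.\<close>

definition Jskew :: "(complex^'n \<Rightarrow> complex^'n \<Rightarrow> real) \<Rightarrow> complex^'n \<Rightarrow> complex^'n \<Rightarrow> real" where
  "Jskew h u w = h (J u) w - h u (J w)"

lemma bilinear_Jskew:
  assumes "bilinear h" shows "bilinear (Jskew h :: complex^'n::finite \<Rightarrow> complex^'n \<Rightarrow> real)"
proof -
  have l: "linear (\<lambda>u. h u a)" "linear (\<lambda>a. h u a)" for u a
    using assms by (auto simp: bilinear_def)
  have "linear (\<lambda>u. h (J u) a)" "linear (\<lambda>u. h a (J u))" for a
    using linear_compose[OF linear_J l(1)] linear_compose[OF linear_J l(2)] by (simp_all add: o_def)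
  with l show ?thesis unfolding bilinear_def Jskew_def by (intro conjI allI linear_compose_sub)
qed

lemma bilinear_uminus:
  assumes "bilinear h" shows "h (- a) b = - h a b" "h a (- b) = - h a b"
  using assms by (simp_all add: bilinear_lneg bilinear_rneg)

text \<open>Here \<open>j'\<close> is the original index of the argument removed second: removing
  \<open>i\<close> has shifted the later ones down by one. The two claims match the arguments that
  are left with the indices other than \<open>i\<close> and \<open>j'\<close>.\<close>

lemma omit_omit:
  assumes "j \<le> m" "i \<le> Suc m" "j' = (if j < i then j else Suc j)"
  shows "q < m \<Longrightarrow> \<exists>r. r < Suc (Suc m) \<and> r \<noteq> i \<and> r \<noteq> j' \<and> omit j (omit i v) q = v r"
    and "r < Suc (Suc m) \<Longrightarrow> r \<noteq> i \<Longrightarrow> r \<noteq> j' \<Longrightarrow> \<exists>q<m. omit j (omit i v) q = v r"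
proof -
  show "\<exists>r. r < Suc (Suc m) \<and> r \<noteq> i \<and> r \<noteq> j' \<and> omit j (omit i v) q = v r" if "q < m"
  proof -
    define r where "r = (let q' = if q < j then q else Suc q in if q' < i then q' else Suc q')"
    have "r < Suc (Suc m) \<and> r \<noteq> i \<and> r \<noteq> j' \<and> omit j (omit i v) q = v r"
      using assms that by (auto simp: r_def omit_def Let_def)
    then show ?thesis by blast
  qed
  show "\<exists>q<m. omit j (omit i v) q = v r" if "r < Suc (Suc m)" "r \<noteq> i" "r \<noteq> j'"
  proof -
    define q where "q = (let q' = if r < i then r else r - 1 in if q' < j then q' else q' - 1)"
    have "q < m \<and> omit j (omit i v) q = v r"
      using assms that by (cases r) (auto simp: q_def omit_def Let_def split: if_splits)
    then show ?thesis by blast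
  qed
qed

text \<open>If the two removed arguments do not form a pair, the partner of the first one stays
  behind, orthogonal to everything left, and the power vanishes. The removed pairs give a diagonal
  sum, whose coefficients are positive by \<open>wedge_power_pos\<close>.\<close>

lemma contract2_orthogonal:
  fixes \<eta> :: "'n::finite multiform" and u :: "nat \<Rightarrow> complex^'n"
  assumes alt: "alt_form 2 \<eta>" and real: "\<And>v. \<eta> v \<in> \<real>"
    and orth: "\<And>p q. p < 2 * Suc k \<Longrightarrow> q < 2 * Suc k \<Longrightarrow> p div 2 \<noteq> q div 2 \<Longrightarrow> \<eta> (pair (pairs u p) (pairs u q)) = 0"
    and pos: "\<And>m. m < Suc k \<Longrightarrow> 0 < Re (\<eta> (pair (u m) (J (u m))))"
  shows "\<And>l. l < Suc k \<Longrightarrow> 0 < Re (wedge_power \<eta> k (pairs (omit l u)))"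
    and "bilinear h \<Longrightarrow> contract2 (2 * k) (Jskew h) (\<lambda>w. Re (wedge_power \<eta> k w)) (pairs u) =
       (\<Sum>l<Suc k. 2 * Re (wedge_power \<eta> k (pairs (omit l u))) * (h (u l) (u l) + h (J (u l)) (J (u l))))"
proof -
  show "0 < Re (wedge_power \<eta> k (pairs (omit l u)))" if l: "l < Suc k" for l
  proof (rule wedge_power_pos[OF alt real])
    have o: "pairs (omit l u) p = pairs u (if p div 2 < l then p else p + 2)" for p
      by (simp add: pairs_def omit_def)
    fix p q assume "p < 2 * k" "q < 2 * k" "p div 2 \<noteq> q div 2"
    then show "\<eta> (pair (pairs (omit l u) p) (pairs (omit l u) q)) = 0"
      unfolding o by (intro orth) auto
  next
    fix m assume "m < k"
    then show "0 < Re (\<eta> (pair (pairs (omit l u) (2 * m)) (pairs (omit l u) (2 * m + 1))))"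
      using pos[of m] pos[of "Suc m"] by (simp add: omit_def)
  qed
  let ?K = "Jskew h" and ?\<beta> = "\<lambda>w. Re (wedge_power \<eta> k w)" and ?v = "pairs u"
  let ?B = "\<lambda>l. Re (wedge_power \<eta> k (pairs (omit l u)))"
  have zero: "?\<beta> (omit j (omit i ?v)) = 0"
    if ij: "i \<le> Suc (2 * k)" "j \<le> 2 * k" "(if j < i then j else Suc j) div 2 \<noteq> i div 2" for i j
  proof -
    define j' where "j' = (if j < i then j else Suc j)"
    \<comment> \<open>The partner of \<open>i\<close> in its pair.\<close>
    define r where "r = (if even i then Suc i else i - 1)"
    have rd: "r div 2 = i div 2" and "r \<noteq> i" and rs: "\<And>s. s div 2 = i div 2 \<Longrightarrow> s = i \<or> s = r"
    proof -
      show "r div 2 = i div 2" "r \<noteq> i" by (cases i rule: nat_pair_cases; simp add: r_def)+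
      show "s = i \<or> s = r" if "s div 2 = i div 2" for s
        using that by (cases i rule: nat_pair_cases; cases s rule: nat_pair_cases) (simp_all add: r_def)
    qed
    moreover have "r \<noteq> j'" using rd ij(3) by (auto simp: j'_def)
    moreover have "r < Suc (Suc (2 * k))"
    proof -
      have "i div 2 \<le> k" using ij(1) by simp
      then show ?thesis using rd by linarith
    qed
    ultimately have r: "r < Suc (Suc (2 * k))" "r \<noteq> i" "r \<noteq> j'" by blast+
    obtain q where q: "q < 2 * k" "omit j (omit i ?v) q = ?v r"
      using omit_omit(2)[OF ij(2,1) j'_def r(1-3)] by blast
    have "wedge_power \<eta> k (omit j (omit i ?v)) = 0"
    proof (rule wedge_power_eq_0[OF alt q(1)])
      fix q' assume "q' < 2 * k"
      then obtain s where s: "s < Suc (Suc (2 * k))" "s \<noteq> i" "omit j (omit i ?v) q' = ?v s"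
        using omit_omit(1)[OF ij(2,1) j'_def] by blast
      show "\<eta> (pair (omit j (omit i ?v) q) (omit j (omit i ?v) q')) = 0"
      proof (cases "s = r")
        case True then show ?thesis using q s alt_form_pair_same[OF alt] by simp
      next
        case False
        then have "r div 2 \<noteq> s div 2" using rd rs[of s] s(2) by auto
        then show ?thesis unfolding q(2) s(3) using r(1) s(1) by (intro orth) auto
      qed
    qed
    then show ?thesis by simp
  qed
  have skip: "omit (2 * l) (omit (2 * l) ?v) = pairs (omit l u)" "omit (2 * l) (omit (2 * l + 1) ?v) = pairs (omit l u)" for l
  proof -
    show "omit (2 * l) (omit (2 * l) ?v) = pairs (omit l u)"
      by (rule ext) (auto simp: omit_def pairs_def)
    show "omit (2 * l) (omit (2 * l + 1) ?v) = pairs (omit l u)"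
      by (rule ext) (auto simp: omit_def pairs_def)
  qed
  \<comment> \<open>After the removal of \<open>i\<close> its partner sits at position
    \<open>2 * (i div 2)\<close> in both cases: if \<open>i\<close> is even, the partner
    \<open>i + 1\<close> has moved down by one; if \<open>i\<close> is odd, the partner
    \<open>i - 1\<close> has not moved.\<close>
  have inner: "(\<Sum>j\<le>2 * k. (-1) ^ j * (?K (?v i) (omit i ?v j) * ?\<beta> (omit j (omit i ?v)))) =
      ?K (?v i) (omit i ?v (2 * (i div 2))) * ?B (i div 2)" if i: "i \<le> Suc (2 * k)" for i
  proof -
    have "(\<Sum>j\<le>2 * k. (-1) ^ j * (?K (?v i) (omit i ?v j) * ?\<beta> (omit j (omit i ?v)))) =
       (\<Sum>j\<in>{2 * (i div 2)}. (-1) ^ j * (?K (?v i) (omit i ?v j) * ?\<beta> (omit j (omit i ?v))))"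
    proof (rule sum.mono_neutral_right)
      show "{2 * (i div 2)} \<subseteq> {..2 * k}" using i by auto
      show "\<forall>j\<in>{..2 * k} - {2 * (i div 2)}. (-1) ^ j * (?K (?v i) (omit i ?v j) * ?\<beta> (omit j (omit i ?v))) = 0"
      proof
        fix j assume j: "j \<in> {..2 * k} - {2 * (i div 2)}"
        have "(if j < i then j else Suc j) div 2 \<noteq> i div 2"
          using j by (auto split: if_splits)
        then have "?\<beta> (omit j (omit i ?v)) = 0" using j i by (intro zero) auto
        then show "(-1) ^ j * (?K (?v i) (omit i ?v j) * ?\<beta> (omit j (omit i ?v))) = 0" by simp
      qed
    qed auto
    also have "\<dots> = ?K (?v i) (omit i ?v (2 * (i div 2))) * ?B (i div 2)"
      by (cases i rule: nat_pair_cases) (simp_all add: skip[simplified])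
    finally show ?thesis .
  qed
  have "contract2 (2 * k) ?K ?\<beta> ?v = (\<Sum>i\<le>Suc (2 * k). (-1) ^ i * (?K (?v i) (omit i ?v (2 * (i div 2))) * ?B (i div 2)))"
    unfolding contract2_def by (intro sum.cong) (use inner in auto)
  also have "{..Suc (2 * k)} = {..<2 * Suc k}" by auto
  also have "(\<Sum>i<2 * Suc k. (-1) ^ i * (?K (?v i) (omit i ?v (2 * (i div 2))) * ?B (i div 2))) =
     (\<Sum>l<Suc k. ?K (u l) (J (u l)) * ?B l - ?K (J (u l)) (u l) * ?B l)"
  proof -
    have "(\<Sum>i<2 * n. (-1) ^ i * (?K (?v i) (omit i ?v (2 * (i div 2))) * ?B (i div 2))) =
     (\<Sum>l<n. ?K (u l) (J (u l)) * ?B l - ?K (J (u l)) (u l) * ?B l)" for n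
      by (induction n) (simp_all add: omit_def)
    then show ?thesis .
  qed
  finally have eq: "contract2 (2 * k) ?K ?\<beta> ?v = (\<Sum>l<Suc k. ?K (u l) (J (u l)) * ?B l - ?K (J (u l)) (u l) * ?B l)" .
  show "contract2 (2 * k) ?K ?\<beta> ?v = (\<Sum>l<Suc k. 2 * ?B l * (h (u l) (u l) + h (J (u l)) (J (u l))))"
    if h: "bilinear h"
    unfolding eq by (intro sum.cong) (simp_all add: Jskew_def bilinear_uminus[OF h] algebra_simps)
qed

section \<open>Hermitian inner products and Gram-Schmidt orthogonalisation\<close>

definition herm :: "complex^'n^'n \<Rightarrow> complex^'n::finite \<Rightarrow> complex^'n \<Rightarrow> complex" where
  "herm H a b = (\<Sum>j\<in>UNIV. \<Sum>k\<in>UNIV. H $ j $ k * (a $ j) * cnj (b $ k))"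

lemma herm_add_left: "herm H (a + a') b = herm H a b + herm H a' b"
  by (simp add: herm_def algebra_simps sum.distrib)

lemma herm_scale_left: "herm H (c *s a) b = c * herm H a b"
  by (simp add: herm_def sum_distrib_left mult_ac)

lemma herm_scale_right: "herm H a (c *s b) = cnj c * herm H a b"
  by (simp add: herm_def sum_distrib_left mult_ac)

lemma herm_sum_left: "herm H (\<Sum>i\<in>I. a i) b = (\<Sum>i\<in>I. herm H (a i) b)"
proof -
  have "herm H 0 b = 0" by (simp add: herm_def)
  then show ?thesis by (induction I rule: infinite_finite_induct) (simp_all add: herm_add_left)
qed

lemma herm_cnj:
  assumes "\<And>j k. H $ k $ j = cnj (H $ j $ k)"
  shows "herm H b a = cnj (herm H a b)"
proof -
  have "cnj (herm H a b) = (\<Sum>j\<in>UNIV. \<Sum>k\<in>UNIV. H $ k $ j * b $ k * cnj (a $ j))"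
    unfolding herm_def by (simp add: assms[symmetric] mult_ac)
  also have "\<dots> = herm H b a" unfolding herm_def by (rule sum.swap)
  finally show ?thesis by simp
qed

lemma wedge_1_1: "wedge 1 1 \<alpha> \<beta> v = \<alpha> (\<lambda>i. v (id i)) * \<beta> (\<lambda>i. v (1 + i)) -
    \<alpha> (\<lambda>i. v (Transposition.transpose 0 1 i)) * \<beta> (\<lambda>i. v (Transposition.transpose 0 1 (1 + i)))"
proof -
  have 2: "{..<1 + 1} = {0, 1::nat}" by auto
  have S: "{\<sigma>. \<sigma> permutes {0, 1::nat}} = {id, Transposition.transpose 0 1}"
  proof -
    have "\<sigma> permutes {0, 1::nat} \<longleftrightarrow> \<sigma> = id \<or> \<sigma> = Transposition.transpose 0 1" for \<sigma>
      by (rule permutes_doubleton_iff)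
    then show ?thesis by auto
  qed
  have "id \<noteq> Transposition.transpose 0 (1::nat)"
    by (metis id_apply transpose_apply_first zero_neq_one)
  then show ?thesis unfolding wedge_def 2 S by (simp add: sign_swap_id)
qed

text \<open>Since \<eta> is a multiple of the imaginary part of \<open>H\<close>, it vanishes on all
  pairs formed from two \<open>H\<close>-orthogonal vectors and their images under \<open>J\<close>,
  and its value on \<open>u\<close>, \<open>J u\<close> is
  \<open>2 * Re (herm H u u)\<close>.\<close>

lemma positive_11_form_herm:
  assumes "positive_11_form \<eta>"
  obtains H where "\<And>a b. herm H b a = cnj (herm H a b)" "\<And>u. u \<noteq> 0 \<Longrightarrow> 0 < Re (herm H u u)"
    "\<And>v. \<eta> v = of_real (- 2 * Im (herm H (v 0) (v 1)))"
proof -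
  obtain H where H: "\<And>j k. H $ k $ j = cnj (H $ j $ k)" "\<And>u. u \<noteq> 0 \<Longrightarrow> 0 < Re (herm H u u)"
    and \<eta>: "\<eta> = (\<lambda>v. \<i> * (\<Sum>j\<in>UNIV. \<Sum>k\<in>UNIV. H $ j $ k * wedge 1 1 (dz j) (dzbar k) v))"
    using assms unfolding positive_11_form_def herm_def by blast
  have w: "wedge 1 1 (dz j) (dzbar k) v = v 0 $ j * cnj (v 1 $ k) - v 1 $ j * cnj (v 0 $ k)" for j k :: 'a and v
    unfolding wedge_1_1 by (simp add: dz_def dzbar_def)
  have "\<eta> v = \<i> * (herm H (v 0) (v 1) - cnj (herm H (v 0) (v 1)))" for v
    unfolding \<eta> w herm_cnj[OF H(1), of "v 1", symmetric] unfolding herm_def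
    by (simp add: algebra_simps sum_subtractf)
  then have "\<eta> v = of_real (- 2 * Im (herm H (v 0) (v 1)))" for v
    by (simp add: complex_eq_iff)
  with that[of H] herm_cnj[OF H(1)] H(2) show thesis by blast
qed

lemma span_J:
  assumes "w \<in> span (pairs u ` {..<2 * m})"
  shows "J w \<in> span (pairs u ` {..<2 * m})"
proof -
  have "J w \<in> span (J ` pairs u ` {..<2 * m})"
    using linear_span_image[OF linear_J] assms by blast
  also have "\<dots> \<subseteq> span (pairs u ` {..<2 * m})"
  proof (rule span_minimal[OF _ subspace_span], safe)
    fix p assume p: "p < 2 * m"
    show "J (pairs u p) \<in> span (pairs u ` {..<2 * m})"
    proof (cases p rule: nat_pair_cases)
      case (1 l)
      then have "J (pairs u p) = pairs u (2 * l + 1)" "2 * l + 1 < 2 * m" using p by auto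
      then show ?thesis by (metis imageI lessThan_iff span_base)
    next
      case (2 l)
      then have "J (pairs u p) = - pairs u (2 * l)" "2 * l < 2 * m" using p by auto
      then show ?thesis by (metis imageI lessThan_iff span_base span_neg)
    qed
  qed
  finally show ?thesis .
qed

lemma scale_complex_eq: "c *s u = Re c *\<^sub>R u + Im c *\<^sub>R J u"
  by (simp add: J_def vec_eq_iff complex_eq_iff)

lemma pairs_cong: "(\<And>m. m < k \<Longrightarrow> u m = u' m) \<Longrightarrow> p < 2 * k \<Longrightarrow> pairs u p = pairs u' p"
  by (simp add: pairs_def)

text \<open>No normalisation takes place, so the change of basis is unipotent. The two conditions on
  coordinates are carried through the induction because they show that each \<open>u m\<close> is
  nonzero, as the divisions by \<open>herm H (u l) (u l)\<close> require.\<close>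

lemma Gram_Schmidt:
  fixes H :: "complex^'n::finite^'n"
  assumes cnj: "\<And>a b. herm H b a = cnj (herm H a b)" and pos: "\<And>u. u \<noteq> 0 \<Longrightarrow> 0 < Re (herm H u u)"
    and e: "inj_on e {..<n}" and "k \<le> n"
  shows "\<exists>u. \<forall>m<k. u m - axis (e m) 1 \<in> span (pairs u ` {..<2 * m}) \<and> (\<forall>l<m. herm H (u m) (u l) = 0) \<and>
     u m $ e m = 1 \<and> (\<forall>l<n. m < l \<longrightarrow> u m $ e l = 0)"
  using assms(4)
proof (induction k)
  case (Suc k)
  then obtain u where u: "\<And>m. m < k \<Longrightarrow> u m - axis (e m) 1 \<in> span (pairs u ` {..<2 * m})"
    "\<And>m l. m < k \<Longrightarrow> l < m \<Longrightarrow> herm H (u m) (u l) = 0" "\<And>m. m < k \<Longrightarrow> u m $ e m = 1"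
    "\<And>m l. m < k \<Longrightarrow> l < n \<Longrightarrow> m < l \<Longrightarrow> u m $ e l = 0"
    by force
  define c where "c l = - (herm H (axis (e k) 1) (u l) / herm H (u l) (u l))" for l
  define w where "w = axis (e k) 1 + (\<Sum>l<k. c l *s u l)"
  let ?u = "u(k := w)"
  have nz: "herm H (u l) (u l) \<noteq> 0" if "l < k" for l
  proof -
    have "u l \<noteq> 0" using u(3)[OF that] by auto
    then show ?thesis using pos by force
  qed
  have orth: "herm H (u l) (u m) = 0" if "l < k" "m < k" "l \<noteq> m" for l m
    using u(2)[of l m] u(2)[of m l] that cnj[of "u l" "u m"] by (metis complex_cnj_zero linorder_neqE_nat)
  have "\<forall>m<Suc k. ?u m - axis (e m) 1 \<in> span (pairs ?u ` {..<2 * m}) \<and> (\<forall>l<m. herm H (?u m) (?u l) = 0) \<and>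
     ?u m $ e m = 1 \<and> (\<forall>l<n. m < l \<longrightarrow> ?u m $ e l = 0)"
  proof (intro allI impI)
    fix m assume m: "m < Suc k"
    have p: "pairs ?u ` {..<2 * m} = pairs u ` {..<2 * m}"
      using m by (intro image_cong pairs_cong[of m]) auto
    show "?u m - axis (e m) 1 \<in> span (pairs ?u ` {..<2 * m}) \<and> (\<forall>l<m. herm H (?u m) (?u l) = 0) \<and>
     ?u m $ e m = 1 \<and> (\<forall>l<n. m < l \<longrightarrow> ?u m $ e l = 0)"
    proof (cases "m = k")
      case False
      then show ?thesis using m u unfolding p by auto
    next
      case True
      have "(\<Sum>l<k. c l *s u l) \<in> span (pairs u ` {..<2 * k})"
      proof (rule span_sum)
        fix l assume l: "l \<in> {..<k}"
        have 1: "u l \<in> span (pairs u ` {..<2 * k})"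
          using l by (intro span_base image_eqI[of _ _ "2 * l"]) auto
        show "c l *s u l \<in> span (pairs u ` {..<2 * k})"
          unfolding scale_complex_eq by (intro span_add span_scale 1 span_J)
      qed
      moreover have "herm H w (u l) = 0" if "l < k" for l
      proof -
        have "(\<Sum>i<k. c i * herm H (u i) (u l)) = (\<Sum>i<k. if i = l then c l * herm H (u l) (u l) else 0)"
          using orth that by (intro sum.cong) auto
        then have "herm H w (u l) = herm H (axis (e k) 1) (u l) + c l * herm H (u l) (u l)"
          using that by (simp add: w_def herm_add_left herm_sum_left herm_scale_left)
        then show ?thesis using nz[OF that] by (simp add: c_def)
      qed
      moreover have "w $ e k = 1" "l < n \<Longrightarrow> k < l \<Longrightarrow> w $ e l = 0" for l
      proof -
        have z: "(\<Sum>i<k. c i * u i $ e l) = 0" if "l < n" "k \<le> l" for l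
          using u(4) that by (intro sum.neutral) auto
        show "w $ e k = 1" using z[of k] Suc.prems by (simp add: w_def)
        assume l: "l < n" "k < l"
        then have "e l \<noteq> e k" using inj_onD[OF e, of l k] Suc.prems by auto
        then show "w $ e l = 0" using z[of l] l by (simp add: w_def axis_def)
      qed
      ultimately show ?thesis using True unfolding p by (auto simp: w_def)
    qed
  qed
  then show ?case by blast
qed simp

text \<open>Replace \<open>a j\<close>, \<open>J (a j)\<close> by \<open>u j\<close>,
  \<open>J (u j)\<close> one index at a time. The differences lie in the span of earlier arguments,
  which is closed under \<open>J\<close>, and an alternating form ignores them.\<close>

lemma alt_form_pairs_unipotent:
  assumes alt: "alt_form (2 * n) \<Psi>" and u: "\<And>m. m < n \<Longrightarrow> u m - a m \<in> span (pairs u ` {..<2 * m})"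
  shows "\<Psi> (pairs u) = \<Psi> (pairs a)"
proof -
  define mix where "mix j m = (if m < j then u m else a m)" for j m
  have "\<Psi> (pairs (mix j)) = \<Psi> (pairs a)" if "j \<le> n" for j
    using that
  proof (induction j)
    case 0 then show ?case by (simp add: mix_def[abs_def])
  next
    case (Suc j)
    let ?V = "pairs (mix j)"
    define w where "w = u j - a j"
    have V_I: "pairs u ` {..<2 * j} = ?V ` {..<2 * j}"
      by (intro image_cong pairs_cong[of j]) (auto simp: mix_def)
    have w: "w \<in> span (?V ` {..<2 * j})" "J w \<in> span (?V ` {..<2 * j})"
      using u[of j] span_J[of w u j] Suc.prems unfolding w_def V_I[symmetric] by auto
    have "\<Psi> (?V(2 * j := a j + w)) = \<Psi> (?V(2 * j := a j))"
      using Suc.prems w(1) by (intro alt_form_add_span[OF alt, where I="{..<2 * j}"]) auto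
    also have "?V(2 * j := a j) = ?V" by (rule fun_upd_idem) (simp add: mix_def)
    finally have 1: "\<Psi> (?V(2 * j := a j + w)) = \<Psi> ?V" .
    let ?W = "?V(2 * j := a j + w)"
    have "?W ` {..<2 * j} = ?V ` {..<2 * j}" by (intro image_cong) auto
    then have "\<Psi> (?W(2 * j + 1 := J (a j) + J w)) = \<Psi> (?W(2 * j + 1 := J (a j)))"
      using Suc.prems w(2) by (intro alt_form_add_span[OF alt, where I="{..<2 * j}"]) auto
    also have "?W(2 * j + 1 := J (a j)) = ?W" by (rule fun_upd_idem) (simp add: mix_def)
    finally have 2: "\<Psi> (?W(2 * j + 1 := J (a j) + J w)) = \<Psi> ?W" .
    have "?W(2 * j + 1 := J (a j) + J w) = pairs (mix (Suc j))"
    proof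
      fix p
      have "a j + w = u j" "J (a j) + J w = J (u j)"
        by (simp_all add: w_def linear_diff[OF linear_J])
      then show "(?W(2 * j + 1 := J (a j) + J w)) p = pairs (mix (Suc j)) p"
      proof (cases p rule: nat_pair_cases)
        case (1 m)
        then show ?thesis using \<open>a j + w = u j\<close> by (auto simp: mix_def less_Suc_eq)
      next
        case (2 m)
        have "2 * m + 1 \<noteq> 2 * j" by presburger
        then show ?thesis using 2 \<open>J (a j) + J w = J (u j)\<close> by (auto simp: mix_def less_Suc_eq)
      qed
    qed
    with 1 2 Suc show ?case by simp
  qed
  from this[of n] have "\<Psi> (pairs (mix n)) = \<Psi> (pairs a)" by simp
  moreover have "\<Psi> (pairs (mix n)) = \<Psi> (pairs u)"
    by (intro alt_form_cong[OF alt] pairs_cong[of n]) (auto simp: mix_def)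
  ultimately show ?thesis by simp
qed

text \<open>In an orthogonal basis the second-order operator \<open>h \<mapsto> \<i>\<partial>\<partial>bar h \<and> \<omega>\<^sup>n\<^sup>-\<^sup>1\<close> is diagonal;
  this gives its ellipticity.  The basis is obtained from the standard one by a unipotent change,
  so that the value on the standard basis is the same.\<close>

lemma positive_11_form_contract2:
  fixes \<eta> :: "'n::finite multiform" and e :: "nat \<Rightarrow> 'n"
  assumes alt: "alt_form 2 \<eta>" and pos: "positive_11_form \<eta>" and e: "bij_betw e {..<Suc k} UNIV"
  obtains u :: "nat \<Rightarrow> complex^'n" and c where "\<And>l. l < Suc k \<Longrightarrow> 0 < c l"
    "\<And>h. bilinear h \<Longrightarrow> contract2 (2 * k) (Jskew h) (\<lambda>w. Re (wedge_power \<eta> k w)) (pairs (\<lambda>m. axis (e m) 1)) =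
       (\<Sum>l<Suc k. c l * (h (u l) (u l) + h (J (u l)) (J (u l))))"
    "\<And>\<xi> z. linear \<xi> \<Longrightarrow> \<xi> z \<noteq> (0::real) \<Longrightarrow> \<exists>l<Suc k. \<xi> (u l) \<noteq> 0 \<or> \<xi> (J (u l)) \<noteq> 0"
proof -
  obtain H where H: "\<And>a b. herm H b a = cnj (herm H a b)" "\<And>u. u \<noteq> 0 \<Longrightarrow> 0 < Re (herm H u u)"
    "\<And>v. \<eta> v = of_real (- 2 * Im (herm H (v 0) (v 1)))"
    using positive_11_form_herm[OF pos] by metis
  let ?E = "\<lambda>m. axis (e m) 1 :: complex^'n"
  have "inj_on e {..<Suc k}" using e by (simp add: bij_betw_def)
  from Gram_Schmidt[OF H(1,2) this order_refl]
  obtain u where u: "\<And>m. m < Suc k \<Longrightarrow> u m - ?E m \<in> span (pairs u ` {..<2 * m})"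
    "\<And>m l. m < Suc k \<Longrightarrow> l < m \<Longrightarrow> herm H (u m) (u l) = 0" "\<And>m. m < Suc k \<Longrightarrow> u m $ e m = 1"
    by blast
  have real: "\<eta> v \<in> \<real>" for v by (simp add: H(3))
  have orth: "herm H (u l) (u m) = 0" if "l < Suc k" "m < Suc k" "l \<noteq> m" for l m
    using u(2)[of l m] u(2)[of m l] that H(1)[of "u l" "u m"] by (metis complex_cnj_zero linorder_neqE_nat)
  have orth': "\<eta> (pair (pairs u p) (pairs u q)) = 0"
    if "p < 2 * Suc k" "q < 2 * Suc k" "p div 2 \<noteq> q div 2" for p q
    using orth[of "p div 2" "q div 2"] that
    by (simp add: H(3) pair_def pairs_def J_def herm_scale_left herm_scale_right)
  have pos': "0 < Re (\<eta> (pair (u m) (J (u m))))" if "m < Suc k" for m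
  proof -
    have "u m \<noteq> 0" using u(3)[OF that] by auto
    then show ?thesis using H(2)[of "u m"] by (simp add: H(3) pair_def J_def herm_scale_right)
  qed
  have C1: "0 < Re (wedge_power \<eta> k (pairs (omit l u)))" if "l < Suc k" for l
    by (rule contract2_orthogonal(1)[OF alt real _ _ that]) (use orth' pos' in auto)
  have C2: "contract2 (2 * k) (Jskew h) (\<lambda>w. Re (wedge_power \<eta> k w)) (pairs u) =
       (\<Sum>l<Suc k. 2 * Re (wedge_power \<eta> k (pairs (omit l u))) * (h (u l) (u l) + h (J (u l)) (J (u l))))"
    if "bilinear h" for h
    by (rule contract2_orthogonal(2)[OF alt real _ _ that]) (use orth' pos' in auto)
  let ?c = "\<lambda>l. 2 * Re (wedge_power \<eta> k (pairs (omit l u)))"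
  have re_alt: "alt_form (2 * k) (\<lambda>w. Re (wedge_power \<eta> k w))"
    by (rule alt_form_compose_linear[OF bounded_linear.linear[OF bounded_linear_Re] alt_form_wedge_power[OF alt]])
  show thesis
  proof (rule that[of ?c u])
    show "0 < ?c l" if "l < Suc k" for l
      using C1[OF that] by simp
  next
    fix h :: "complex^'n \<Rightarrow> complex^'n \<Rightarrow> real" assume h: "bilinear h"
    have "alt_form (2 * Suc k) (contract2 (2 * k) (Jskew h) (\<lambda>w. Re (wedge_power \<eta> k w)))"
      using alt_form_contract2[OF bilinear_Jskew[OF h] re_alt] by simp
    from alt_form_pairs_unipotent[OF this u(1)] C2[OF h]
    show "contract2 (2 * k) (Jskew h) (\<lambda>w. Re (wedge_power \<eta> k w)) (pairs ?E) =
       (\<Sum>l<Suc k. ?c l * (h (u l) (u l) + h (J (u l)) (J (u l))))" by simp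
  next
    fix \<xi> :: "complex^'n \<Rightarrow> real" and z assume \<xi>: "linear \<xi>" "\<xi> z \<noteq> 0"
    show "\<exists>l<Suc k. \<xi> (u l) \<noteq> 0 \<or> \<xi> (J (u l)) \<noteq> 0"
    proof (rule ccontr)
      assume "\<not> ?thesis"
      then have z: "\<xi> (pairs u p) = 0" if "p < 2 * Suc k" for p
        using that by (cases p rule: nat_pair_cases) auto
      have zs: "\<xi> w = 0" if "w \<in> span (pairs u ` {..<2 * m})" "m \<le> Suc k" for w m
        using z that(2) by (intro linear_eq_0_on_span[OF \<xi>(1) _ that(1)]) auto
      \<comment> \<open>By triangularity a functional that kills all \<open>u l\<close> and
        \<open>J (u l)\<close> kills the standard basis as well.\<close>
      have "\<xi> (?E m) = 0 \<and> \<xi> (J (?E m)) = 0" if m: "m < Suc k" for m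
      proof -
        let ?w = "u m - ?E m"
        have "\<xi> ?w = 0" "\<xi> (J ?w) = 0" using zs[OF u(1)[OF m]] zs[OF span_J[OF u(1)[OF m]]] m by auto
        then show ?thesis using z[of "2 * m"] z[of "2 * m + 1"] m
          by (simp add: linear_diff[OF linear_J] linear_diff[OF \<xi>(1)])
      qed
      then have E: "\<xi> (axis n 1) = 0" "\<xi> (J (axis n 1)) = 0" for n
        using e unfolding bij_betw_def by (metis UNIV_I imageE lessThan_iff)+
      have "z = (\<Sum>n\<in>UNIV. z $ n *s axis n 1)" by (simp add: vec_eq_iff axis_def if_distrib cong: if_cong)
      also have "\<dots> = (\<Sum>n\<in>UNIV. Re (z $ n) *\<^sub>R axis n 1 + Im (z $ n) *\<^sub>R J (axis n 1))"
        by (simp only: scale_complex_eq)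
      finally have "\<xi> z = (\<Sum>n\<in>UNIV. \<xi> (Re (z $ n) *\<^sub>R axis n 1 + Im (z $ n) *\<^sub>R J (axis n 1)))"
        using linear_sum[OF \<xi>(1)] by metis
      also have "\<dots> = 0" by (intro sum.neutral) (simp add: linear_add[OF \<xi>(1)] linear_scale[OF \<xi>(1)] E)
      finally show False using \<xi>(2) by simp
    qed
  qed
qed

section \<open>Holomorphic maps are smooth\<close>

definition hol_fun_on :: "(complex^'n) set \<Rightarrow> (complex^'n::finite \<Rightarrow> complex) \<Rightarrow> bool" where
  "hol_fun_on S f \<longleftrightarrow> (\<forall>x\<in>S. \<exists>L. (f has_derivative L) (at x) \<and> (\<forall>u. L (J u) = \<i> * L u))"

lemma hol_fun_onD:
  assumes "hol_fun_on S f" "x \<in> S"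
  shows "(f has_derivative (\<lambda>u. dder f u x)) (at x)" "dder f (J u) x = \<i> * dder f u x" "dder f (c *s u) x = c * dder f u x"
proof -
  obtain L where L: "(f has_derivative L) (at x)" "\<And>u. L (J u) = \<i> * L u"
    using assms by (auto simp: hol_fun_on_def)
  have D: "(\<lambda>u. dder f u x) = L" using dder_eq[OF L(1)] by auto
  then show "(f has_derivative (\<lambda>u. dder f u x)) (at x)" using L(1) by simp
  show J: "dder f (J u) x = \<i> * dder f u x" for u using D L(2) by metis
  have lin: "linear (\<lambda>u. dder f u x)" unfolding D using L(1) by (rule has_derivative_linear)
  show "dder f (c *s u) x = c * dder f u x"
    unfolding scale_complex_eq linear_add[OF lin] linear_scale[OF lin] J
    by (simp add: complex_eq_iff)
qed

lemma hol_fun_continuous: "hol_fun_on S f \<Longrightarrow> continuous_on S f"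
  by (meson continuous_at_imp_continuous_on has_derivative_continuous hol_fun_onD(1))

lemma has_field_derivative_along_line:
  assumes "hol_fun_on S f" "x + \<zeta> *s v \<in> S"
  shows "((\<lambda>\<zeta>. f (x + \<zeta> *s v)) has_field_derivative dder f v (x + \<zeta> *s v)) (at \<zeta>)"
proof -
  have "bounded_linear (\<lambda>\<zeta>::complex. Re \<zeta> *\<^sub>R v + Im \<zeta> *\<^sub>R J v)"
    by (intro bounded_linear_add bounded_linear_compose[OF bounded_linear_scaleR_left] bounded_linear_Re bounded_linear_Im)
  then have "bounded_linear (\<lambda>\<zeta>. \<zeta> *s v)" by (simp only: scale_complex_eq[symmetric])
  then have "((\<lambda>\<zeta>. x + \<zeta> *s v) has_derivative (\<lambda>h. h *s v)) (at \<zeta>)"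
    by (auto intro!: derivative_eq_intros bounded_linear_imp_has_derivative)
  from has_derivative_compose[OF this hol_fun_onD(1)[OF assms]]
  show ?thesis
    by (simp add: has_field_derivative_def hol_fun_onD(3)[OF assms] mult_commute_abs)
qed

text \<open>Cauchy's formula for the first derivative, written over the fixed interval from 0 to 1
  so that theorems on integrals with parameters apply to it.\<close>

lemma deriv_eq_circle_integral:
  fixes F :: "complex \<Rightarrow> complex"
  assumes R: "0 < R" and F: "\<And>\<zeta>. norm \<zeta> \<le> R \<Longrightarrow> (F has_field_derivative F' \<zeta>) (at \<zeta>)"
  shows "F' 0 = integral (cbox 0 1) (\<lambda>t::real. F (of_real R * exp (2 * of_real pi * \<i> * of_real t)) / (of_real R * exp (2 * of_real pi * \<i> * of_real t)))"
proof -
  have "continuous_on (cball 0 R) F"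
    using F by (intro continuous_at_imp_continuous_on ballI DERIV_isCont) auto
  moreover have "F holomorphic_on ball 0 R"
    using F by (force simp: holomorphic_on_open)
  ultimately have "(F has_field_derivative 1 / (2 * of_real pi * \<i>) * contour_integral (circlepath 0 R) (\<lambda>u. F u / (u - 0)\<^sup>2)) (at 0)"
    using R by (intro Cauchy_derivative_integral_circlepath(2)) auto
  then have "F' 0 = 1 / (2 * of_real pi * \<i>) * contour_integral (circlepath 0 R) (\<lambda>u. F u / u\<^sup>2)"
    using DERIV_unique[OF F[of 0]] R by simp
  also have "contour_integral (circlepath 0 R) (\<lambda>u. F u / u\<^sup>2) =
      integral (cbox 0 1) (\<lambda>t::real. 2 * of_real pi * \<i> * (F (of_real R * exp (2 * of_real pi * \<i> * of_real t)) / (of_real R * exp (2 * of_real pi * \<i> * of_real t))))"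
    unfolding contour_integral_integral box_real
  proof (rule integral_cong)
    fix t :: real assume t: "t \<in> {0..1}"
    show "F (circlepath 0 R t) / (circlepath 0 R t)\<^sup>2 * vector_derivative (circlepath 0 R) (at t) =
      2 * of_real pi * \<i> * (F (of_real R * exp (2 * of_real pi * \<i> * of_real t)) / (of_real R * exp (2 * of_real pi * \<i> * of_real t)))"
      using R unfolding vector_derivative_circlepath unfolding circlepath by (simp add: power2_eq_square)
  qed
  also have "\<dots> = 2 * of_real pi * \<i> * integral (cbox 0 1) (\<lambda>t::real. F (of_real R * exp (2 * of_real pi * \<i> * of_real t)) / (of_real R * exp (2 * of_real pi * \<i> * of_real t)))"
    by (rule integral_mult_right)
  finally show ?thesis by simp
qed

text \<open>Cauchy's formula on complex lines expresses the derivative by values of the function; differentiating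
  under the integral sign shows that it is holomorphic again.\<close>

lemma hol_fun_dder_local:
  assumes S: "open S" and f: "hol_fun_on S f" and x0: "x0 \<in> S"
  obtains U R where "open U" "convex U" "x0 \<in> U" "U \<subseteq> S" "0 < R"
    "\<And>x t. x \<in> U \<Longrightarrow> x + (of_real R * exp (2 * of_real pi * \<i> * of_real t)) *s v \<in> S"
    "\<And>x. x \<in> U \<Longrightarrow> dder f v x = integral (cbox 0 1) (\<lambda>t::real.
        f (x + (of_real R * exp (2 * of_real pi * \<i> * of_real t)) *s v) / (of_real R * exp (2 * of_real pi * \<i> * of_real t)))"
proof -
  obtain \<epsilon> where \<epsilon>: "0 < \<epsilon>" "ball x0 \<epsilon> \<subseteq> S" using S x0 openE by blast
  \<comment> \<open>Multiplication by a complex number is split as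
    \<open>Re \<zeta> *\<^sub>R v + Im \<zeta> *\<^sub>R J v\<close>, so
    \<open>norm \<zeta> * N\<close> bounds its norm. The radius \<open>R\<close> below then keeps
    the discs in direction \<open>v\<close> around points of the half-size ball inside
    \<open>S\<close>.\<close>
  define N where "N = norm v + norm (J v) + 1"
  have N: "0 < N" by (simp add: N_def add_nonneg_pos)
  define R where "R = \<epsilon> / (2 * N)"
  have R: "0 < R" "R * N = \<epsilon> / 2" using \<epsilon> N by (simp_all add: R_def)
  have nv: "norm (\<zeta> *s v) \<le> norm \<zeta> * N" for \<zeta>
  proof -
    have "norm (\<zeta> *s v) \<le> \<bar>Re \<zeta>\<bar> * norm v + \<bar>Im \<zeta>\<bar> * norm (J v)"
      unfolding scale_complex_eq by (rule order_trans[OF norm_triangle_ineq]) simp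
    also have "\<dots> \<le> norm \<zeta> * norm v + norm \<zeta> * norm (J v)"
      by (intro add_mono mult_right_mono abs_Re_le_cmod abs_Im_le_cmod) auto
    also have "\<dots> \<le> norm \<zeta> * N" by (simp add: N_def algebra_simps)
    finally show ?thesis .
  qed
  have inS: "x + \<zeta> *s v \<in> S" if "x \<in> ball x0 (\<epsilon> / 2)" "norm \<zeta> \<le> R" for x \<zeta>
  proof -
    have "norm (\<zeta> *s v) \<le> \<epsilon> / 2" using nv[of \<zeta>] mult_right_mono[OF that(2), of N] N R(2) by linarith
    then have "dist x0 (x + \<zeta> *s v) < \<epsilon>"
      using that(1) norm_triangle_ineq4[of "x0 - x" "\<zeta> *s v"] by (simp add: dist_norm algebra_simps)
    then show ?thesis using \<epsilon>(2) by auto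
  qed
  show thesis
  proof (rule that[of "ball x0 (\<epsilon> / 2)" R])
    show "x + (of_real R * exp (2 * of_real pi * \<i> * of_real t)) *s v \<in> S" if "x \<in> ball x0 (\<epsilon> / 2)" for x t
      using R by (intro inS that) (simp add: norm_mult)
    show "dder f v x = integral (cbox 0 1) (\<lambda>t::real.
        f (x + (of_real R * exp (2 * of_real pi * \<i> * of_real t)) *s v) / (of_real R * exp (2 * of_real pi * \<i> * of_real t)))"
      if x: "x \<in> ball x0 (\<epsilon> / 2)" for x
      using deriv_eq_circle_integral[OF R(1) has_field_derivative_along_line[OF f inS[OF x]]] by simp
    show "ball x0 (\<epsilon> / 2) \<subseteq> S" using \<epsilon> subset_ball[of "\<epsilon> / 2" \<epsilon> x0] by simp
  qed (use \<epsilon> R in auto)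
qed

lemma continuous_on_circle_translate:
  "continuous_on T (\<lambda>(x, t). x + (of_real R * exp (2 * of_real pi * \<i> * of_real t)) *s v)"
  unfolding scale_complex_eq by (auto simp: split_beta intro!: continuous_intros)

text \<open>Holomorphy is given as differentiability at each point only. The integral formula yields
  continuity of the derivative, which differentiation under the integral sign in
  \<open>hol_fun_dder\<close> relies on.\<close>

lemma hol_fun_dder_continuous:
  assumes S: "open S" and f: "hol_fun_on S f"
  shows "continuous_on S (dder f v)"
proof -
  have "isCont (dder f v) x0" if x0: "x0 \<in> S" for x0
  proof -
    obtain U R where U: "open U" "convex U" "x0 \<in> U" "U \<subseteq> S" "0 < R"
      "\<And>x t. x \<in> U \<Longrightarrow> x + (of_real R * exp (2 * of_real pi * \<i> * of_real t)) *s v \<in> S"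
      "\<And>x. x \<in> U \<Longrightarrow> dder f v x = integral (cbox 0 1) (\<lambda>t::real.
        f (x + (of_real R * exp (2 * of_real pi * \<i> * of_real t)) *s v) / (of_real R * exp (2 * of_real pi * \<i> * of_real t)))"
      using hol_fun_dder_local[OF S f x0] by blast
    have "continuous_on U (\<lambda>x. integral (cbox 0 1) (\<lambda>t::real.
        f (x + (of_real R * exp (2 * of_real pi * \<i> * of_real t)) *s v) / (of_real R * exp (2 * of_real pi * \<i> * of_real t))))"
      using U(5,6)
      by (intro integral_continuous_on_param)
        (auto simp: split_beta intro!: continuous_intros continuous_on_compose2[OF hol_fun_continuous[OF f]]
          continuous_on_circle_translate[unfolded split_beta])
    then have "continuous_on U (dder f v)" by (rule continuous_on_eq) (simp add: U(7))
    then show ?thesis using U(1,3) by (simp only: continuous_on_eq_continuous_at)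
  qed
  then show ?thesis by (simp add: continuous_at_imp_continuous_on)
qed

lemma hol_fun_dder:
  assumes S: "open S" and f: "hol_fun_on S f"
  shows "hol_fun_on S (dder f v)"
  unfolding hol_fun_on_def
proof
  fix x0 assume x0: "x0 \<in> S"
  obtain U R where U: "open U" "convex U" "x0 \<in> U" "U \<subseteq> S" "0 < R"
    "\<And>x t. x \<in> U \<Longrightarrow> x + (of_real R * exp (2 * of_real pi * \<i> * of_real t)) *s v \<in> S"
    "\<And>x. x \<in> U \<Longrightarrow> dder f v x = integral (cbox 0 1) (\<lambda>t::real.
      f (x + (of_real R * exp (2 * of_real pi * \<i> * of_real t)) *s v) / (of_real R * exp (2 * of_real pi * \<i> * of_real t)))"
    using hol_fun_dder_local[OF S f x0] by blast
  define \<gamma> :: "real \<Rightarrow> complex" where "\<gamma> t = of_real R * exp (2 * of_real pi * \<i> * of_real t)" for t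
  have \<gamma>: "\<gamma> t \<noteq> 0" for t using U(5) by (simp add: \<gamma>_def)
  note U6 = U(6)[folded \<gamma>_def] and U7 = U(7)[folded \<gamma>_def]
  have c\<gamma>: "continuous_on T \<gamma>" for T unfolding \<gamma>_def[abs_def] by (intro continuous_intros)
  have ct: "continuous_on T (\<lambda>p. fst p + \<gamma> (snd p) *s v)" for T
    using continuous_on_circle_translate[of T R v] by (simp add: split_beta \<gamma>_def)
  have ct1: "continuous_on T (\<lambda>t. x + \<gamma> t *s v)" for x T
    unfolding scale_complex_eq by (intro continuous_intros c\<gamma>)
  define fx where "fx x t = Blinfun (\<lambda>u. dder f u (x + \<gamma> t *s v) / \<gamma> t)" for x t
  have bl: "bounded_linear (\<lambda>u. dder f u (x + \<gamma> t *s v) / \<gamma> t)" if "x \<in> U" for x t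
    using bounded_linear_compose[OF bounded_linear_divide has_derivative_bounded_linear[OF hol_fun_onD(1)[OF f U6[OF that]]]] .
  have fx: "blinfun_apply (fx x t) u = dder f u (x + \<gamma> t *s v) / \<gamma> t" if "x \<in> U" for x t u
    unfolding fx_def using bounded_linear_Blinfun_apply[OF bl[OF that]] by metis
  have fx_cont: "continuous_on (U \<times> cbox 0 1) (\<lambda>(x, t). fx x t)"
  proof (rule continuous_on_blinfun_componentwise)
    fix i :: "complex^'a"
    have "continuous_on (U \<times> cbox 0 1) (\<lambda>p. dder f i (fst p + \<gamma> (snd p) *s v) / \<gamma> (snd p))"
      using U6 \<gamma> by (intro continuous_intros continuous_on_compose2[OF hol_fun_dder_continuous[OF S f]] ct
        continuous_on_compose2[OF c\<gamma>[of UNIV]]) auto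
    then show "continuous_on (U \<times> cbox 0 1) (\<lambda>p. blinfun_apply (case p of (x, t) \<Rightarrow> fx x t) i)"
      by (rule continuous_on_eq) (auto simp: fx)
  qed
  have "((\<lambda>x. integral (cbox 0 1) (\<lambda>t. f (x + \<gamma> t *s v) / \<gamma> t)) has_derivative integral (cbox 0 1) (fx x0)) (at x0 within U)"
  proof (rule leibniz_rule[OF _ _ fx_cont U(3,2)])
    fix x t assume x: "x \<in> U"
    have "((\<lambda>x. x + \<gamma> t *s v) has_derivative (\<lambda>h. h)) (at x within U)" by (auto intro!: derivative_eq_intros)
    from has_derivative_compose[OF this hol_fun_onD(1)[OF f U6[OF x]]]
    have "((\<lambda>x. f (x + \<gamma> t *s v)) has_derivative (\<lambda>h. dder f h (x + \<gamma> t *s v))) (at x within U)" by simp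
    from bounded_linear.has_derivative[OF bounded_linear_divide[of "\<gamma> t"] this]
    show "((\<lambda>x. f (x + \<gamma> t *s v) / \<gamma> t) has_derivative blinfun_apply (fx x t)) (at x within U)"
      by (rule has_derivative_eq_rhs) (simp add: fun_eq_iff fx[OF x])
  next
    fix x assume "x \<in> U"
    then show "(\<lambda>t. f (x + \<gamma> t *s v) / \<gamma> t) integrable_on cbox 0 1"
      using U6 \<gamma> by (intro integrable_continuous continuous_intros continuous_on_compose2[OF hol_fun_continuous[OF f]] ct1 c\<gamma>) auto
  qed
  then have "((\<lambda>x. integral (cbox 0 1) (\<lambda>t. f (x + \<gamma> t *s v) / \<gamma> t)) has_derivative integral (cbox 0 1) (fx x0)) (at x0)"
    by (simp only: at_within_open[OF U(3,1)])
  then have "(dder f v has_derivative integral (cbox 0 1) (fx x0)) (at x0)"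
    by (rule has_derivative_transform_within_open[OF _ U(1,3)]) (simp add: U7)
  moreover have "blinfun_apply (integral (cbox 0 1) (fx x0)) (J u) = \<i> * blinfun_apply (integral (cbox 0 1) (fx x0)) u" for u
  proof -
    have "continuous_on (cbox 0 1) (fx x0)"
    proof -
      have "continuous_on (cbox 0 1) (\<lambda>t::real. (x0, t))" by (intro continuous_intros)
      from continuous_on_compose2[OF fx_cont this] U(3) show ?thesis by auto
    qed
    then have i: "fx x0 integrable_on cbox 0 1" by (rule integrable_continuous)
    show ?thesis
      unfolding blinfun_apply_integral[OF i] fx[OF U(3)] hol_fun_onD(2)[OF f U6[OF U(3)]]
      by (simp flip: integral_mult_right)
  qed
  ultimately show "\<exists>L. (dder f v has_derivative L) (at x0) \<and> (\<forall>u. L (J u) = \<i> * L u)" by blast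
qed

lemma hol_fun_C_k_on:
  assumes "open S" "hol_fun_on S f" shows "C_k_on k S f"
  using assms(2)
proof (induction k arbitrary: f)
  case 0 then show ?case by (simp add: hol_fun_continuous)
next
  case (Suc k)
  show ?case
  proof (rule C_k_on_SucI[OF assms(1)])
    show "(f has_derivative (\<lambda>u. dder f u x)) (at x)" if "x \<in> S" for x
      using hol_fun_onD(1)[OF Suc.prems that] .
    show "C_k_on k S (dder f u)" for u by (intro Suc.IH hol_fun_dder assms(1) Suc.prems)
  qed
qed

lemma holomorphic_map_component:
  assumes "holomorphic_map_on S g"
  shows "hol_fun_on S (\<lambda>x. g x $ i)"
  unfolding hol_fun_on_def
proof
  fix x assume "x \<in> S"
  then obtain L where L: "(g has_derivative L) (at x)" "\<And>u. L (\<i> *s u) = \<i> *s L u"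
    using assms by (auto simp: holomorphic_map_on_def)
  have "((\<lambda>x. g x $ i) has_derivative (\<lambda>u. L u $ i)) (at x)"
    by (rule bounded_linear.has_derivative[OF bounded_linear_vec_nth L(1)])
  then show "\<exists>L. ((\<lambda>x. g x $ i) has_derivative L) (at x) \<and> (\<forall>u. L (J u) = \<i> * L u)"
    using L(2) by (intro exI[of _ "\<lambda>u. L u $ i"]) (simp add: J_def)
qed

lemma holomorphic_map_C_k_on:
  assumes "open S" "holomorphic_map_on S (g :: complex^'n::finite \<Rightarrow> complex^'n)"
  shows "C_k_on k S g"
proof -
  have bl: "bounded_linear (axis i :: complex \<Rightarrow> complex^'n)" for i
    unfolding linear_conv_bounded_linear[symmetric] by (auto intro!: linearI simp: axis_def vec_eq_iff)
  have "C_k_on k S (\<lambda>x. \<Sum>i\<in>UNIV. axis i (g x $ i))"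
    by (intro C_k_on_sum assms(1) C_k_on_linear[OF bl] hol_fun_C_k_on holomorphic_map_component[OF assms(2)])
  moreover have "(\<Sum>i\<in>UNIV. axis i (y $ i)) = y" for y :: "complex^'n"
    by (simp add: vec_eq_iff axis_def if_distrib cong: if_cong)
  ultimately show ?thesis by simp
qed

lemma holomorphic_map_dder_J:
  assumes "holomorphic_map_on S g" "x \<in> S"
  shows "dder g (J u) x = J (dder g u x)"
proof -
  obtain L where L: "(g has_derivative L) (at x)" "\<And>u. L (\<i> *s u) = \<i> *s L u"
    using assms by (auto simp: holomorphic_map_on_def)
  show ?thesis unfolding dder_eq[OF L(1)] by (simp add: L(2) J_def)
qed

text \<open>As \<open>J\<close> can be pulled out of either direction, the term with the second
  derivative of a transition map cancels in \<open>Jskew\<close>.\<close>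

lemma holomorphic_map_dder2_J:
  assumes S: "open S" "x \<in> S" and g: "holomorphic_map_on S (g :: complex^'n::finite \<Rightarrow> complex^'n)"
  shows "dder (dder g v) (J u) x = J (dder (dder g v) u x)" "dder (dder g (J v)) u x = J (dder (dder g v) u x)"
proof -
  have d: "(dder g v has_derivative (\<lambda>u. dder (dder g v) u y)) (at y)" if "y \<in> S" for v y
    using C_k_on_imp_has_derivative[OF C_k_on_dder[OF holomorphic_map_C_k_on[OF S(1) g, of "Suc (Suc 0)"]] S(1) that] .
  have dg: "(g has_derivative (\<lambda>u. dder g u y)) (at y)" if "y \<in> S" for y
    using C_k_on_imp_has_derivative[OF holomorphic_map_C_k_on[OF S(1) g, of "Suc 0"] S(1) that] .
  have c1: "dder (\<lambda>x. g x $ i) v y = dder g v y $ i" if "y \<in> S" for i v y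
    by (rule dder_eq[OF bounded_linear.has_derivative[OF bounded_linear_vec_nth dg[OF that]]])
  have c2: "dder (dder (\<lambda>x. g x $ i) v) u x = dder (dder g v) u x $ i" for i u
  proof -
    have "dder (dder (\<lambda>x. g x $ i) v) u x = dder (\<lambda>y. dder g v y $ i) u x"
      by (rule dder_cong[OF S]) (rule c1)
    then show ?thesis
      using dder_eq[OF bounded_linear.has_derivative[OF bounded_linear_vec_nth d[OF S(2)]]] by simp
  qed
  show "dder (dder g v) (J u) x = J (dder (dder g v) u x)"
    using hol_fun_onD(2)[OF hol_fun_dder[where v=v, OF S(1) holomorphic_map_component[OF g]] S(2), where u=u]
    by (simp add: vec_eq_iff c2 J_def)
  have "dder (dder g (J v)) u x = dder (\<lambda>y. J (dder g v y)) u x"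
    by (rule dder_cong[OF S]) (rule holomorphic_map_dder_J[OF g])
  then show "dder (dder g (J v)) u x = J (dder (dder g v) u x)"
    using dder_eq[OF bounded_linear.has_derivative[OF bounded_linear_J d[OF S(2)]]] by simp
qed

section \<open>Change of variables\<close>

text \<open>Determinants and the change-of-variables theorem are stated on \<open>real^'N\<close>;
  this map and \<open>to_coords\<close> carry them to a Euclidean space whose basis is enumerated by
  \<beta>.\<close>

definition from_coords :: "('N \<Rightarrow> 'a::euclidean_space) \<Rightarrow> real^'N \<Rightarrow> 'a" where
  "from_coords \<beta> y = (\<Sum>n\<in>UNIV. (y $ n) *\<^sub>R \<beta> n)"

definition to_coords :: "('N \<Rightarrow> 'a::euclidean_space) \<Rightarrow> 'a \<Rightarrow> real^'N" where
  "to_coords \<beta> x = (\<chi> n. x \<bullet> \<beta> n)"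

lemma linear_from_coords: "linear (from_coords \<beta>)"
  by (auto intro!: linearI simp: from_coords_def scaleR_left_distrib sum.distrib scaleR_sum_right)

lemma linear_to_coords: "linear (to_coords \<beta>)"
  by (auto intro!: linearI simp: to_coords_def vec_eq_iff inner_add_left)

lemma from_coords_axis: "from_coords \<beta> (axis n 1) = \<beta> n"
proof -
  have "from_coords \<beta> (axis n 1) = (\<Sum>m\<in>UNIV. if m = n then \<beta> n else 0)"
    unfolding from_coords_def by (intro sum.cong) (auto simp: axis_def)
  then show ?thesis by simp
qed

lemma from_coords_inner:
  assumes "bij_betw \<beta> UNIV Basis" shows "from_coords \<beta> y \<bullet> \<beta> n = y $ n"
proof -
  have B: "\<beta> m \<in> Basis" "\<beta> m = \<beta> n \<longleftrightarrow> m = n" for m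
    using assms by (auto simp: bij_betw_def inj_eq)
  have "from_coords \<beta> y \<bullet> \<beta> n = (\<Sum>m\<in>UNIV. if m = n then y $ n else 0)"
    unfolding from_coords_def inner_sum_left by (intro sum.cong) (auto simp: inner_Basis B)
  then show ?thesis by simp
qed

lemma to_coords_from_coords: "bij_betw \<beta> UNIV Basis \<Longrightarrow> to_coords \<beta> (from_coords \<beta> y) = y"
  by (simp add: to_coords_def from_coords_inner vec_eq_iff)

lemma from_coords_to_coords:
  assumes "bij_betw \<beta> UNIV Basis" shows "from_coords \<beta> (to_coords \<beta> x) = x"
proof -
  have "(\<Sum>n\<in>UNIV. (x \<bullet> \<beta> n) *\<^sub>R \<beta> n) = (\<Sum>b\<in>Basis. (x \<bullet> b) *\<^sub>R b)"
    by (rule sum.reindex_bij_betw[OF assms])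
  then show ?thesis by (simp add: from_coords_def to_coords_def euclidean_representation)
qed

text \<open>The preimage of a box is a box with the same edge lengths, and volumes of boxes
  determine Lebesgue measure.\<close>

lemma lborel_from_coords:
  fixes \<beta> :: "'N::finite \<Rightarrow> 'a::euclidean_space"
  assumes \<beta>: "bij_betw \<beta> UNIV Basis"
  shows "distr lborel borel (from_coords \<beta>) = lborel"
proof (rule lborel_eqI[symmetric])
  fix l u :: 'a assume lu: "\<And>b. b \<in> Basis \<Longrightarrow> l \<bullet> b \<le> u \<bullet> b"
  have B: "\<beta> n \<in> Basis" for n using \<beta> by (auto simp: bij_betw_def)
  have range: "Basis = range \<beta>" using \<beta> by (auto simp: bij_betw_def)
  have m: "from_coords \<beta> \<in> borel_measurable lborel"
    using borel_measurable_continuous_onI[OF linear_continuous_on[of "from_coords \<beta>" UNIV]] linear_from_coords[of \<beta>]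
    by (simp add: linear_conv_bounded_linear)
  have "from_coords \<beta> -` box l u = box (to_coords \<beta> l) (to_coords \<beta> u)"
    unfolding box_def range using from_coords_inner[OF \<beta>]
    by (auto simp: Basis_vec_def inner_axis to_coords_def)
  then have "emeasure (distr lborel borel (from_coords \<beta>)) (box l u) = emeasure lborel (box (to_coords \<beta> l) (to_coords \<beta> u))"
    using m by (simp add: emeasure_distr)
  also have "\<dots> = (\<Prod>b\<in>Basis. (to_coords \<beta> u - to_coords \<beta> l) \<bullet> b)"
    using lu[OF B] by (subst emeasure_lborel_box) (auto simp: Basis_vec_def inner_axis to_coords_def)
  also have "(\<Prod>b\<in>Basis. (to_coords \<beta> u - to_coords \<beta> l) \<bullet> b) = (\<Prod>n\<in>UNIV. (to_coords \<beta> u - to_coords \<beta> l) $ n)"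
  proof -
    have "bij_betw (\<lambda>n. axis n 1) UNIV (Basis :: (real^'N) set)"
      by (auto simp: bij_betw_def inj_def axis_eq_axis Basis_vec_def)
    from prod.reindex_bij_betw[OF this, of "\<lambda>b. (to_coords \<beta> u - to_coords \<beta> l) \<bullet> b"]
    show ?thesis by (simp add: inner_axis)
  qed
  also have "\<dots> = (\<Prod>n\<in>UNIV. (u - l) \<bullet> \<beta> n)" by (simp add: to_coords_def inner_diff_left)
  also have "\<dots> = (\<Prod>b\<in>Basis. (u - l) \<bullet> b)" by (rule prod.reindex_bij_betw[OF \<beta>])
  finally show "emeasure (distr lborel borel (from_coords \<beta>)) (box l u) = ennreal (\<Prod>b\<in>Basis. (u - l) \<bullet> b)" .
qed simp

lemma integral_from_coords:
  fixes \<beta> :: "'N::finite \<Rightarrow> 'a::euclidean_space" and F :: "'a \<Rightarrow> real"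
  assumes \<beta>: "bij_betw \<beta> UNIV Basis" and F: "continuous_on S F" "compact K" "K \<subseteq> S" "\<And>x. x \<in> S - K \<Longrightarrow> F x = 0"
  shows "integral S F = integral (from_coords \<beta> -` S) (\<lambda>y. F (from_coords \<beta> y))"
    "(\<lambda>y. F (from_coords \<beta> y)) absolutely_integrable_on (from_coords \<beta> -` S)"
proof -
  let ?\<phi> = "from_coords \<beta>" and ?G = "\<lambda>x. indicator K x *\<^sub>R F x"
  have m: "?\<phi> \<in> measurable lborel borel"
    using borel_measurable_continuous_onI[OF linear_continuous_on[of ?\<phi> UNIV]] linear_from_coords[of \<beta>]
    by (simp add: linear_conv_bounded_linear)
  have G: "integrable lborel ?G"
    using continuous_on_subset[OF F(1,3)] by (rule borel_integrable_compact[OF F(2)])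
  then have Gm: "?G \<in> borel_measurable borel" by simp
  have G\<phi>: "integrable lborel (\<lambda>y. ?G (?\<phi> y))"
    using G lborel_from_coords[OF \<beta>] integrable_distr_eq[OF m Gm] by simp
  have eq: "integral\<^sup>L lborel ?G = integral\<^sup>L lborel (\<lambda>y. ?G (?\<phi> y))"
    using integral_distr[OF m Gm] lborel_from_coords[OF \<beta>] by simp
  have 1: "?G = (\<lambda>x. if x \<in> S then F x else 0)" using F(3,4) by (auto simp: fun_eq_iff indicator_def)
  have 2: "(\<lambda>y. ?G (?\<phi> y)) = (\<lambda>y. if y \<in> ?\<phi> -` S then F (?\<phi> y) else 0)"
    using F(3,4) by (auto simp: fun_eq_iff indicator_def)
  have "integral S F = integral UNIV ?G" unfolding 1 by (rule integral_restrict_UNIV[symmetric])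
  also have "\<dots> = integral\<^sup>L lborel ?G" using G by (rule integral_lborel)
  also have "\<dots> = integral UNIV (\<lambda>y. ?G (?\<phi> y))" unfolding eq using G\<phi> by (rule integral_lborel[symmetric])
  also have "\<dots> = integral (?\<phi> -` S) (\<lambda>y. F (?\<phi> y))" unfolding 2 by (rule integral_restrict_UNIV)
  finally show "integral S F = integral (?\<phi> -` S) (\<lambda>y. F (?\<phi> y))" .
  have "(\<lambda>y. ?G (?\<phi> y)) = (\<lambda>y. indicator (?\<phi> -` S) y *\<^sub>R F (?\<phi> y))"
    unfolding 2 by (auto simp: fun_eq_iff)
  with G\<phi> show "(\<lambda>y. F (?\<phi> y)) absolutely_integrable_on (?\<phi> -` S)"
    unfolding set_integrable_def by (simp add: integrable_completion borel_measurable_integrable)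
qed

lemma change_of_variables_compact_support:
  fixes \<beta> :: "'N::{finite,wellorder} \<Rightarrow> 'a::euclidean_space" and F G :: "'a \<Rightarrow> real"
  assumes \<beta>: "bij_betw \<beta> UNIV Basis"
    and S: "open S" and \<tau>: "\<And>x. x \<in> S \<Longrightarrow> (\<tau> has_derivative \<tau>' x) (at x)" "inj_on \<tau> S" "\<tau> ` S = T"
    and F: "continuous_on T F" "compact K" "K \<subseteq> T" "\<And>x. x \<in> T - K \<Longrightarrow> F x = 0"
    and G: "continuous_on S G" "compact K'" "K' \<subseteq> S" "\<And>x. x \<in> S - K' \<Longrightarrow> G x = 0"
    and eq: "\<And>x. x \<in> S \<Longrightarrow> G x = \<bar>det (matrix (\<lambda>y. to_coords \<beta> (\<tau>' x (from_coords \<beta> y))))\<bar> * F (\<tau> x)"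
  shows "integral S G = integral T F"
proof -
  let ?\<phi> = "from_coords \<beta>" and ?\<psi> = "to_coords \<beta>"
  let ?S = "?\<phi> -` S"
  let ?\<tau> = "\<lambda>y. ?\<psi> (\<tau> (?\<phi> y))" and ?\<tau>' = "\<lambda>y h. ?\<psi> (\<tau>' (?\<phi> y) (?\<phi> h))"
  note [simp] = to_coords_from_coords[OF \<beta>] from_coords_to_coords[OF \<beta>]
  have bl: "bounded_linear ?\<phi>" "bounded_linear ?\<psi>"
    using linear_from_coords linear_to_coords by (simp_all add: linear_conv_bounded_linear)
  have "open ?S" using S by (intro continuous_open_vimage) (auto intro: linear_continuous_at bl)
  then have meas: "?S \<in> sets lebesgue" by (simp add: borel_open)
  have d: "(?\<tau> has_derivative ?\<tau>' y) (at y within ?S)" if "y \<in> ?S" for y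
  proof -
    have "(?\<phi> has_derivative ?\<phi>) (at y within ?S)" by (rule bounded_linear_imp_has_derivative[OF bl(1)])
    then have "((\<lambda>y. \<tau> (?\<phi> y)) has_derivative (\<lambda>h. \<tau>' (?\<phi> y) (?\<phi> h))) (at y within ?S)"
      by (rule has_derivative_compose) (use that \<tau>(1) in auto)
    then show ?thesis by (rule bounded_linear.has_derivative[OF bl(2)])
  qed
  have inj: "inj_on ?\<tau> ?S"
  proof (rule inj_onI)
    fix y z assume y: "y \<in> ?S" "z \<in> ?S" "?\<tau> y = ?\<tau> z"
    then have "\<tau> (?\<phi> y) = \<tau> (?\<phi> z)" by (metis from_coords_to_coords[OF \<beta>])
    then have "?\<phi> y = ?\<phi> z" using \<tau>(2) y by (auto dest: inj_onD)
    then show "y = z" by (metis to_coords_from_coords[OF \<beta>])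
  qed
  have image: "?\<tau> ` ?S = ?\<phi> -` T"
  proof (intro set_eqI iffI)
    fix z assume "z \<in> ?\<tau> ` ?S"
    then obtain y where y: "?\<phi> y \<in> S" "z = ?\<tau> y" by auto
    then have "?\<phi> z = \<tau> (?\<phi> y)" by simp
    then show "z \<in> ?\<phi> -` T" using y(1) \<tau>(3) by auto
  next
    fix y assume "y \<in> ?\<phi> -` T"
    then obtain x where x: "x \<in> S" "?\<phi> y = \<tau> x" using \<tau>(3) by auto
    then have "y = ?\<tau> (?\<psi> x)" "?\<psi> x \<in> ?S" using to_coords_from_coords[OF \<beta>, of y] by auto
    then show "y \<in> ?\<tau> ` ?S" by blast
  qed
  \<comment> \<open>The theorem takes vector-valued integrands, so real functions are passed through
    \<open>real^1\<close>.\<close>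
  let ?F = "\<lambda>y. vec (F (?\<phi> y)) :: real^1"
  have "?F absolutely_integrable_on ?\<tau> ` ?S \<and> integral (?\<tau> ` ?S) ?F = vec (integral T F)"
    unfolding image absolutely_integrable_on_1_iff integral_on_1_eq
    using integral_from_coords[OF \<beta> F] by (simp add: vec_eq_iff)
  then have "integral ?S (\<lambda>y. \<bar>det (matrix (?\<tau>' y))\<bar> *\<^sub>R ?F (?\<tau> y)) = vec (integral T F)"
    using has_absolute_integral_change_of_variables[OF meas d inj, of ?F "vec (integral T F)"] by blast
  then have "integral ?S (\<lambda>y. \<bar>det (matrix (?\<tau>' y))\<bar> * F (\<tau> (?\<phi> y))) = integral T F"
    unfolding integral_on_1_eq by (simp add: vec_eq_iff)
  moreover have "integral S G = integral ?S (\<lambda>y. G (?\<phi> y))"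
    by (rule integral_from_coords(1)[OF \<beta> G])
  moreover have "integral ?S (\<lambda>y. G (?\<phi> y)) = integral ?S (\<lambda>y. \<bar>det (matrix (?\<tau>' y))\<bar> * F (\<tau> (?\<phi> y)))"
    by (intro integral_cong) (simp add: eq)
  ultimately show ?thesis by simp
qed

section \<open>\<open>\<partial>\<partial>bar\<close> in coordinates\<close>

text \<open>The direction \<open>dder \<tau> v y\<close> of the inner derivative moves with the
  point. It is expanded in the basis before the second differentiation and reassembled afterwards;
  its motion gives the last summand.\<close>

lemma dder2_compose:
  fixes \<tau> :: "'c::euclidean_space \<Rightarrow> 'a::euclidean_space" and g :: "'a \<Rightarrow> 'b::real_normed_vector"
  assumes \<tau>: "C_k_on (Suc (Suc 0)) S \<tau>" and g: "C_k_on (Suc (Suc 0)) T g" and S: "open S" "open T" "\<tau> ` S \<subseteq> T" "x \<in> S"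
  shows "dder (dder (\<lambda>y. g (\<tau> y)) v) u x =
    dder (dder g (dder \<tau> v x)) (dder \<tau> u x) (\<tau> x) + dder g (dder (dder \<tau> v) u x) (\<tau> x)"
proof -
  have T: "y \<in> S \<Longrightarrow> \<tau> y \<in> T" for y using S(3) by auto
  note dg = C_k_on_imp_has_derivative[OF g S(2) T]
  have "dder (dder (\<lambda>y. g (\<tau> y)) v) u x = dder (\<lambda>y. \<Sum>b\<in>Basis. (dder \<tau> v y \<bullet> b) *\<^sub>R dder g b (\<tau> y)) u x"
  proof (rule dder_cong[OF S(1,4)])
    fix y assume y: "y \<in> S"
    show "dder (\<lambda>y. g (\<tau> y)) v y = (\<Sum>b\<in>Basis. (dder \<tau> v y \<bullet> b) *\<^sub>R dder g b (\<tau> y))"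
      unfolding dder_eq[OF dder_compose[OF \<tau> g S(1,2) y T[OF y]]] by (rule has_derivative_euclidean_sum[OF dg[OF y]])
  qed
  also have "\<dots> = (\<Sum>b\<in>Basis. (dder \<tau> v x \<bullet> b) *\<^sub>R dder (dder g b) (dder \<tau> u x) (\<tau> x) + (dder (dder \<tau> v) u x \<bullet> b) *\<^sub>R dder g b (\<tau> x))"
    by (intro dder_eq has_derivative_sum has_derivative_scaleR has_derivative_inner_left
      C_k_on_imp_has_derivative[OF C_k_on_dder[OF \<tau>] S(1,4)] dder_compose[OF \<tau> C_k_on_dder[OF g] S(1,2,4) T[OF S(4)]])
  also have "\<dots> = (\<Sum>b\<in>Basis. (dder \<tau> v x \<bullet> b) *\<^sub>R dder (dder g b) (dder \<tau> u x) (\<tau> x)) + dder g (dder (dder \<tau> v) u x) (\<tau> x)"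
    by (simp add: sum.distrib has_derivative_euclidean_sum[OF dg[OF S(4)], symmetric])
  also have "(\<Sum>b\<in>Basis. (dder \<tau> v x \<bullet> b) *\<^sub>R dder (dder g b) (dder \<tau> u x) (\<tau> x)) = dder (dder g (dder \<tau> v x)) (dder \<tau> u x) (\<tau> x)"
  proof -
    have lin: "linear (\<lambda>v. dder (dder g v) (dder \<tau> u x) (\<tau> x))"
      using bilinear_dder2[OF g S(2) T[OF S(4)]] by (simp add: bilinear_def)
    have "dder (dder g (dder \<tau> v x)) (dder \<tau> u x) (\<tau> x) = dder (dder g (\<Sum>b\<in>Basis. (dder \<tau> v x \<bullet> b) *\<^sub>R b)) (dder \<tau> u x) (\<tau> x)"
      by (simp add: euclidean_representation)
    also have "\<dots> = (\<Sum>b\<in>Basis. (dder \<tau> v x \<bullet> b) *\<^sub>R dder (dder g b) (dder \<tau> u x) (\<tau> x))"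
      by (simp add: linear_sum[OF lin] linear_scale[OF lin])
    finally show ?thesis by simp
  qed
  finally show ?thesis .
qed

lemma dder_of_real:
  assumes "C_k_on (Suc k) S g" "open S" "x \<in> S"
  shows "((\<lambda>y. complex_of_real (g y)) has_derivative (\<lambda>u. complex_of_real (dder g u x))) (at x)"
    "dder (\<lambda>y. complex_of_real (g y)) u x = complex_of_real (dder g u x)"
proof -
  show "((\<lambda>y. complex_of_real (g y)) has_derivative (\<lambda>u. complex_of_real (dder g u x))) (at x)"
    by (rule bounded_linear.has_derivative[OF bounded_linear_of_real C_k_on_imp_has_derivative[OF assms]])
  then show "dder (\<lambda>y. complex_of_real (g y)) u x = complex_of_real (dder g u x)" by (rule dder_eq)
qed

lemma dder_cmult:
  fixes g :: "'a::euclidean_space \<Rightarrow> real"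
  assumes "C_k_on (Suc k) S g" "open S" "x \<in> S"
  shows "dder (\<lambda>y. c * g y) u x = c * dder g u x"
  by (rule dder_eq) (intro has_derivative_mult_right C_k_on_imp_has_derivative[OF assms])

lemma dder2_cmult:
  fixes g :: "'a::euclidean_space \<Rightarrow> real"
  assumes g: "C_k_on (Suc (Suc 0)) S g" and S: "open S" "x \<in> S"
  shows "dder (dder (\<lambda>y. c * g y) v) u x = c * dder (dder g v) u x"
proof -
  have "dder (dder (\<lambda>y. c * g y) v) u x = dder (\<lambda>y. c * dder g v y) u x"
    by (rule dder_cong[OF S]) (rule dder_cmult[OF g S(1)])
  then show ?thesis using dder_cmult[OF C_k_on_dder[OF g] S] by simp
qed

text \<open>The operator \<open>g \<mapsto> \<i>\<partial>\<partial>bar (g \<beta>)\<close>, evaluated on \<open>v\<close>, in double-divergence form;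
  \<open>\<beta>\<close> is a real \<open>m\<close>-form.\<close>

type_synonym op_index = "nat \<times> nat \<times> bool"

definition op_indices :: "nat \<Rightarrow> op_index set" where
  "op_indices m = {..Suc m} \<times> {..m} \<times> UNIV"

text \<open>The Boolean selects one of the two terms of \<open>Jskew\<close>: \<open>J\<close> on
  \<open>v i\<close> with sign plus, or on \<open>omit i v j\<close> with sign minus.\<close>

definition op_s :: "(nat \<Rightarrow> complex^'n) \<Rightarrow> op_index \<Rightarrow> complex^'n" where
  "op_s v = (\<lambda>(i, j, \<epsilon>). if \<epsilon> then J (v i) else v i)"

definition op_t :: "(nat \<Rightarrow> complex^'n) \<Rightarrow> op_index \<Rightarrow> complex^'n" where
  "op_t v = (\<lambda>(i, j, \<epsilon>). if \<epsilon> then omit i v j else J (omit i v j))"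

definition op_b :: "(nat \<Rightarrow> complex^'n) \<Rightarrow> (complex^'n \<Rightarrow> (nat \<Rightarrow> complex^'n) \<Rightarrow> real) \<Rightarrow> op_index \<Rightarrow> complex^'n \<Rightarrow> real" where
  "op_b v \<beta> = (\<lambda>(i, j, \<epsilon>) x. (-1) ^ i * (-1) ^ j * (if \<epsilon> then 1 else - 1) * \<beta> x (omit j (omit i v)))"

lemma finite_op_indices: "finite (op_indices m)"
  by (simp add: op_indices_def)

lemma sum_op_indices:
  "(\<Sum>q\<in>op_indices m. F q) = (\<Sum>i\<le>Suc m. \<Sum>j\<le>m. F (i, j, True) + F (i, j, False))"
  unfolding op_indices_def sum.cartesian_product' by (simp add: UNIV_bool add.commute)

text \<open>Through this identity the diagonal form found in an orthogonal basis becomes the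
  ellipticity of the operator.\<close>

lemma sum_op_b:
  "(\<Sum>q\<in>op_indices m. op_b v \<beta> q x * h (op_s v q) (op_t v q)) = contract2 m (Jskew h) (\<beta> x) v"
  unfolding sum_op_indices contract2_def Jskew_def
  by (intro sum.cong refl) (simp add: op_b_def op_s_def op_t_def sum_distrib_left algebra_simps)

text \<open>Write \<open>D\<^sub>u\<close> for the derivative in direction \<open>u\<close>.
  Applying \<open>D\<^sub>u - \<i> D\<^sub>J\<^sub>u\<close> after
  \<open>D\<^sub>w + \<i> D\<^sub>J\<^sub>w\<close> to a real function leaves the imaginary part
  \<open>D\<^sub>u D\<^sub>J\<^sub>w - D\<^sub>J\<^sub>u D\<^sub>w\<close>. The two halves in the
  linear and antilinear parts give the factor 1/4.\<close>

lemma Im_del_delbar: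
  fixes v :: "nat \<Rightarrow> complex^'n::finite"
  assumes S: "open S" "x \<in> S" and g: "\<And>w. C_k_on (Suc (Suc 0)) S (\<lambda>y. g y w)"
    and \<alpha>: "\<And>y w. y \<in> S \<Longrightarrow> \<alpha> y w = of_real (g y w)"
  shows "Im (del (Suc m) (delbar m \<alpha>) x v) = - (1 / 4) * (\<Sum>i\<le>Suc m. (-1) ^ i * (\<Sum>j\<le>m. (-1) ^ j *
     (dder (dder (\<lambda>y. g y (omit j (omit i v))) (omit i v j)) (J (v i)) x -
      dder (dder (\<lambda>y. g y (omit j (omit i v))) (J (omit i v j))) (v i) x)))"
proof -
  have al: "antilinear_part (coeff_differential \<alpha> y w) u = (of_real (dder (\<lambda>y. g y w) u y) + \<i> * of_real (dder (\<lambda>y. g y w) (J u) y)) / 2"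
    if "y \<in> S" for y w u
  proof -
    have "coeff_differential \<alpha> y w u = of_real (dder (\<lambda>y. g y w) u y)" for u
    proof -
      have "coeff_differential \<alpha> y w u = dder (\<lambda>y. \<alpha> y w) u y" by (simp add: coeff_differential_def dder_def)
      also have "\<dots> = dder (\<lambda>y. of_real (g y w)) u y" by (rule dder_cong[OF S(1) that]) (rule \<alpha>)
      finally show ?thesis using dder_of_real(2)[OF g S(1) that] by simp
    qed
    then show ?thesis by (simp add: antilinear_part_def J_def)
  qed
  define D where "D w u = (\<Sum>j\<le>m. (-1) ^ j * ((of_real (dder (dder (\<lambda>y. g y (omit j w)) (w j)) u x) +
       \<i> * of_real (dder (dder (\<lambda>y. g y (omit j w)) (J (w j))) u x)) / 2))" for w u
  have D: "coeff_differential (delbar m \<alpha>) x w u = D w u" for w u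
  proof -
    have "coeff_differential (delbar m \<alpha>) x w u = dder (\<lambda>y. delbar m \<alpha> y w) u x"
      by (simp add: coeff_differential_def dder_def)
    also have "\<dots> = dder (\<lambda>y. \<Sum>j\<le>m. (-1) ^ j * ((of_real (dder (\<lambda>y. g y (omit j w)) (w j) y) +
       \<i> * of_real (dder (\<lambda>y. g y (omit j w)) (J (w j)) y)) / 2)) u x"
      by (rule dder_cong[OF S]) (simp add: delbar_def al)
    also have "\<dots> = D w u"
      unfolding D_def
      by (intro dder_eq has_derivative_sum has_derivative_mult_right bounded_linear.has_derivative[OF bounded_linear_divide] has_derivative_add
          dder_of_real(1)[OF C_k_on_dder[OF g] S])
    finally show ?thesis .
  qed
  have e1: "del (Suc m) (delbar m \<alpha>) x v = (\<Sum>i\<le>Suc m. (-1) ^ i * ((D (omit i v) (v i) - \<i> * D (omit i v) (J (v i))) / 2))"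
    unfolding del_def linear_part_def D J_def ..
  have e2: "Im ((D w u - \<i> * D w (J u)) / 2) = - (1 / 4) * (\<Sum>j\<le>m. (-1) ^ j *
     (dder (dder (\<lambda>y. g y (omit j w)) (w j)) (J u) x - dder (dder (\<lambda>y. g y (omit j w)) (J (w j))) u x))" for w u
  proof -
    have pw: "(-1) ^ j = complex_of_real ((-1) ^ j)" for j by simp
    show ?thesis
      unfolding D_def pw sum_distrib_left sum_subtractf[symmetric] sum_divide_distrib Im_sum
      by (intro sum.cong refl) (simp add: field_simps)
  qed
  have e3: "Im ((-1) ^ i * z) = (-1) ^ i * Im z" for i z
    by (cases "even i") simp_all
  show ?thesis
    unfolding e1 Im_sum e3 e2 sum_distrib_left by (intro sum.cong refl) (simp only: mult_ac)
qed

section \<open>Compact complex manifolds\<close>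

locale compact_complex_manifold =
  fixes A :: "('m::t2_space, 'n::finite) chart set"
  assumes atlas: "complex_atlas A" and compact_M: "compact (UNIV :: 'm set)" and connected_M: "connected (UNIV :: 'm set)"
begin

lemma chart_cover: obtains c where "c \<in> A" "x \<in> fst c"
  using atlas unfolding complex_atlas_def by (metis UNIV_I UN_E)

lemma chart:
  assumes "c \<in> A"
  shows "open (fst c)" "open (chart_image c)" "homeomorphism (fst c) (chart_image c) (snd c) (chart_inv c)"
  using assms atlas unfolding complex_atlas_def by blast+

lemma chart_facts:
  assumes "c \<in> A"
  shows "x \<in> fst c \<Longrightarrow> chart_inv c (snd c x) = x" "x \<in> fst c \<Longrightarrow> snd c x \<in> chart_image c"
    "y \<in> chart_image c \<Longrightarrow> snd c (chart_inv c y) = y" "y \<in> chart_image c \<Longrightarrow> chart_inv c y \<in> fst c"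
    "continuous_on (fst c) (snd c)" "continuous_on (chart_image c) (chart_inv c)"
  using chart(3)[OF assms] unfolding homeomorphism_def by auto

lemma overlap_iff:
  assumes "c \<in> A" shows "y \<in> overlap c d \<longleftrightarrow> y \<in> chart_image c \<and> chart_inv c y \<in> fst d"
proof
  assume "y \<in> overlap c d"
  then obtain x where "x \<in> fst c" "x \<in> fst d" "y = snd c x" by (auto simp: overlap_def)
  then show "y \<in> chart_image c \<and> chart_inv c y \<in> fst d" using chart_facts[OF assms] by auto
next
  assume "y \<in> chart_image c \<and> chart_inv c y \<in> fst d"
  then show "y \<in> overlap c d" unfolding overlap_def using chart_facts[OF assms] by (metis IntI image_eqI)
qed

lemma open_vimage_chart_inv:
  assumes "c \<in> A" "open O'" shows "open (chart_image c \<inter> chart_inv c -` O')"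
  using continuous_openin_preimage_gen[OF chart_facts(6)[OF assms(1)] assms(2)] chart(2)[OF assms(1)]
  by (auto simp: openin_open_eq vimage_def Int_def)

lemma open_image_chart_inv:
  assumes "c \<in> A" "open O'" "O' \<subseteq> chart_image c" shows "open (chart_inv c ` O')"
proof -
  have "chart_inv c ` O' = fst c \<inter> snd c -` O'"
    using chart_facts[OF assms(1)] assms(3) by (auto simp: image_iff) metis
  then show ?thesis
    using continuous_openin_preimage_gen[OF chart_facts(5)[OF assms(1)] assms(2)] chart(1)[OF assms(1)]
    by (auto simp: openin_open_eq vimage_def Int_def)
qed

lemma overlap_eq: "c \<in> A \<Longrightarrow> overlap c d = chart_image c \<inter> chart_inv c -` fst d"
  by (intro set_eqI) (simp add: overlap_iff)

lemma open_overlap: "c \<in> A \<Longrightarrow> d \<in> A \<Longrightarrow> open (overlap c d)"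
  unfolding overlap_eq by (intro open_vimage_chart_inv chart)

lemma transition:
  assumes "c \<in> A" "d \<in> A" "y \<in> overlap c d"
  shows "transition c d y \<in> overlap d c" "chart_inv d (transition c d y) = chart_inv c y"
    "transition d c (transition c d y) = y"
  using assms(3) chart_facts[OF assms(1)] chart_facts[OF assms(2)] 
  by (auto simp: overlap_iff[OF assms(1)] overlap_iff[OF assms(2)] transition_def)

lemma transition_image:
  assumes "c \<in> A" "d \<in> A" shows "transition c d ` overlap c d = overlap d c"
proof (intro equalityI subsetI)
  show "y \<in> overlap d c" if "y \<in> transition c d ` overlap c d" for y using transition(1)[OF assms] that by blast
  show "y \<in> transition c d ` overlap c d" if "y \<in> overlap d c" for y
    using transition[OF assms(2,1) that] by (intro image_eqI[of _ _ "transition d c y"]) simp_all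
qed

lemma transition_inj: "c \<in> A \<Longrightarrow> d \<in> A \<Longrightarrow> inj_on (transition c d) (overlap c d)"
  by (rule inj_on_inverseI[where g="transition d c"]) (rule transition(3))

lemma transition_holomorphic: "c \<in> A \<Longrightarrow> d \<in> A \<Longrightarrow> holomorphic_map_on (overlap c d) (transition c d)"
  using atlas unfolding complex_atlas_def by blast

lemma transition_C_k: "c \<in> A \<Longrightarrow> d \<in> A \<Longrightarrow> C_k_on k (overlap c d) (transition c d)"
  by (intro holomorphic_map_C_k_on open_overlap transition_holomorphic)

definition C2M :: "('m \<Rightarrow> real) \<Rightarrow> bool" where
  "C2M u \<longleftrightarrow> (\<forall>c\<in>A. C_k_on (Suc (Suc 0)) (chart_image c) (\<lambda>y. u (chart_inv c y)))"

lemma C2MD: "C2M u \<Longrightarrow> c \<in> A \<Longrightarrow> C_k_on (Suc (Suc 0)) (chart_image c) (\<lambda>y. u (chart_inv c y))"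
  by (simp add: C2M_def)

lemma smooth_function_C2M: "smooth_function A f \<Longrightarrow> C2M f"
  by (simp add: smooth_function_def smooth_on_def C2M_def o_def)

lemma C2M_const: "C2M (\<lambda>x. a)"
  by (simp add: C2M_def)

lemma C2M_add: "C2M u \<Longrightarrow> C2M v \<Longrightarrow> C2M (\<lambda>x. u x + v x)"
  by (auto simp: C2M_def intro: C_k_on_add chart)

lemma C2M_mult: "C2M u \<Longrightarrow> C2M v \<Longrightarrow> C2M (\<lambda>x. u x * v x)"
  by (auto simp: C2M_def intro: C_k_on_mult chart)

lemma C2M_sum: "(\<And>i. i \<in> I \<Longrightarrow> C2M (u i)) \<Longrightarrow> C2M (\<lambda>x. \<Sum>i\<in>I. u i x)"
  by (induction I rule: infinite_finite_induct) (auto intro: C2M_const C2M_add)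

lemma C2M_inverse:
  assumes "C2M u" "\<And>x. 0 < u x" shows "C2M (\<lambda>x. inverse (u x))"
proof -
  have "C_k_on (Suc (Suc 0)) {0<..} (inverse :: real \<Rightarrow> real)"
    by (rule C_2_real[where \<psi>'="\<lambda>r. - (1 / r ^ 2)" and \<psi>''="\<lambda>r. 2 / r ^ 3"])
      (auto intro!: derivative_eq_intros continuous_intros simp: divide_simps power2_eq_square power3_eq_cube)
  note inverse = this
  show ?thesis
    unfolding C2M_def
  proof
    fix c assume c: "c \<in> A"
    show "C_k_on (Suc (Suc 0)) (chart_image c) (\<lambda>y. inverse (u (chart_inv c y)))"
      by (rule C_k_on_compose[OF chart(2)[OF c] open_greaterThan C2MD[OF assms(1) c] inverse]) (use assms(2) in auto)
  qed
qed

lemma C2M_continuous: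
  assumes "C2M u" shows "continuous_on UNIV u"
proof (intro continuous_at_imp_continuous_on ballI)
  fix x
  obtain c where c: "c \<in> A" "x \<in> fst c" by (rule chart_cover)
  have "continuous_on (fst c) (\<lambda>x. u (chart_inv c (snd c x)))"
    using chart_facts(2)[OF c(1)] by (intro continuous_on_compose2[OF C_k_on_imp_continuous[OF C2MD[OF assms c(1)]] chart_facts(5)[OF c(1)]]) auto
  then have "continuous_on (fst c) u" by (rule continuous_on_eq) (simp add: chart_facts(1)[OF c(1)])
  then show "isCont u x" using c chart(1) by (simp add: continuous_on_eq_continuous_at)
qed

text \<open>The image of \<open>K\<close> in the Hausdorff space is compact, hence closed. So a
  point outside the chart domain has a neighbourhood on which the extended function is 0.\<close>

lemma C2M_extend:
  fixes \<phi> :: "complex^'n \<Rightarrow> real"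
  assumes c: "c \<in> A" and \<phi>: "C_k_on (Suc (Suc 0)) (chart_image c) \<phi>"
    and K: "compact K" "K \<subseteq> chart_image c" "\<And>y. y \<in> chart_image c - K \<Longrightarrow> \<phi> y = 0"
  shows "C2M (\<lambda>x. if x \<in> fst c then \<phi> (snd c x) else 0)" (is "C2M ?u")
  unfolding C2M_def
proof
  fix d assume d: "d \<in> A"
  have "compact (chart_inv c ` K)"
    using chart_facts(6)[OF c] K by (intro compact_continuous_image) (auto intro: continuous_on_subset)
  then have cl: "closed (chart_inv c ` K)" by (rule compact_imp_closed)
  show "C_k_on (Suc (Suc 0)) (chart_image d) (\<lambda>y. ?u (chart_inv d y))"
  proof (rule C_k_on_local[OF chart(2)[OF d]])
    fix y assume y: "y \<in> chart_image d"
    show "\<exists>T. open T \<and> y \<in> T \<and> C_k_on (Suc (Suc 0)) T (\<lambda>y. ?u (chart_inv d y))"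
    proof (cases "chart_inv d y \<in> fst c")
      case True
      have "C_k_on (Suc (Suc 0)) (overlap d c) (\<lambda>y. \<phi> (transition d c y))"
        using transition(1)[OF d c] overlap_iff[OF c]
        by (intro C_k_on_compose[OF open_overlap[OF d c] chart(2)[OF c] transition_C_k[OF d c] \<phi>]) auto
      then have "C_k_on (Suc (Suc 0)) (overlap d c) (\<lambda>y. ?u (chart_inv d y))"
        by (subst C_k_on_cong[OF open_overlap[OF d c], where g="\<lambda>y. \<phi> (transition d c y)"])
          (auto simp: overlap_iff[OF d] transition_def)
      then show ?thesis using True y open_overlap[OF d c] overlap_iff[OF d] by blast
    next
      case False
      let ?O = "chart_image d \<inter> chart_inv d -` (- (chart_inv c ` K))"
      have O: "open ?O" by (intro open_vimage_chart_inv d) (use cl in auto)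
      have "chart_inv d y \<notin> chart_inv c ` K" using False K(2) chart_facts(4)[OF c] by auto
      then have "y \<in> ?O" using y by auto
      moreover have "C_k_on (Suc (Suc 0)) ?O (\<lambda>y. ?u (chart_inv d y))"
      proof (subst C_k_on_cong[OF O, where g="\<lambda>y. 0"])
        fix z assume z: "z \<in> ?O"
        show "?u (chart_inv d z) = 0"
        proof (cases "chart_inv d z \<in> fst c")
          case True
          then have "snd c (chart_inv d z) \<notin> K"
            using z chart_facts(1)[OF c True] by (metis (no_types, lifting) ComplD IntD2 image_eqI vimageD)
          then show ?thesis using True K(3) chart_facts(2)[OF c True] by simp
        qed simp
      qed simp
      ultimately show ?thesis using O by blast
    qed
  qed
qed

text \<open>By connectedness \<open>E\<close> is not open, so some point of \<open>E\<close> has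
  points outside \<open>E\<close> arbitrarily near. The ball is centred at such an outside point and
  grown until it meets \<open>E\<close>.\<close>

lemma touching_ball:
  assumes E: "closed E" "E \<noteq> {}" "E \<noteq> (UNIV :: 'm set)"
  obtains c y r R0 p where "c \<in> A" "0 < r" "r < R0" "cball y R0 \<subseteq> chart_image c" "dist y p = r"
    "chart_inv c p \<in> E" "\<And>z. dist y z < r \<Longrightarrow> chart_inv c z \<notin> E"
proof -
  have "\<not> open E"
    using connected_M E unfolding connected_clopen by auto
  then obtain q where q: "q \<in> E" "\<And>T. open T \<Longrightarrow> q \<in> T \<Longrightarrow> \<not> T \<subseteq> E"
    unfolding open_subopen[of E] by blast
  obtain c where c: "c \<in> A" "q \<in> fst c" by (rule chart_cover)
  define y0 where "y0 = snd c q"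
  have y0: "y0 \<in> chart_image c" "chart_inv c y0 = q" using chart_facts[OF c(1)] c(2) by (auto simp: y0_def)
  obtain \<epsilon> where \<epsilon>: "0 < \<epsilon>" "ball y0 \<epsilon> \<subseteq> chart_image c" using chart(2)[OF c(1)] y0(1) openE by blast
  \<comment> \<open>The centre \<open>y\<close> is within \<rho> of \<open>y0\<close>, so the ball
    of radius 2\<rho> around it stays within 3\<rho> of \<open>y0\<close>, inside the chart image.
    As \<open>y0\<close> belongs to \<open>E\<close>, the touching radius is less than \<rho>, which
    leaves room outside the touching sphere for the barrier.\<close>
  define \<rho> where "\<rho> = \<epsilon> / 4"
  have \<rho>: "0 < \<rho>" "ball y0 \<rho> \<subseteq> chart_image c" using \<epsilon> subset_ball[of \<rho> \<epsilon> y0] by (auto simp: \<rho>_def)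
  have "\<not> chart_inv c ` ball y0 \<rho> \<subseteq> E"
    using y0(2) \<rho>(1) by (intro q(2) open_image_chart_inv c \<rho>(2)) (auto intro!: image_eqI[of _ _ y0])
  then obtain y where y: "dist y0 y < \<rho>" "chart_inv c y \<notin> E"
    unfolding image_subset_iff Ball_def mem_ball by blast
  have sub: "cball y (2 * \<rho>) \<subseteq> chart_image c"
  proof
    fix z assume "z \<in> cball y (2 * \<rho>)"
    then have "dist y0 z < \<epsilon>" using y(1) dist_triangle[of y0 z y] \<epsilon>(1) by (simp add: \<rho>_def)
    then show "z \<in> chart_image c" using \<epsilon>(2) by auto
  qed
  define D where "D = cball y (2 * \<rho>) \<inter> chart_inv c -` E"
  have "closedin (top_of_set (cball y (2 * \<rho>))) D"
    unfolding D_def using continuous_on_subset[OF chart_facts(6)[OF c(1)] sub] E(1) by (rule continuous_closedin_preimage)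
  then have D: "compact D" using closedin_compact compact_cball by blast
  have y0D: "y0 \<in> D" using y(1) \<rho>(1) y0(2) q(1) by (auto simp: D_def dist_commute)
  obtain p where p: "p \<in> D" "\<And>z. z \<in> D \<Longrightarrow> dist y p \<le> dist y z"
    using distance_attains_inf[OF compact_imp_closed[OF D], of y] y0D by blast
  define r where "r = dist y p"
  have r2: "r < 2 * \<rho>" using p(2)[OF y0D] y(1) \<rho>(1) by (simp add: r_def dist_commute)
  show thesis
  proof (rule that[of c r "2 * \<rho>" y p])
    show "c \<in> A" "r < 2 * \<rho>" "cball y (2 * \<rho>) \<subseteq> chart_image c" by fact+
    show "0 < r" "chart_inv c p \<in> E" using p(1) y(2) by (auto simp: r_def D_def)
    show "dist y p = r" by (simp add: r_def)
    show "chart_inv c z \<notin> E" if "dist y z < r" for z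
    proof
      assume "chart_inv c z \<in> E"
      then have "z \<in> D" using that r2 by (simp add: D_def)
      then show False using p(2)[of z] that by (simp add: r_def)
    qed
  qed
qed

text \<open>Cubes of positive parts in charts serve as bumps; by compactness finitely many have a
  positive sum, and they are divided by it.\<close>

lemma partition_of_unity:
  obtains I :: "'m set" and ch K \<theta> where "finite I" "\<And>i. i \<in> I \<Longrightarrow> ch i \<in> A" "\<And>i. i \<in> I \<Longrightarrow> compact (K i)"
    "\<And>i. i \<in> I \<Longrightarrow> K i \<subseteq> fst (ch i)" "\<And>i. i \<in> I \<Longrightarrow> C2M (\<theta> i)" "\<And>i x. i \<in> I \<Longrightarrow> 0 \<le> \<theta> i x"
    "\<And>i x. i \<in> I \<Longrightarrow> x \<notin> K i \<Longrightarrow> \<theta> i x = 0" "\<And>x. (\<Sum>i\<in>I. \<theta> i x) = 1"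
proof -
  have "\<exists>c r. c \<in> A \<and> p \<in> fst c \<and> 0 < r \<and> cball (snd c p) r \<subseteq> chart_image c" for p
  proof -
    obtain c where c: "c \<in> A" "p \<in> fst c" by (rule chart_cover)
    obtain r where "0 < r" "cball (snd c p) r \<subseteq> chart_image c"
      using open_contains_cball chart(2)[OF c(1)] chart_facts(2)[OF c] by blast
    then show ?thesis using c by blast
  qed
  then obtain ch r where ch: "\<And>p. ch p \<in> A" "\<And>p. p \<in> fst (ch p)" "\<And>p. 0 < r p" "\<And>p. cball (snd (ch p) p) (r p) \<subseteq> chart_image (ch p)"
    by metis
  define \<phi> where "\<phi> p y = (max 0 ((r p)\<^sup>2 - (y - snd (ch p) p) \<bullet> (y - snd (ch p) p))) ^ 3" for p y
  define b where "b p x = (if x \<in> fst (ch p) then \<phi> p (snd (ch p) x) else 0)" for p x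
  define K where "K p = chart_inv (ch p) ` cball (snd (ch p) p) (r p)" for p
  have \<phi>: "C_k_on (Suc (Suc 0)) (chart_image (ch p)) (\<phi> p)" for p
  proof -
    have "((\<lambda>t::real. max 0 t ^ 3) has_real_derivative 3 * max 0 t ^ 2) (at t)"
      "((\<lambda>t::real. 3 * max 0 t ^ 2) has_real_derivative 6 * max 0 t) (at t)" for t
      using DERIV_max_0_power[of 1 t] DERIV_cmult[OF DERIV_max_0_power[of 0 t], of 3]
      by (simp_all add: numeral_3_eq_3 numeral_2_eq_2)
    then have "C_k_on (Suc (Suc 0)) UNIV (\<lambda>t::real. max 0 t ^ 3)"
      by (intro C_2_real[where \<psi>'="\<lambda>t. 3 * max 0 t ^ 2" and \<psi>''="\<lambda>t. 6 * max 0 t"] continuous_intros) auto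
    moreover have "C_k_on (Suc (Suc 0)) (chart_image (ch p)) (\<lambda>y. (r p)\<^sup>2 + (- 1) * ((y - snd (ch p) p) \<bullet> (y - snd (ch p) p)))"
      by (intro C_k_on_add C_k_on_mult C_k_on_const chart ch C_k_on_subset[OF C_k_on_norm_square]) simp
    ultimately show ?thesis
      unfolding \<phi>_def[abs_def] using C_k_on_compose[OF chart(2)[OF ch(1)] open_UNIV] by fastforce
  qed
  have \<phi>0: "\<phi> p y = 0" if "y \<notin> cball (snd (ch p) p) (r p)" for p y
  proof -
    have "(r p)\<^sup>2 \<le> (dist (snd (ch p) p) y)\<^sup>2" using that ch(3)[of p] by (intro power_mono) auto
    then show ?thesis by (simp add: \<phi>_def dist_norm dot_square_norm norm_minus_commute)
  qed
  have b: "C2M (b p)" for p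
    unfolding b_def using \<phi>0 by (intro C2M_extend[OF ch(1) \<phi> compact_cball ch(4)]) auto
  have b_nonneg: "0 \<le> b p x" for p x by (simp add: b_def \<phi>_def)
  have b_pos: "0 < b p p" for p using ch(2,3)[of p] by (simp add: b_def \<phi>_def)
  have b_K: "b p x = 0" if "x \<notin> K p" for p x
  proof (cases "x \<in> fst (ch p)")
    case True
    then have "snd (ch p) x \<notin> cball (snd (ch p) p) (r p)"
      using that chart_facts(1)[OF ch(1) True] unfolding K_def by (metis image_eqI)
    then show ?thesis by (simp add: b_def \<phi>0)
  qed (simp add: b_def)
  have "open {x. 0 < b p x}" for p
    using C2M_continuous[OF b] by (intro open_Collect_less continuous_on_const) auto
  then obtain I where I: "finite I" "UNIV \<subseteq> (\<Union>p\<in>I. {x. 0 < b p x})"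
    using compactE_image[OF compact_M, of UNIV "\<lambda>p. {x. 0 < b p x}"] b_pos by (metis (no_types, lifting) UNIV_I UN_iff mem_Collect_eq subsetI)
  define \<sigma> where "\<sigma> x = (\<Sum>p\<in>I. b p x)" for x
  have \<sigma>_pos: "0 < \<sigma> x" for x
  proof -
    obtain p where "p \<in> I" "0 < b p x" using I(2) by blast
    then show ?thesis unfolding \<sigma>_def using I(1) b_nonneg by (intro sum_pos2) auto
  qed
  have \<sigma>: "C2M \<sigma>" unfolding \<sigma>_def[abs_def] by (intro C2M_sum b)
  show thesis
  proof (rule that[of I ch K "\<lambda>p x. b p x * inverse (\<sigma> x)"])
    show "compact (K i)" for i
      unfolding K_def using ch(4)[of i] chart_facts(6)[OF ch(1)]
      by (intro compact_continuous_image) (auto intro: continuous_on_subset)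
    show "K i \<subseteq> fst (ch i)" for i unfolding K_def using ch(4)[of i] chart_facts(4)[OF ch(1)] by auto
    show "C2M (\<lambda>x. b i x * inverse (\<sigma> x))" for i by (intro C2M_mult b C2M_inverse \<sigma> \<sigma>_pos)
    show "0 \<le> b i x * inverse (\<sigma> x)" for i x using b_nonneg[of i x] \<sigma>_pos[of x] by simp
    show "(\<Sum>i\<in>I. b i x * inverse (\<sigma> x)) = 1" for x
      using \<sigma>_pos[of x] by (simp add: \<sigma>_def[symmetric] sum_distrib_right[symmetric])
  qed (use I ch b_K in auto)
qed

end

section \<open>Hermitian manifolds\<close>

lemma bij_betw_standard_basis:
  fixes e :: "nat \<Rightarrow> 'n::finite"
  assumes e: "bij_betw e {..<n} UNIV"
  shows "bij_betw (pairs (\<lambda>m. axis (e m) 1 :: complex^'n)) {..<2 * n} Basis"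
proof (rule bij_betwI')
  have J: "J (axis i 1) = (axis i \<i> :: complex^'n)" for i by (simp add: J_def axis_def vec_eq_iff)
  have inj: "l < n \<Longrightarrow> m < n \<Longrightarrow> e l = e m \<longleftrightarrow> l = m" for l m
    using e by (auto simp: bij_betw_def inj_on_def)
  have B: "axis i 1 \<in> (Basis :: (complex^'n) set)" "axis i \<i> \<in> (Basis :: (complex^'n) set)" for i
    by (auto simp: Basis_vec_def Basis_complex_def)
  let ?v = "pairs (\<lambda>m. axis (e m) 1 :: complex^'n)"
  show "?v p = ?v q \<longleftrightarrow> p = q" if "p \<in> {..<2 * n}" "q \<in> {..<2 * n}" for p q
  proof -
    have "2 * l \<noteq> Suc (2 * m)" "Suc (2 * m) \<noteq> 2 * l" for l m :: nat by presburger+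
    then show ?thesis
      using that inj by (cases p rule: nat_pair_cases; cases q rule: nat_pair_cases) (auto simp: J axis_eq_axis)
  qed
  show "?v p \<in> Basis" if "p \<in> {..<2 * n}" for p
    using B by (cases p rule: nat_pair_cases) (auto simp: J)
  show "\<exists>p\<in>{..<2 * n}. b = ?v p" if b: "b \<in> Basis" for b
  proof -
    obtain i where i: "b = axis i 1 \<or> b = axis i \<i>" using b by (auto simp: Basis_vec_def Basis_complex_def)
    obtain m where m: "m < n" "e m = i" using e by (metis UNIV_I bij_betw_iff_bijections lessThan_iff)
    from i show ?thesis
    proof
      assume "b = axis i 1" then show ?thesis using m by (intro bexI[of _ "2 * m"]) auto
    next
      assume "b = axis i \<i>" then show ?thesis using m by (intro bexI[of _ "2 * m + 1"]) (auto simp: J)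
    qed
  qed
qed

text \<open>Here \<open>k\<close> is n - 1, and \<open>e\<close> enumerates the complex coordinates,
  which fixes the order of the real basis \<open>v0\<close> on which forms of top degree are
  evaluated.\<close>

locale hermitian_manifold = compact_complex_manifold A
  for A :: "('m::t2_space, 'n::finite) chart set" +
  fixes \<omega> :: "('m, 'n) form" and e :: "nat \<Rightarrow> 'n" and k :: nat
  assumes metric: "hermitian_metric A \<omega>" and e: "bij_betw e {..<Suc k} UNIV"
begin

definition v0 :: "nat \<Rightarrow> complex^'n" where
  "v0 = pairs (\<lambda>m. axis (e m) 1)"

definition \<beta> :: "('m, 'n) chart \<Rightarrow> complex^'n \<Rightarrow> (nat \<Rightarrow> complex^'n) \<Rightarrow> real" where
  "\<beta> c x w = Re (wedge_power (\<omega> c x) k w)"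

abbreviation Lop :: "('m, 'n) chart \<Rightarrow> (complex^'n \<Rightarrow> real) \<Rightarrow> complex^'n \<Rightarrow> real" where
  "Lop c \<equiv> elliptic.L (op_indices (2 * k)) (op_s v0) (op_t v0) (op_b v0 (\<beta> c))"

abbreviation Pop :: "('m, 'n) chart \<Rightarrow> (complex^'n \<Rightarrow> real) \<Rightarrow> complex^'n \<Rightarrow> real" where
  "Pop c \<equiv> elliptic.P (op_indices (2 * k)) (op_s v0) (op_t v0) (op_b v0 (\<beta> c))"

lemma card_n: "CARD('n) = Suc k"
  using bij_betw_same_card[OF e] by simp

lemma metric_facts:
  assumes "c \<in> A"
  shows "x \<in> chart_image c \<Longrightarrow> alt_form 2 (\<omega> c x)" "x \<in> chart_image c \<Longrightarrow> positive_11_form (\<omega> c x)"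
    "C_k_on r (chart_image c) (\<lambda>x. \<omega> c x w)"
    "d \<in> A \<Longrightarrow> x \<in> overlap c d \<Longrightarrow> \<omega> c x = (\<lambda>w. \<omega> d (transition c d x) (\<lambda>i. dder (transition c d) (w i) x))"
  using metric assms unfolding hermitian_metric_def smooth_form_def alternating_form_eq smooth_on_def dder_def
  by blast+

lemma metric_real:
  assumes "c \<in> A" "x \<in> chart_image c" shows "\<omega> c x w \<in> \<real>"
proof (rule positive_11_form_herm[OF metric_facts(2)[OF assms]])
  fix H assume "\<And>v. \<omega> c x v = of_real (- 2 * Im (herm H (v 0) (v 1)))"
  then show ?thesis by (simp only: Reals_of_real)
qed

lemma wedge_power_eq_\<beta>: "c \<in> A \<Longrightarrow> x \<in> chart_image c \<Longrightarrow> wedge_power (\<omega> c x) k w = of_real (\<beta> c x w)"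
  unfolding \<beta>_def by (rule of_real_Re[OF wedge_power_real[OF metric_real], symmetric])

lemma \<beta>_alt:
  assumes "c \<in> A" "x \<in> chart_image c" shows "alt_form (2 * k) (\<beta> c x)"
  unfolding \<beta>_def[abs_def]
  by (rule alt_form_compose_linear[OF bounded_linear.linear[OF bounded_linear_Re] alt_form_wedge_power[OF metric_facts(1)[OF assms]]])

lemma \<beta>_smooth: "c \<in> A \<Longrightarrow> C_k_on r (chart_image c) (\<lambda>x. \<beta> c x w)"
  unfolding \<beta>_def by (intro C_k_on_linear[OF bounded_linear_Re] C_k_on_wedge_power chart metric_facts)

lemma \<beta>_pullback:
  assumes "c \<in> A" "d \<in> A" "x \<in> overlap c d"
  shows "\<beta> c x = (\<lambda>w. \<beta> d (transition c d x) (\<lambda>i. dder (transition c d) (w i) x))"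
  unfolding \<beta>_def[abs_def] metric_facts(4)[OF assms]
    wedge_power_pullback[where T="\<lambda>v. dder (transition c d) v x" and \<eta>="\<omega> d (transition c d x)"] ..

definition diagonal_at :: "('m, 'n) chart \<Rightarrow> complex^'n \<Rightarrow> (nat \<Rightarrow> complex^'n) \<Rightarrow> (nat \<Rightarrow> real) \<Rightarrow> bool" where
  "diagonal_at c x u a \<longleftrightarrow> (\<forall>l<Suc k. 0 < a l) \<and>
     (\<forall>h. bilinear h \<longrightarrow> contract2 (2 * k) (Jskew h) (\<beta> c x) v0 = (\<Sum>l<Suc k. a l * (h (u l) (u l) + h (J (u l)) (J (u l))))) \<and>
     (\<forall>\<xi> z. linear \<xi> \<longrightarrow> \<xi> z \<noteq> (0::real) \<longrightarrow> (\<exists>l<Suc k. \<xi> (u l) \<noteq> 0 \<or> \<xi> (J (u l)) \<noteq> 0))"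

lemma diagonal_atD:
  assumes "diagonal_at c x u a"
  shows "\<And>l. l < Suc k \<Longrightarrow> 0 < a l"
    "\<And>h. bilinear h \<Longrightarrow> contract2 (2 * k) (Jskew h) (\<beta> c x) v0 = (\<Sum>l<Suc k. a l * (h (u l) (u l) + h (J (u l)) (J (u l))))"
    "\<And>\<xi> z. linear \<xi> \<Longrightarrow> \<xi> z \<noteq> (0::real) \<Longrightarrow> \<exists>l<Suc k. \<xi> (u l) \<noteq> 0 \<or> \<xi> (J (u l)) \<noteq> 0"
  using assms unfolding diagonal_at_def by blast+

lemma diagonal_at_exists:
  assumes "c \<in> A" "x \<in> chart_image c"
  shows "\<exists>u a. diagonal_at c x u a"
proof (rule positive_11_form_contract2[OF metric_facts(1,2)[OF assms] e])
  fix u :: "nat \<Rightarrow> complex^'n" and a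
  assume 1: "\<And>l. l < Suc k \<Longrightarrow> 0 < a l"
    and 2: "\<And>h. bilinear h \<Longrightarrow> contract2 (2 * k) (Jskew h) (\<lambda>w. Re (wedge_power (\<omega> c x) k w)) (pairs (\<lambda>m. axis (e m) 1)) =
       (\<Sum>l<Suc k. a l * (h (u l) (u l) + h (J (u l)) (J (u l))))"
    and 3: "\<And>\<xi> z. linear \<xi> \<Longrightarrow> \<xi> z \<noteq> (0::real) \<Longrightarrow> \<exists>l<Suc k. \<xi> (u l) \<noteq> 0 \<or> \<xi> (J (u l)) \<noteq> 0"
  have "diagonal_at c x u a"
    unfolding diagonal_at_def v0_def \<beta>_def[abs_def] by (intro conjI allI impI 1 2 3)
  then show ?thesis by blast
qed

text \<open>Both positivity conditions are read off from the diagonal form: for the square of a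
  covector it is a sum of squares, not all zero; for a positive semidefinite form it is nonnegative
  term by term.\<close>

lemma elliptic_chart:
  assumes c: "c \<in> A"
  shows "elliptic (chart_image c) (op_indices (2 * k)) (op_s v0) (op_t v0) (op_b v0 (\<beta> c))"
proof
  show "open (chart_image c)" by (rule chart(2)[OF c])
  show "finite (op_indices (2 * k))" by (rule finite_op_indices)
  show "C_k_on (Suc (Suc 0)) (chart_image c) (op_b v0 (\<beta> c) q)" for q
  proof -
    obtain i j \<epsilon> where q: "q = (i, j, \<epsilon>)" by (cases q)
    have "op_b v0 (\<beta> c) q = (\<lambda>x. ((-1) ^ i * (-1) ^ j * (if \<epsilon> then 1 else - 1)) * \<beta> c x (omit j (omit i v0)))"
      by (simp add: op_b_def q fun_eq_iff)
    then show ?thesis by (simp only:) (intro C_k_on_mult C_k_on_const \<beta>_smooth c chart)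
  qed
next
  fix x \<xi> and z :: "complex^'n" assume x: "x \<in> chart_image c" and \<xi>: "linear \<xi>" "\<xi> z \<noteq> (0::real)"
  obtain u a where "diagonal_at c x u a"
      using diagonal_at_exists[OF c x] by blast
    note ua = diagonal_atD[OF this]
  have "bilinear (\<lambda>a b. \<xi> a * \<xi> b)"
    using \<xi>(1) unfolding bilinear_def by (auto simp: linear_iff algebra_simps)
  from ua(2)[OF this]
  have "(\<Sum>q\<in>op_indices (2 * k). op_b v0 (\<beta> c) q x * (\<xi> (op_s v0 q) * \<xi> (op_t v0 q))) =
      (\<Sum>l<Suc k. a l * (\<xi> (u l) * \<xi> (u l) + \<xi> (J (u l)) * \<xi> (J (u l))))"
    using sum_op_b[of v0 "\<beta> c" x "\<lambda>a b. \<xi> a * \<xi> b"] by simp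
  also have "\<dots> > 0"
  proof -
    obtain l where l: "l < Suc k" "\<xi> (u l) \<noteq> 0 \<or> \<xi> (J (u l)) \<noteq> 0" using ua(3)[OF \<xi>] by blast
    then have "0 < \<xi> (u l) * \<xi> (u l) + \<xi> (J (u l)) * \<xi> (J (u l))"
      using sum_squares_gt_zero_iff[of "\<xi> (u l)" "\<xi> (J (u l))"] by blast
    then show ?thesis
      using l ua(1) by (intro sum_pos2[of _ l]) (auto intro!: mult_pos_pos mult_nonneg_nonneg less_imp_le[OF ua(1)])
  qed
  finally show "0 < (\<Sum>q\<in>op_indices (2 * k). op_b v0 (\<beta> c) q x * (\<xi> (op_s v0 q) * \<xi> (op_t v0 q)))" .
next
  fix x and h :: "complex^'n \<Rightarrow> complex^'n \<Rightarrow> real"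
  assume x: "x \<in> chart_image c" and h: "bilinear h" "\<And>z. 0 \<le> h z z"
  obtain u a where "diagonal_at c x u a"
      using diagonal_at_exists[OF c x] by blast
    note ua = diagonal_atD[OF this]
  have "0 \<le> (\<Sum>l<Suc k. a l * (h (u l) (u l) + h (J (u l)) (J (u l))))"
    using h(2) by (intro sum_nonneg mult_nonneg_nonneg add_nonneg_nonneg) (auto intro: less_imp_le[OF ua(1)])
  then show "0 \<le> (\<Sum>q\<in>op_indices (2 * k). op_b v0 (\<beta> c) q x * h (op_s v0 q) (op_t v0 q))"
    unfolding sum_op_b ua(2)[OF h(1)] .
qed

section \<open>The operators in charts and their behaviour under a change of chart\<close>

lemma Lop_eq:
  assumes "c \<in> A"
  shows "Lop c u x = contract2 (2 * k) (Jskew (\<lambda>a b. dder (dder u a) b x)) (\<beta> c x) v0"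
  unfolding elliptic.L_def[OF elliptic_chart[OF assms]] by (rule sum_op_b)

lemma Pop_eq:
  assumes c: "c \<in> A" and g: "C_k_on (Suc (Suc 0)) (chart_image c) g" and x: "x \<in> chart_image c"
  shows "Pop c g x = (\<Sum>i\<le>Suc (2 * k). (-1) ^ i * (\<Sum>j\<le>2 * k. (-1) ^ j *
     (dder (dder (\<lambda>y. g y * \<beta> c y (omit j (omit i v0))) (omit i v0 j)) (J (v0 i)) x -
      dder (dder (\<lambda>y. g y * \<beta> c y (omit j (omit i v0))) (J (omit i v0 j))) (v0 i) x)))"
proof -
  have gb: "C_k_on (Suc (Suc 0)) (chart_image c) (\<lambda>y. g y * \<beta> c y w)" for w
    by (intro C_k_on_mult g \<beta>_smooth c chart)
  have eq: "op_b v0 (\<beta> c) (i, j, \<epsilon>) y * g y = ((-1) ^ i * (-1) ^ j * (if \<epsilon> then 1 else - 1)) * (g y * \<beta> c y (omit j (omit i v0)))"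
    for i j \<epsilon> y by (simp add: op_b_def)
  show ?thesis
    unfolding elliptic.P_def[OF elliptic_chart[OF c]] sum_op_indices eq dder2_cmult[OF gb chart(2)[OF c] x] sum_distrib_left
    by (intro sum.cong refl) (simp add: op_s_def op_t_def algebra_simps)
qed

lemma contract2_pullback_chart:
  assumes c: "c \<in> A" and d: "d \<in> A" and x: "x \<in> overlap c d"
  shows "contract2 (2 * k) (\<lambda>a b. K (dder (transition c d) a x) (dder (transition c d) b x)) (\<beta> c x) v0 =
     contract2 (2 * k) K (\<beta> d (transition c d x)) (\<lambda>i. dder (transition c d) (v0 i) x)"
  unfolding \<beta>_pullback[OF assms]
  by (rule contract2_pullback[where T="\<lambda>v. dder (transition c d) v x" and \<beta>="\<beta> d (transition c d x)"])

text \<open>The Hessian in the new chart is the pulled-back one plus a first-order term with the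
  second derivative of the transition. That term commutes with \<open>J\<close> in both directions
  and cancels in \<open>Jskew\<close>.\<close>

lemma Lop_transform:
  assumes c: "c \<in> A" and d: "d \<in> A" and x: "x \<in> overlap c d" and u: "C2M u"
  shows "Lop c (\<lambda>y. u (chart_inv c y)) x =
    contract2 (2 * k) (Jskew (\<lambda>a b. dder (dder (\<lambda>y. u (chart_inv d y)) a) b (transition c d x)))
      (\<beta> d (transition c d x)) (\<lambda>i. dder (transition c d) (v0 i) x)"
proof -
  let ?\<tau> = "transition c d" and ?uc = "\<lambda>y. u (chart_inv c y)" and ?ud = "\<lambda>y. u (chart_inv d y)"
  note o = open_overlap[OF c d] and hol = transition_holomorphic[OF c d]
  have \<tau>: "C_k_on (Suc (Suc 0)) (overlap c d) ?\<tau>" by (rule transition_C_k[OF c d])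
  have im: "?\<tau> ` overlap c d \<subseteq> chart_image d"
    using transition(1)[OF c d] overlap_iff[OF d] by auto
  have lin: "linear (\<lambda>v. dder ?ud v (?\<tau> x))"
    by (rule dder_linear[OF C2MD[OF u d] chart(2)[OF d]]) (use im x in auto)
  have h: "dder (dder ?uc a) b x = dder (dder ?ud (dder ?\<tau> a x)) (dder ?\<tau> b x) (?\<tau> x) + dder ?ud (dder (dder ?\<tau> a) b x) (?\<tau> x)" for a b
  proof -
    have "dder (dder ?uc a) b x = dder (dder (\<lambda>y. ?ud (?\<tau> y)) a) b x"
    proof (rule dder_cong[OF o x])
      fix y assume "y \<in> overlap c d"
      then show "dder ?uc a y = dder (\<lambda>y. ?ud (?\<tau> y)) a y"
        by (rule dder_cong[OF o]) (simp add: transition(2)[OF c d])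
    qed
    then show ?thesis using dder2_compose[OF \<tau> C2MD[OF u d] o chart(2)[OF d] im x] by simp
  qed
  have "Jskew (\<lambda>a b. dder (dder ?uc a) b x) a b =
      Jskew (\<lambda>a b. dder (dder ?ud a) b (?\<tau> x)) (dder ?\<tau> a x) (dder ?\<tau> b x)" for a b
    unfolding Jskew_def h holomorphic_map_dder2_J[OF o x hol] holomorphic_map_dder_J[OF hol x] by simp
  then have "Jskew (\<lambda>a b. dder (dder ?uc a) b x) =
      (\<lambda>a b. Jskew (\<lambda>a b. dder (dder ?ud a) b (?\<tau> x)) (dder ?\<tau> a x) (dder ?\<tau> b x))"
    by (simp add: fun_eq_iff)
  then show ?thesis unfolding Lop_eq[OF c] by (simp only: contract2_pullback_chart[OF c d x])
qed

lemma Lop_locally_zero: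
  assumes c: "c \<in> A" and x: "x \<in> chart_image c" and O: "open O'" "x \<in> O'" "\<And>y. y \<in> chart_image c \<Longrightarrow> y \<in> O' \<Longrightarrow> u y = 0"
  shows "Lop c u x = 0"
  by (rule elliptic.L_off_support[OF elliptic_chart[OF c], of "- O'"]) (use x O in auto)

lemma Lop_off_support:
  assumes c: "c \<in> A" and x: "x \<in> chart_image c" and K: "closed K" "\<And>p. p \<notin> K \<Longrightarrow> u p = 0" "chart_inv c x \<notin> K"
  shows "Lop c (\<lambda>y. u (chart_inv c y)) x = 0"
  by (rule Lop_locally_zero[OF c x, of "chart_image c \<inter> chart_inv c -` (- K)"])
    (use x K open_vimage_chart_inv[OF c, of "- K"] in auto)

text \<open>\<open>Lop\<close> is the value of a form of top degree on \<open>v0\<close>, so it is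
  multiplied by the Jacobian determinant, as a density on an oriented manifold is. The integrand is
  supported in the intersection of \<open>K1\<close> and \<open>K2\<close>; only this set has to lie
  in both charts.\<close>

lemma integral_chart_change:
  assumes c: "c \<in> A" and d: "d \<in> A" and u: "C2M u" and h: "continuous_on UNIV h"
    and K1: "compact K1" "\<And>p. p \<notin> K1 \<Longrightarrow> h p = 0" and K2: "compact K2" "\<And>p. p \<notin> K2 \<Longrightarrow> u p = 0"
    and K: "K1 \<inter> K2 \<subseteq> fst c \<inter> fst d"
  shows "integral (chart_image c) (\<lambda>y. h (chart_inv c y) * Lop c (\<lambda>y. u (chart_inv c y)) y) =
     integral (chart_image d) (\<lambda>y. h (chart_inv d y) * Lop d (\<lambda>y. u (chart_inv d y)) y)"
proof -
  let ?F = "\<lambda>c y. h (chart_inv c y) * Lop c (\<lambda>y. u (chart_inv c y)) y"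
  have cpt: "compact (K1 \<inter> K2)" using K1(1) K2(1) by (intro compact_Int)
  have zero: "?F c y = 0" if "c \<in> A" "y \<in> chart_image c" "chart_inv c y \<notin> K1 \<inter> K2" for c y
  proof (cases "chart_inv c y \<in> K1")
    case True
    then have "chart_inv c y \<notin> K2" using that(3) by simp
    from Lop_off_support[where u=u and K=K2, OF that(1,2) compact_imp_closed[OF K2(1)] K2(2) this] show ?thesis by simp
  qed (simp add: K1(2))
  have cont: "continuous_on (chart_image c) (?F c)" if "c \<in> A" for c
    by (intro continuous_on_mult continuous_on_compose2[OF h chart_facts(6)[OF that]]
      elliptic.L_continuous[OF elliptic_chart[OF that]] C2MD[OF u that]) auto
  have red: "integral (chart_image c) (?F c) = integral (overlap c d) (?F c)"
      "compact (snd c ` (K1 \<inter> K2))" "snd c ` (K1 \<inter> K2) \<subseteq> overlap c d"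
      "\<And>y. y \<in> overlap c d - snd c ` (K1 \<inter> K2) \<Longrightarrow> ?F c y = 0"
      "continuous_on (overlap c d) (?F c)"
    if c: "c \<in> A" and K: "K1 \<inter> K2 \<subseteq> fst c \<inter> fst d" for c d
  proof -
    show sub: "snd c ` (K1 \<inter> K2) \<subseteq> overlap c d" using K by (auto simp: overlap_def)
    show "compact (snd c ` (K1 \<inter> K2))"
      using continuous_on_subset[OF chart_facts(5)[OF c]] K by (intro compact_continuous_image cpt) auto
    have z: "?F c y = 0" if "y \<in> chart_image c - snd c ` (K1 \<inter> K2)" for y
    proof (rule zero[OF c])
      show "y \<in> chart_image c" using that by simp
      show "chart_inv c y \<notin> K1 \<inter> K2" using that chart_facts(3)[OF c, of y] by (metis DiffD1 DiffD2 image_eqI)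
    qed
    have ov: "overlap c d \<subseteq> chart_image c" by (intro subsetI) (simp add: overlap_iff[OF c])
    show "integral (chart_image c) (?F c) = integral (overlap c d) (?F c)"
      by (rule integral_compact_support_subset[OF ov]) (use z sub in blast)
    show "?F c y = 0" if "y \<in> overlap c d - snd c ` (K1 \<inter> K2)" for y using z that ov by blast
    show "continuous_on (overlap c d) (?F c)" using cont[OF c] ov by (rule continuous_on_subset)
  qed
  note rc = red[OF c K] and rd = red[OF d, of c] 
  have K': "K1 \<inter> K2 \<subseteq> fst d \<inter> fst c" using K by auto
  note rd = rd[OF K']
  \<comment> \<open>The type \<open>'n bit0\<close> has 2n elements and indexes real coordinates.
    The basis enumeration \<open>bN\<close> is arranged so that the determinant refers to the
    ordered basis \<open>v0\<close>.\<close>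
  define N where "N = 2 * Suc k"
  have cardN: "CARD('n bit0) = N" by (simp add: card_n N_def)
  obtain e2 :: "nat \<Rightarrow> 'n bit0" where e2: "bij_betw e2 {..<N} UNIV"
    using ex_bij_betw_nat_finite[of "UNIV :: 'n bit0 set"] cardN by (auto simp: atLeast0LessThan)
  define bN where "bN = v0 \<circ> inv_into {..<N} e2"
  have bN: "bij_betw bN UNIV Basis"
    unfolding bN_def using bij_betw_standard_basis[OF e, folded v0_def N_def] bij_betw_inv_into[OF e2]
    by (rule bij_betw_trans[rotated])
  have bN_e2: "bN (e2 i) = v0 i" if "i < N" for i
    using that e2 by (simp add: bN_def bij_betw_def)
  let ?\<tau> = "transition c d"
  let ?M = "\<lambda>x. matrix (\<lambda>y. to_coords bN (dder ?\<tau> (from_coords bN y) x))"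
  have det: "contract2 (2 * k) (Jskew h) (\<beta> d (?\<tau> x)) (\<lambda>i. dder ?\<tau> (v0 i) x) = det (?M x) * contract2 (2 * k) (Jskew h) (\<beta> d (?\<tau> x)) v0"
    if x: "x \<in> overlap c d" and h: "bilinear h" for x h
  proof -
    let ?\<Psi> = "contract2 (2 * k) (Jskew h) (\<beta> d (?\<tau> x))"
    have "?\<tau> x \<in> chart_image d" using transition(1)[OF c d x] overlap_iff[OF d] by auto
    then have alt: "alt_form N ?\<Psi>"
      using alt_form_contract2[OF bilinear_Jskew[OF h] \<beta>_alt[OF d]] by (simp add: N_def)
    have lin: "linear (\<lambda>v. dder ?\<tau> v x)"
      by (rule dder_linear[OF transition_C_k[OF c d, of "Suc 0"] open_overlap[OF c d] x])
    have "?\<Psi> (\<lambda>i. dder ?\<tau> (from_coords bN (axis (e2 i) 1)) x) = det (?M x) * ?\<Psi> (\<lambda>i. from_coords bN (axis (e2 i) 1))"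
      using alt e2 unfolding cardN[symmetric]
      by (rule alt_form_linear_image[OF _ _ linear_from_coords linear_to_coords from_coords_to_coords[OF bN] lin])
    then show ?thesis
      unfolding from_coords_axis
      using alt_form_cong[OF alt, of "\<lambda>i. dder ?\<tau> (bN (e2 i)) x" "\<lambda>i. dder ?\<tau> (v0 i) x"]
        alt_form_cong[OF alt, of "\<lambda>i. bN (e2 i)" v0] bN_e2 by simp
  qed
  have det_nonneg: "0 \<le> det (?M x)" if x: "x \<in> overlap c d" for x
  proof -
    have xc: "x \<in> chart_image c" and xd: "?\<tau> x \<in> chart_image d"
      using x transition(1)[OF c d x] overlap_iff[OF d] overlap_iff[OF c] by auto
    have lin: "linear (\<lambda>v. dder ?\<tau> v x)"
      by (rule dder_linear[OF transition_C_k[OF c d, of "Suc 0"] open_overlap[OF c d] x])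
    let ?h = "\<lambda>a b::complex^'n. a \<bullet> b"
    have h: "bilinear ?h" using bounded_bilinear_inner by (simp add: bilinear_conv_bounded_bilinear)
    obtain u a where "diagonal_at d (?\<tau> x) u a"
      using diagonal_at_exists[OF d xd] by blast
    note ua = diagonal_atD[OF this]
    have pos: "0 < contract2 (2 * k) (Jskew ?h) (\<beta> d (?\<tau> x)) v0"
    proof -
      obtain z :: "complex^'n" where "z \<in> Basis" using nonempty_Basis by blast
      then have "z \<bullet> z \<noteq> 0" by simp
      then obtain l where l: "l < Suc k" "z \<bullet> u l \<noteq> 0 \<or> z \<bullet> J (u l) \<noteq> 0"
        using ua(3)[of "\<lambda>w. z \<bullet> w" z] bounded_linear.linear[OF bounded_linear_inner_right] by metis
      then have "u l \<noteq> 0 \<or> J (u l) \<noteq> 0" by auto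
      then have "0 < u l \<bullet> u l \<or> 0 < J (u l) \<bullet> J (u l)" by (simp only: inner_gt_zero_iff)
      then have "0 < u l \<bullet> u l + J (u l) \<bullet> J (u l)"
        using inner_ge_zero[of "u l"] inner_ge_zero[of "J (u l)"] by linarith
      then show ?thesis
        unfolding ua(2)[OF h] using l(1) ua(1)
        by (intro sum_pos2[of _ l]) (auto intro!: mult_pos_pos mult_nonneg_nonneg less_imp_le[OF ua(1)])
    qed
    obtain u' a' where "diagonal_at c x u' a'"
      using diagonal_at_exists[OF c xc] by blast
    note ua' = diagonal_atD[OF this]
    let ?h' = "\<lambda>a b. dder ?\<tau> a x \<bullet> dder ?\<tau> b x"
    have h': "bilinear ?h'"
      using lin unfolding bilinear_def by (auto simp: linear_iff inner_simps)
    have "Jskew ?h' = (\<lambda>a b. Jskew ?h (dder ?\<tau> a x) (dder ?\<tau> b x))"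
      by (simp add: Jskew_def fun_eq_iff holomorphic_map_dder_J[OF transition_holomorphic[OF c d] x])
    then have "contract2 (2 * k) (Jskew ?h') (\<beta> c x) v0 = det (?M x) * contract2 (2 * k) (Jskew ?h) (\<beta> d (?\<tau> x)) v0"
      by (simp only: contract2_pullback_chart[OF c d x] det[OF x h])
    moreover have "0 \<le> contract2 (2 * k) (Jskew ?h') (\<beta> c x) v0"
      unfolding ua'(2)[OF h'] by (intro sum_nonneg mult_nonneg_nonneg) (auto intro: less_imp_le[OF ua'(1)])
    ultimately show ?thesis using pos by (simp add: zero_le_mult_iff)
  qed
  have "integral (overlap c d) (?F c) = integral (overlap d c) (?F d)"
  proof (rule change_of_variables_compact_support[OF bN open_overlap[OF c d] _ transition_inj[OF c d] transition_image[OF c d]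
      rd(5,2,3,4) rc(5,2,3,4)])
    fix x assume x: "x \<in> overlap c d"
    show "(?\<tau> has_derivative (\<lambda>v. dder ?\<tau> v x)) (at x)"
      by (rule C_k_on_imp_has_derivative[OF transition_C_k[OF c d, of "Suc 0"] open_overlap[OF c d] x])
    have xd: "?\<tau> x \<in> chart_image d" using transition(1)[OF c d x] overlap_iff[OF d] by auto
    have "Lop c (\<lambda>y. u (chart_inv c y)) x = det (?M x) * Lop d (\<lambda>y. u (chart_inv d y)) (?\<tau> x)"
      unfolding Lop_transform[OF c d x u] Lop_eq[OF d] 
      by (rule det[OF x]) (use bilinear_dder2[OF C2MD[OF u d] chart(2)[OF d] xd] in \<open>auto simp: bilinear_def\<close>)
    then show "?F c x = \<bar>det (?M x)\<bar> * ?F d (?\<tau> x)"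
      using det_nonneg[OF x] transition(2)[OF c d x] by simp
  qed
  then show ?thesis using rc(1) rd(1) by simp
qed

end

section \<open>Solutions of \<open>\<partial>\<partial>bar (f \<omega>\<^sup>n\<^sup>-\<^sup>1) = 0\<close>\<close>

lemma dder2_sum:
  fixes f :: "'i \<Rightarrow> 'a::euclidean_space \<Rightarrow> real"
  assumes S: "open S" "x \<in> S" and f: "\<And>i. i \<in> I \<Longrightarrow> C_k_on (Suc (Suc 0)) S (f i)"
  shows "dder (dder (\<lambda>y. \<Sum>i\<in>I. f i y) v) u x = (\<Sum>i\<in>I. dder (dder (f i) v) u x)"
proof -
  have "dder (dder (\<lambda>y. \<Sum>i\<in>I. f i y) v) u x = dder (\<lambda>y. \<Sum>i\<in>I. dder (f i) v y) u x"
    by (rule dder_cong[OF S]) (intro dder_eq has_derivative_sum C_k_on_imp_has_derivative[OF f S(1)])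
  also have "\<dots> = (\<Sum>i\<in>I. dder (dder (f i) v) u x)"
    by (intro dder_eq has_derivative_sum C_k_on_imp_has_derivative[OF C_k_on_dder[OF f] S])
  finally show ?thesis .
qed

context elliptic
begin

lemma L_sum:
  assumes "x \<in> S" "\<And>i. i \<in> I \<Longrightarrow> C2 (v i)"
  shows "L (\<lambda>y. \<Sum>i\<in>I. v i y) x = (\<Sum>i\<in>I. L (v i) x)"
proof -
  have "dder (dder (\<lambda>y. \<Sum>i\<in>I. v i y) a) a' x = (\<Sum>i\<in>I. dder (dder (v i) a) a' x)" for a a'
    by (rule dder2_sum[OF open_S assms])
  then show ?thesis unfolding L_def by (simp only: sum_distrib_left) (rule sum.swap)
qed

lemma L_cmult: "x \<in> S \<Longrightarrow> C2 v \<Longrightarrow> L (\<lambda>y. a * v y) x = a * L v x"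
  unfolding L_def by (simp add: dder2_cmult[OF _ open_S] sum_distrib_left mult_ac)

lemma L_const: "L (\<lambda>y. a) x = 0"
proof -
  have 0: "dder (\<lambda>y::'a. c::real) u y = 0" for c u y by (rule dder_eq[OF has_derivative_const])
  have "dder (\<lambda>y::'a. c::real) u = (\<lambda>y. 0)" for c u by (rule ext) (rule 0)
  then show ?thesis by (simp add: L_def)
qed

end

context hermitian_manifold
begin

text \<open>The weak pairing of \<open>h\<close> with \<i>\<partial>\<partial>bar \<open>u\<close>
  wedged with the power of \<omega>, up to a constant factor, computed in a single chart. It is used
  when \<open>h\<close> or \<open>u\<close> vanishes off a compact subset of the chart
  domain.\<close>

definition mean :: "('m, 'n) chart \<Rightarrow> ('m \<Rightarrow> real) \<Rightarrow> ('m \<Rightarrow> real) \<Rightarrow> real" where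
  "mean c h u = integral (chart_image c) (\<lambda>y. h (chart_inv c y) * Lop c (\<lambda>y. u (chart_inv c y)) y)"

lemma chart_support:
  assumes c: "c \<in> A" and K: "compact K" "K \<subseteq> fst c"
  shows "compact (snd c ` K)" "snd c ` K \<subseteq> chart_image c"
    "\<And>y. y \<in> chart_image c \<Longrightarrow> y \<notin> snd c ` K \<Longrightarrow> chart_inv c y \<notin> K"
proof -
  show "compact (snd c ` K)"
    using continuous_on_subset[OF chart_facts(5)[OF c] K(2)] K(1) by (rule compact_continuous_image)
  show "snd c ` K \<subseteq> chart_image c" using K(2) by (auto simp: chart_image_def)
  show "chart_inv c y \<notin> K" if "y \<in> chart_image c" "y \<notin> snd c ` K" for y
    using that chart_facts(3)[OF c that(1)] by (metis image_eqI)
qed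

lemma mean_integrable:
  assumes c: "c \<in> A" and u: "C2M u" and h: "continuous_on UNIV h" and K: "compact K" "K \<subseteq> fst c"
    and z: "(\<forall>p. p \<notin> K \<longrightarrow> h p = 0) \<or> (\<forall>p. p \<notin> K \<longrightarrow> u p = 0)"
  shows "(\<lambda>y. h (chart_inv c y) * Lop c (\<lambda>y. u (chart_inv c y)) y) integrable_on chart_image c"
proof (rule integrable_compact_support[OF _ chart_support(1,2)[OF c K]])
  show "continuous_on (chart_image c) (\<lambda>y. h (chart_inv c y) * Lop c (\<lambda>y. u (chart_inv c y)) y)"
    by (intro continuous_on_mult continuous_on_compose2[OF h chart_facts(6)[OF c]]
      elliptic.L_continuous[OF elliptic_chart[OF c]] C2MD[OF u c]) auto
  fix y assume "y \<in> chart_image c - snd c ` K"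
  then have y: "y \<in> chart_image c" "chart_inv c y \<notin> K" using chart_support(3)[OF c K] by auto
  show "h (chart_inv c y) * Lop c (\<lambda>y. u (chart_inv c y)) y = 0"
    using z
  proof
    assume "\<forall>p. p \<notin> K \<longrightarrow> u p = 0"
    then show ?thesis
      using Lop_off_support[where u=u and K=K, OF c y(1) compact_imp_closed[OF K(1)] _ y(2)] by simp
  qed (use y(2) in simp)
qed

text \<open>Each summand lives in its own chart. Insert the partition a second time as a factor of
  \<open>g\<close>, move the term with indices i, j to chart j, and sum over i there: the operator
  is then applied to the constant 1 and gives 0.\<close>

lemma sum_mean_zero:
  assumes I: "finite I" and ch: "\<And>i. i \<in> I \<Longrightarrow> ch i \<in> A" and K: "\<And>i. i \<in> I \<Longrightarrow> compact (K i)" "\<And>i. i \<in> I \<Longrightarrow> K i \<subseteq> fst (ch i)"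
    and u: "\<And>i. i \<in> I \<Longrightarrow> C2M (u i)" "\<And>i p. i \<in> I \<Longrightarrow> p \<notin> K i \<Longrightarrow> u i p = 0" "\<And>p. (\<Sum>i\<in>I. u i p) = 1"
    and g: "continuous_on UNIV g"
  shows "(\<Sum>i\<in>I. mean (ch i) g (u i)) = 0"
proof -
  let ?L = "\<lambda>c i y. Lop c (\<lambda>y. u i (chart_inv c y)) y"
  have gu: "continuous_on UNIV (\<lambda>p. g p * u j p)" if "j \<in> I" for j
    by (intro continuous_on_mult g C2M_continuous u that)
  have int1: "(\<lambda>y. (g (chart_inv (ch i) y) * u j (chart_inv (ch i) y)) * ?L (ch i) i y) integrable_on chart_image (ch i)"
    if "i \<in> I" "j \<in> I" for i j
    using mean_integrable[OF ch[OF that(1)] u(1)[OF that(1)] gu[OF that(2)] K(1,2)[OF that(1)]] u(2)[OF that(1)] by blast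
  have int2: "(\<lambda>y. (g (chart_inv (ch j) y) * u j (chart_inv (ch j) y)) * ?L (ch j) i y) integrable_on chart_image (ch j)"
    if "i \<in> I" "j \<in> I" for i j
    using mean_integrable[OF ch[OF that(2)] u(1)[OF that(1)] gu[OF that(2)] K(1,2)[OF that(2)]] u(2)[OF that(2)] by simp
  have "mean (ch i) g (u i) = (\<Sum>j\<in>I. mean (ch j) (\<lambda>p. g p * u j p) (u i))" if i: "i \<in> I" for i
  proof -
    have "mean (ch i) g (u i) = integral (chart_image (ch i)) (\<lambda>y. \<Sum>j\<in>I. (g (chart_inv (ch i) y) * u j (chart_inv (ch i) y)) * ?L (ch i) i y)"
      unfolding mean_def sum_distrib_right[symmetric] sum_distrib_left[symmetric] u(3) by simp
    also have "\<dots> = (\<Sum>j\<in>I. integral (chart_image (ch i)) (\<lambda>y. (g (chart_inv (ch i) y) * u j (chart_inv (ch i) y)) * ?L (ch i) i y))"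
      by (rule integral_sum[OF I int1[OF i]])
    also have "\<dots> = (\<Sum>j\<in>I. mean (ch j) (\<lambda>p. g p * u j p) (u i))"
    proof (rule sum.cong[OF refl])
      fix j assume j: "j \<in> I"
      show "integral (chart_image (ch i)) (\<lambda>y. (g (chart_inv (ch i) y) * u j (chart_inv (ch i) y)) * ?L (ch i) i y) =
        mean (ch j) (\<lambda>p. g p * u j p) (u i)"
        unfolding mean_def
        by (rule integral_chart_change[where h="\<lambda>p. g p * u j p", OF ch[OF i] ch[OF j] u(1)[OF i] gu[OF j] K(1)[OF j] _ K(1)[OF i] u(2)[OF i]])
          (use K(2)[OF i] K(2)[OF j] u(2)[OF j] in auto)
    qed
    finally show ?thesis .
  qed
  then have "(\<Sum>i\<in>I. mean (ch i) g (u i)) = (\<Sum>i\<in>I. \<Sum>j\<in>I. mean (ch j) (\<lambda>p. g p * u j p) (u i))" by simp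
  also have "\<dots> = (\<Sum>j\<in>I. \<Sum>i\<in>I. mean (ch j) (\<lambda>p. g p * u j p) (u i))" by (rule sum.swap)
  also have "\<dots> = 0"
  proof (rule sum.neutral, rule ballI)
    fix j assume j: "j \<in> I"
    note ell = elliptic_chart[OF ch[OF j]]
    have "(\<Sum>i\<in>I. mean (ch j) (\<lambda>p. g p * u j p) (u i)) =
        integral (chart_image (ch j)) (\<lambda>y. \<Sum>i\<in>I. (g (chart_inv (ch j) y) * u j (chart_inv (ch j) y)) * ?L (ch j) i y)"
      unfolding mean_def by (rule integral_sum[OF I int2[OF _ j], symmetric])
    also have "\<dots> = integral (chart_image (ch j)) (\<lambda>y. 0)"
    proof (rule integral_cong)
      fix y assume y: "y \<in> chart_image (ch j)"
      have "(\<Sum>i\<in>I. ?L (ch j) i y) = Lop (ch j) (\<lambda>y. \<Sum>i\<in>I. u i (chart_inv (ch j) y)) y"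
        by (rule elliptic.L_sum[OF ell y C2MD[OF u(1) ch[OF j]], symmetric])
      also have "\<dots> = 0" unfolding u(3) by (rule elliptic.L_const[OF ell])
      finally show "(\<Sum>i\<in>I. (g (chart_inv (ch j) y) * u j (chart_inv (ch j) y)) * ?L (ch j) i y) = 0"
        by (simp add: sum_distrib_left[symmetric])
    qed
    finally show "(\<Sum>i\<in>I. mean (ch j) (\<lambda>p. g p * u j p) (u i)) = 0" by simp
  qed
  finally show ?thesis .
qed

definition solution :: "('m \<Rightarrow> real) \<Rightarrow> bool" where
  "solution f \<longleftrightarrow> C2M f \<and> (\<forall>c\<in>A. \<forall>y\<in>chart_image c. Pop c (\<lambda>y. f (chart_inv c y)) y = 0)"

lemma solution_linear:
  assumes "solution f" "solution g" shows "solution (\<lambda>x. f x + a * g x)"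
  using assms elliptic.P_linear[OF elliptic_chart C2MD C2MD] unfolding solution_def
  by (auto intro!: C2M_add C2M_mult C2M_const)

text \<open>Extend \<open>v\<close>, suitably scaled, to a partition of unity: the integrals of \<open>\<bar>f\<bar> L u\<close> over its members \<open>u\<close>
  are nonnegative by Kato's inequality and add up to zero.\<close>

lemma mean_abs_solution:
  assumes f: "solution f" and c: "c \<in> A" and v: "C2M v" "\<And>p. 0 \<le> v p"
    and Kv: "compact Kv" "Kv \<subseteq> fst c" "\<And>p. p \<notin> Kv \<Longrightarrow> v p = 0"
  shows "mean c (\<lambda>p. \<bar>f p\<bar>) v = 0"
proof -
  have f': "C2M f" "\<And>c y. c \<in> A \<Longrightarrow> y \<in> chart_image c \<Longrightarrow> Pop c (\<lambda>y. f (chart_inv c y)) y = 0"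
    using f by (auto simp: solution_def)
  have Kato: "0 \<le> mean c (\<lambda>p. \<bar>f p\<bar>) u"
    if c: "c \<in> A" and u: "C2M u" "\<And>p. 0 \<le> u p" and K: "compact K" "K \<subseteq> fst c" "\<And>p. p \<notin> K \<Longrightarrow> u p = 0" for c u K
    unfolding mean_def
  proof (rule elliptic.Kato[OF elliptic_chart[OF c] C2MD[OF f'(1) c] f'(2)[OF c] C2MD[OF u(1) c] _ chart_support(1,2)[OF c K(1,2)]])
    show "0 \<le> u (chart_inv c x)" for x by (rule u(2))
    show "u (chart_inv c x) = 0" if "x \<in> chart_image c - snd c ` K" for x
      using that chart_support(3)[OF c K(1,2)] by (intro K(3)) auto
  qed
  obtain M where M: "0 \<le> M" "\<And>p. \<bar>v p\<bar> \<le> M"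
    by (rule compact_continuous_abs_le[OF compact_M C2M_continuous[OF v(1)]]) auto
  \<comment> \<open>Scaling makes \<open>\<delta> * v\<close> at most 1, so that the factor
    \<open>1 - \<delta> v\<close> on the other members is nonnegative.\<close>
  define \<delta> where "\<delta> = 1 / (M + 1)"
  have \<delta>: "0 < \<delta>" using M(1) by (simp add: \<delta>_def)
  have \<delta>v: "0 \<le> \<delta> * v p" "\<delta> * v p \<le> 1" for p
  proof -
    show "0 \<le> \<delta> * v p" using \<delta> v(2)[of p] by simp
    have "v p \<le> M + 1" using M(2)[of p] by linarith
    then show "\<delta> * v p \<le> 1" using M(1) by (simp add: \<delta>_def)
  qed
  obtain I :: "'m set" and ch K \<theta> where I: "finite I" "\<And>i. i \<in> I \<Longrightarrow> ch i \<in> A" "\<And>i. i \<in> I \<Longrightarrow> compact (K i)"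
    "\<And>i. i \<in> I \<Longrightarrow> K i \<subseteq> fst (ch i)" "\<And>i. i \<in> I \<Longrightarrow> C2M (\<theta> i)" "\<And>i x. i \<in> I \<Longrightarrow> 0 \<le> \<theta> i x"
    "\<And>i x. i \<in> I \<Longrightarrow> x \<notin> K i \<Longrightarrow> \<theta> i x = 0" "\<And>x. (\<Sum>i\<in>I. \<theta> i x) = 1"
    by (rule partition_of_unity) blast
  \<comment> \<open>The new index \<open>None\<close> carries \<open>\<delta> * v\<close>; the
    others carry the old partition multiplied by the complementary factor.\<close>
  define I' where "I' = insert None (Some ` I)"
  define ch' where "ch' i = (case i of None \<Rightarrow> c | Some i \<Rightarrow> ch i)" for i
  define K' where "K' i = (case i of None \<Rightarrow> Kv | Some i \<Rightarrow> K i)" for i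
  define u where "u i p = (case i of None \<Rightarrow> \<delta> * v p | Some i \<Rightarrow> \<theta> i p * (1 + (- \<delta>) * v p))" for i p
  have fin: "finite I'" using I(1) by (simp add: I'_def)
  have members: "ch' i \<in> A" "compact (K' i)" "K' i \<subseteq> fst (ch' i)" "C2M (u i)" "\<And>p. 0 \<le> u i p" "\<And>p. p \<notin> K' i \<Longrightarrow> u i p = 0"
    if "i \<in> I'" for i
  proof -
    from that consider "i = None" | j where "i = Some j" "j \<in> I" by (auto simp: I'_def)
    note cases = this
    show "ch' i \<in> A" using cases by cases (use c I in \<open>auto simp: ch'_def\<close>)
    show "compact (K' i)" using cases by cases (use Kv I in \<open>auto simp: K'_def\<close>)
    show "K' i \<subseteq> fst (ch' i)" using cases by cases (use Kv I in \<open>auto simp: K'_def ch'_def\<close>)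
    show "C2M (u i)"
      using cases
    proof cases
      case 1
      then have "u i = (\<lambda>p. \<delta> * v p)" by (simp add: u_def fun_eq_iff)
      then show ?thesis by (simp only:) (intro C2M_mult C2M_const v(1))
    next
      case (2 j)
      then have "u i = (\<lambda>p. \<theta> j p * (1 + (- \<delta>) * v p))" by (simp add: u_def fun_eq_iff)
      then show ?thesis by (simp only:) (intro C2M_mult C2M_add C2M_const v(1) I(5) \<open>j \<in> I\<close>)
    qed
    show "0 \<le> u i p" for p
      using cases by cases (use \<delta>v[of p] I(6) in \<open>auto simp: u_def\<close>)
    show "u i p = 0" if "p \<notin> K' i" for p
      using cases that by cases (use Kv(3) I(7) in \<open>auto simp: u_def K'_def\<close>)
  qed
  have sum: "(\<Sum>i\<in>I'. u i p) = 1" for p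
  proof -
    have "(\<Sum>i\<in>I'. u i p) = \<delta> * v p + (\<Sum>i\<in>I. \<theta> i p * (1 + (- \<delta>) * v p))"
      unfolding I'_def using I(1) by (subst sum.insert) (auto simp: sum.reindex u_def)
    also have "\<dots> = 1" by (simp only: sum_distrib_right[symmetric] I(8)) simp
    finally show ?thesis .
  qed
  have abs_f: "continuous_on UNIV (\<lambda>p. \<bar>f p\<bar>)"
    using C2M_continuous[OF f'(1)] by (rule continuous_on_rabs)
  have sum0: "(\<Sum>i\<in>I'. mean (ch' i) (\<lambda>p. \<bar>f p\<bar>) (u i)) = 0"
    by (rule sum_mean_zero[OF fin members(1-4,6) sum abs_f])
  have nonneg: "0 \<le> mean (ch' i) (\<lambda>p. \<bar>f p\<bar>) (u i)" if "i \<in> I'" for i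
    by (rule Kato[OF members(1,4,5,2,3,6)]) (use that in simp_all)
  have "mean (ch' None) (\<lambda>p. \<bar>f p\<bar>) (u None) = 0"
    by (rule sum_nonneg_0[OF fin nonneg sum0]) (simp_all add: I'_def)
  then have "mean c (\<lambda>p. \<bar>f p\<bar>) (\<lambda>p. \<delta> * v p) = 0" by (simp add: ch'_def u_def[abs_def])
  also have "mean c (\<lambda>p. \<bar>f p\<bar>) (\<lambda>p. \<delta> * v p) = \<delta> * mean c (\<lambda>p. \<bar>f p\<bar>) v"
    unfolding mean_def integral_mult_right[symmetric]
    by (rule integral_cong) (simp add: elliptic.L_cmult[OF elliptic_chart[OF c] _ C2MD[OF v(1) c]])
  finally show ?thesis using \<delta> by simp
qed

lemma mean_solution:
  assumes f: "solution f" and c: "c \<in> A" and v: "C2M v" and K: "compact K" "K \<subseteq> fst c" "\<And>p. p \<notin> K \<Longrightarrow> v p = 0"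
  shows "mean c f v = 0"
proof -
  have f': "C2M f" "\<And>y. y \<in> chart_image c \<Longrightarrow> Pop c (\<lambda>y. f (chart_inv c y)) y = 0"
    using f c by (auto simp: solution_def)
  have "mean c f v = integral (chart_image c) (\<lambda>y. v (chart_inv c y) * Pop c (\<lambda>y. f (chart_inv c y)) y)"
    unfolding mean_def
    by (rule elliptic.integral_P_eq_integral_L[OF elliptic_chart[OF c] C2MD[OF v c] C2MD[OF f'(1) c] chart_support(1,2)[OF c K(1,2)], symmetric])
      (use K(3) chart_support(3)[OF c K(1,2)] in auto)
  also have "\<dots> = integral (chart_image c) (\<lambda>y. 0)" by (rule integral_cong) (simp add: f'(2))
  finally show ?thesis by simp
qed

lemma solution_no_sign_change:
  assumes f: "solution f" and pos: "0 < f p0" and neg: "f n0 < 0"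
  shows False
proof -
  have C: "C2M f" using f by (simp add: solution_def)
  note fc = C2M_continuous[OF C]
  let ?E = "closure {x. 0 < f x}"
  have "?E \<subseteq> {x. 0 \<le> f x}"
    by (rule closure_minimal) (auto intro!: closed_Collect_le continuous_on_const fc)
  then have ne1: "?E \<noteq> UNIV" using neg by (metis UNIV_I mem_Collect_eq not_le subsetD)
  have ne0: "?E \<noteq> {}" using pos closure_subset by blast
  obtain c y r R0 p where b: "c \<in> A" "0 < r" "r < R0" "cball y R0 \<subseteq> chart_image c" "dist y p = r"
    "chart_inv c p \<in> ?E" "\<And>z. dist y z < r \<Longrightarrow> chart_inv c z \<notin> ?E"
    by (rule touching_ball[OF closed_closure ne0 ne1]) blast
  note c = b(1)
  have pI: "p \<in> chart_image c" using b(3-5) by auto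
  define h where "h x = max 0 (f x)" for x
  have h: "continuous_on UNIV h" unfolding h_def[abs_def] by (intro continuous_intros fc)
  have hc: "continuous_on (chart_image c) (\<lambda>y. h (chart_inv c y))"
    by (rule continuous_on_compose2[OF h chart_facts(6)[OF c]]) auto
  have hn: "0 \<le> h (chart_inv c z)" for z by (simp add: h_def)
  have hz: "h (chart_inv c z) = 0" if "dist y z < r" for z
  proof -
    have "\<not> 0 < f (chart_inv c z)" using b(7)[OF that] closure_subset[of "{x. 0 < f x}"] by blast
    then show ?thesis by (simp add: h_def)
  qed
  \<comment> \<open>The touching point lies only in the closure, and \<open>f\<close> may vanish at
    it; positive values arbitrarily near are what the weak form of the Hopf argument asks
    for.\<close>
  have hp: "\<exists>x. dist p x < \<epsilon> \<and> x \<in> chart_image c \<and> 0 < h (chart_inv c x)" if \<epsilon>: "0 < \<epsilon>" for \<epsilon>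
  proof -
    let ?N = "chart_inv c ` (ball p \<epsilon> \<inter> chart_image c)"
    have "open ?N" by (intro open_image_chart_inv c open_Int chart) auto
    moreover have "chart_inv c p \<in> ?N" using \<epsilon> pI by auto
    ultimately obtain x where "x \<in> ?N" "0 < f x"
      using b(6) unfolding closure_iff_nhds_not_empty by (metis (mono_tags) Int_iff all_not_in_conv mem_Collect_eq order_refl)
    then show ?thesis by (auto simp: h_def)
  qed
  show False
  proof (rule elliptic.weak_Hopf[OF elliptic_chart[OF c] hc hn b(2,3,4) hz b(5) hp])
    fix v K assume v: "C_k_on (Suc (Suc 0)) (chart_image c) v" "\<And>x. 0 \<le> v x" "compact K" "K \<subseteq> chart_image c"
      "\<And>x. x \<notin> K \<Longrightarrow> v x = 0" "0 < integral (chart_image c) (\<lambda>x. h (chart_inv c x) * Lop c v x)"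
    define w where "w x = (if x \<in> fst c then v (snd c x) else 0)" for x
    define KM where "KM = chart_inv c ` K"
    have w: "C2M w" unfolding w_def[abs_def] using v by (intro C2M_extend[OF c]) auto
    have w0: "0 \<le> w p" for p using v(2) by (simp add: w_def)
    have KM: "compact KM" "KM \<subseteq> fst c"
      unfolding KM_def using v(3,4) chart_facts(4,6)[OF c] by (auto intro!: compact_continuous_image intro: continuous_on_subset)
    have wK: "w p = 0" if "p \<notin> KM" for p
    proof (cases "p \<in> fst c")
      case True
      then have "snd c p \<notin> K" using that chart_facts(1)[OF c True] unfolding KM_def by (metis image_eqI)
      then show ?thesis using v(5) by (simp add: w_def)
    qed (simp add: w_def)
    have Lw: "Lop c (\<lambda>y. w (chart_inv c y)) y = Lop c v y" if y: "y \<in> chart_image c" for y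
    proof -
      have eq: "w (chart_inv c z) = v z" if "z \<in> chart_image c" for z using chart_facts(3,4)[OF c that] by (simp add: w_def)
      have "dder (\<lambda>y. w (chart_inv c y)) u z = dder v u z" if "z \<in> chart_image c" for u z
        by (rule dder_cong[OF chart(2)[OF c] that eq])
      then have "dder (dder (\<lambda>y. w (chart_inv c y)) u) u' y = dder (dder v u) u' y" for u u'
        by (intro dder_cong[OF chart(2)[OF c] y])
      then show ?thesis by (simp add: elliptic.L_def[OF elliptic_chart[OF c]])
    qed
    have "mean c h w = integral (chart_image c) (\<lambda>x. h (chart_inv c x) * Lop c v x)"
      unfolding mean_def by (rule integral_cong) (simp add: Lw)
    moreover have "mean c h w = (mean c (\<lambda>p. \<bar>f p\<bar>) w + mean c f w) / 2"
    proof -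
      have hf: "h p = (\<bar>f p\<bar> + f p) / 2" for p by (auto simp: h_def)
      have "mean c h w = integral (chart_image c) (\<lambda>y. (\<bar>f (chart_inv c y)\<bar> * Lop c (\<lambda>y. w (chart_inv c y)) y +
          f (chart_inv c y) * Lop c (\<lambda>y. w (chart_inv c y)) y) * (1 / 2))"
        unfolding mean_def hf by (rule integral_cong) (simp add: field_simps)
      also have "\<dots> = integral (chart_image c) (\<lambda>y. \<bar>f (chart_inv c y)\<bar> * Lop c (\<lambda>y. w (chart_inv c y)) y +
          f (chart_inv c y) * Lop c (\<lambda>y. w (chart_inv c y)) y) * (1 / 2)"
        by (rule integral_mult_left)
      also have "\<dots> = (mean c (\<lambda>p. \<bar>f p\<bar>) w + mean c f w) / 2"
        unfolding mean_def using wK mean_integrable[OF c w fc KM] mean_integrable[OF c w continuous_on_rabs[OF fc] KM]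
        by (subst integral_add) auto
      finally show ?thesis .
    qed
    ultimately show False
      using v(6) mean_abs_solution[OF f c w w0 KM wK] mean_solution[OF f c w KM wK] by simp
  qed
qed

lemma solution_nonneg_zero:
  assumes f: "solution f" and nonneg: "\<And>x. 0 \<le> f x" and zero: "f q = 0"
  shows "f x = 0"
proof (rule ccontr)
  assume "f x \<noteq> 0"
  have C: "C2M f" using f by (simp add: solution_def)
  have cl: "closed {x. f x = 0}" by (intro closed_Collect_eq continuous_on_const C2M_continuous[OF C])
  have ne: "{x. f x = 0} \<noteq> {}" "{x. f x = 0} \<noteq> UNIV" using zero \<open>f x \<noteq> 0\<close> by auto
  obtain c y r R0 p where b: "c \<in> A" "0 < r" "r < R0" "cball y R0 \<subseteq> chart_image c" "dist y p = r"
    "chart_inv c p \<in> {x. f x = 0}" "\<And>z. dist y z < r \<Longrightarrow> chart_inv c z \<notin> {x. f x = 0}"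
    by (rule touching_ball[OF cl ne]) blast
  show False
  proof (rule elliptic.strong_Hopf[OF elliptic_chart[OF b(1)] C2MD[OF C b(1)]])
    show "Pop c (\<lambda>y. f (chart_inv c y)) z = 0" if "z \<in> chart_image c" for z
      using f b(1) that by (simp add: solution_def)
    show "cball y r \<subseteq> chart_image c" using b(3,4) subset_cball[of r R0 y] by simp
    show "0 < f (chart_inv c z)" if "dist y z < r" for z
      using b(7)[OF that] nonneg[of "chart_inv c z"] by simp
  qed (use b nonneg in auto)
qed

lemma solution_constant_sign:
  assumes f: "solution f" shows "constant_sign f"
proof -
  have m: "solution (\<lambda>x. - f x)"
  proof -
    have "solution (\<lambda>x. 0)"
      using solution_linear[OF f f, of "-1"] by simp
    from solution_linear[OF this f, of "-1"] show ?thesis by simp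
  qed
  have "(\<forall>x. 0 \<le> f x) \<or> (\<forall>x. 0 \<le> - f x)"
    using solution_no_sign_change[OF f] by (metis neg_0_le_iff_le not_le)
  then show ?thesis
  proof
    assume "\<forall>x. 0 \<le> f x"
    then show ?thesis using solution_nonneg_zero[OF f] unfolding constant_sign_def by (metis order_le_less)
  next
    assume "\<forall>x. 0 \<le> - f x"
    then show ?thesis using solution_nonneg_zero[OF m] unfolding constant_sign_def by (metis neg_0_less_iff_less neg_equal_0_iff_equal order_le_less neg_less_0_iff_less)
  qed
qed

end

section \<open>From equations between forms to solutions of the scalar equation\<close>

lemma C_k_on_delbar:
  fixes \<alpha> :: "'n::finite local_form"
  assumes S: "open S" and \<alpha>: "\<And>w. C_k_on (Suc r) S (\<lambda>y. \<alpha> y w)"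
  shows "C_k_on r S (\<lambda>y. delbar m \<alpha> y w)"
  unfolding delbar_def antilinear_part_def coeff_differential_def dder_def[symmetric] divide_inverse
  by (intro C_k_on_sum C_k_on_mult C_k_on_add C_k_on_const S C_k_on_dder[OF \<alpha>])

lemma dder_cmult_complex:
  fixes g :: "'a::euclidean_space \<Rightarrow> complex"
  assumes "C_k_on (Suc r) S g" "open S" "x \<in> S"
  shows "dder (\<lambda>y. c * g y) u x = c * dder g u x"
  by (rule dder_eq) (intro has_derivative_mult_right C_k_on_imp_has_derivative[OF assms])

lemma del_delbar_cmult:
  fixes \<alpha> \<alpha>' :: "'n::finite local_form"
  assumes S: "open S" "x \<in> S" and \<alpha>: "\<And>w. C_k_on (Suc (Suc 0)) S (\<lambda>y. \<alpha> y w)" and \<alpha>': "\<And>y w. y \<in> S \<Longrightarrow> \<alpha>' y w = c * \<alpha> y w"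
  shows "del (Suc m) (delbar m \<alpha>') x v = c * del (Suc m) (delbar m \<alpha>) x v"
proof -
  have 1: "delbar m \<alpha>' y w = c * delbar m \<alpha> y w" if y: "y \<in> S" for y w
  proof -
    have "coeff_differential \<alpha>' y w u = c * coeff_differential \<alpha> y w u" for w u
    proof -
      have "dder (\<lambda>y. \<alpha>' y w) u y = dder (\<lambda>y. c * \<alpha> y w) u y" by (rule dder_cong[OF S(1) y]) (rule \<alpha>')
      then show ?thesis using dder_cmult_complex[OF \<alpha> S(1) y] by (simp add: coeff_differential_def dder_def)
    qed
    then show ?thesis by (simp add: delbar_def antilinear_part_def sum_distrib_left algebra_simps)
  qed
  have "coeff_differential (delbar m \<alpha>') x w u = c * coeff_differential (delbar m \<alpha>) x w u" for w u
  proof -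
    have "dder (\<lambda>y. delbar m \<alpha>' y w) u x = dder (\<lambda>y. c * delbar m \<alpha> y w) u x" by (rule dder_cong[OF S]) (rule 1)
    then show ?thesis using dder_cmult_complex[OF C_k_on_delbar[OF S(1) \<alpha>] S] by (simp add: coeff_differential_def dder_def)
  qed
  then show ?thesis by (simp only: del_def linear_part_def sum_distrib_left) (simp add: algebra_simps)
qed

context hermitian_manifold
begin

text \<open>The form \<alpha> is left open to cover both \<open>f\<close> times the power of
  \<omega> and, with the constant function 1, that power itself, as in the Gauduchon
  condition.\<close>

lemma vanishes_imp_solution:
  assumes f: "C2M f" and \<alpha>: "\<And>c y w. c \<in> A \<Longrightarrow> y \<in> chart_image c \<Longrightarrow> \<alpha> c y w = of_real (f (chart_inv c y) * \<beta> c y w)"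
    and z: "vanishes A (del_delbar_form (2 * k) \<alpha>)"
  shows "solution f"
  unfolding solution_def
proof (intro conjI f ballI)
  fix c y assume c: "c \<in> A" and y: "y \<in> chart_image c"
  have g: "C_k_on (Suc (Suc 0)) (chart_image c) (\<lambda>y. f (chart_inv c y) * \<beta> c y w)" for w
    by (intro C_k_on_mult C2MD[OF f c] \<beta>_smooth c chart)
  have "0 = Im (del (Suc (2 * k)) (delbar (2 * k) (\<alpha> c)) y v0)"
    using z c y by (simp add: vanishes_def del_delbar_form_def)
  also have "\<dots> = - (1 / 4) * Pop c (\<lambda>y. f (chart_inv c y)) y"
    unfolding Pop_eq[OF c C2MD[OF f c] y]
    by (rule Im_del_delbar[OF chart(2)[OF c] y g]) (rule \<alpha>[OF c])
  finally show "Pop c (\<lambda>y. f (chart_inv c y)) y = 0" by simp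
qed

lemma scale_form_power:
  "c \<in> A \<Longrightarrow> y \<in> chart_image c \<Longrightarrow> scale_form f (form_power \<omega> k) c y w = of_real (f (chart_inv c y) * \<beta> c y w)"
  by (simp add: scale_form_def form_power_def wedge_power_eq_\<beta>)

lemma del_delbar_vanishes_solution:
  assumes "C2M f" "vanishes A (del_delbar_form (2 * k) (scale_form f (form_power \<omega> k)))"
  shows "solution f"
  using vanishes_imp_solution[OF assms(1) scale_form_power assms(2)] .

lemma gauduchon_solution:
  assumes "gauduchon_metric A \<omega>" shows "solution (\<lambda>x. 1)"
proof (rule vanishes_imp_solution[OF C2M_const])
  show "vanishes A (del_delbar_form (2 * k) (form_power \<omega> k))"
    using assms by (simp add: gauduchon_metric_def card_n)
  show "form_power \<omega> k c y w = of_real (1 * \<beta> c y w)" if "c \<in> A" "y \<in> chart_image c" for c y w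
    using wedge_power_eq_\<beta>[OF that] by (simp add: form_power_def)
qed

lemma solution_gauduchon_constant:
  assumes f: "solution f" and G: "gauduchon_metric A \<omega>"
  shows "\<exists>a. \<forall>x. f x = a"
proof -
  have C: "continuous_on UNIV f" using f C2M_continuous by (auto simp: solution_def)
  \<comment> \<open>The value to subtract is the minimum: the difference is then a nonnegative
    solution with a zero.\<close>
  obtain q where q: "\<And>x. f q \<le> f x"
    using continuous_attains_inf[OF compact_M _ C] by auto
  have "solution (\<lambda>x. f x + (- f q) * 1)" by (rule solution_linear[OF f gauduchon_solution[OF G]])
  then have "f x + (- f q) * 1 = 0" for x
    by (rule solution_nonneg_zero[where q=q]) (use q in auto)
  then show ?thesis by (intro exI[of _ "f q"]) simp
qed

lemma constant_gauduchon:
  assumes a: "a \<noteq> 0" "\<And>x. f x = a" and z: "vanishes A (del_delbar_form (2 * k) (scale_form f (form_power \<omega> k)))"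
  shows "gauduchon_metric A \<omega>"
proof -
  have "del (Suc (2 * k)) (delbar (2 * k) (form_power \<omega> k c)) x v = 0"
    if c: "c \<in> A" and x: "x \<in> chart_image c" for c x v
  proof -
    have "del (Suc (2 * k)) (delbar (2 * k) (scale_form f (form_power \<omega> k) c)) x v =
       of_real a * del (Suc (2 * k)) (delbar (2 * k) (form_power \<omega> k c)) x v"
    proof (rule del_delbar_cmult[OF chart(2)[OF c] x])
      show "C_k_on (Suc (Suc 0)) (chart_image c) (\<lambda>y. form_power \<omega> k c y w)" for w
        unfolding form_power_def by (intro C_k_on_wedge_power chart(2)[OF c] metric_facts(3)[OF c])
    qed (simp add: scale_form_def a(2))
    then show ?thesis using z c x a(1) by (simp add: vanishes_def del_delbar_form_def)
  qed
  then show ?thesis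
    using metric by (simp add: gauduchon_metric_def card_n vanishes_def del_delbar_form_def)
qed

end

section \<open>Closed conformal multiples of a Hermitian metric\<close>

text \<open>The function \<open>(\<phi> t)\<^sup>2 * exp (- 2 * C * t)\<close> is nonincreasing and
  starts at 0.\<close>

lemma Gronwall_zero:
  fixes \<phi> :: "real \<Rightarrow> real"
  assumes \<phi>: "\<And>t. 0 \<le> t \<Longrightarrow> t \<le> 1 \<Longrightarrow> (\<phi> has_real_derivative \<phi>' t) (at t)"
    "\<And>t. 0 \<le> t \<Longrightarrow> t \<le> 1 \<Longrightarrow> \<bar>\<phi>' t\<bar> \<le> C * \<bar>\<phi> t\<bar>" and zero: "\<phi> 0 = 0"
  shows "\<phi> 1 = 0"
proof -
  let ?g = "\<lambda>t. (\<phi> t)\<^sup>2 * exp (- 2 * C * t)"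
  have "?g 1 \<le> ?g 0"
  proof (rule DERIV_nonpos_imp_nonincreasing[of 0 1])
    fix t :: real assume t: "0 \<le> t" "t \<le> 1"
    have "(?g has_real_derivative (2 * (\<phi> t * \<phi>' t) - 2 * C * (\<phi> t)\<^sup>2) * exp (- 2 * C * t)) (at t)"
      by (auto intro!: derivative_eq_intros \<phi>(1)[OF t] simp: algebra_simps power2_eq_square)
    moreover have "\<phi> t * \<phi>' t \<le> C * (\<phi> t)\<^sup>2"
    proof -
      have "\<phi> t * \<phi>' t \<le> \<bar>\<phi> t\<bar> * \<bar>\<phi>' t\<bar>" by (metis abs_ge_self abs_mult)
      also have "\<dots> \<le> \<bar>\<phi> t\<bar> * (C * \<bar>\<phi> t\<bar>)" by (intro mult_left_mono \<phi>(2)[OF t]) simp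
      also have "\<dots> = C * (\<phi> t)\<^sup>2" by (simp add: power2_eq_square)
      finally show ?thesis .
    qed
    then have "(2 * (\<phi> t * \<phi>' t) - 2 * C * (\<phi> t)\<^sup>2) * exp (- 2 * C * t) \<le> 0"
      by (intro mult_nonpos_nonneg) auto
    ultimately show "\<exists>y. (?g has_real_derivative y) (at t) \<and> y \<le> 0" by blast
  qed simp
  then have "(\<phi> 1)\<^sup>2 \<le> 0" using zero by (simp add: mult_le_0_iff)
  then show ?thesis by simp
qed

lemma zero_near_zero:
  fixes F :: "'a::euclidean_space \<Rightarrow> real"
  assumes F: "C_k_on (Suc 0) S F" "open S" and r: "ball x0 r \<subseteq> S"
    and bound: "\<And>x u. x \<in> ball x0 r \<Longrightarrow> \<bar>dder F u x\<bar> \<le> C * norm u * \<bar>F x\<bar>" and zero: "F x0 = 0" and x: "x \<in> ball x0 r"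
  shows "F x = 0"
proof -
  let ?\<gamma> = "\<lambda>t. x0 + t *\<^sub>R (x - x0)"
  have \<gamma>: "?\<gamma> t \<in> ball x0 r" if "0 \<le> t" "t \<le> 1" for t
  proof -
    have "\<bar>t\<bar> * norm (x - x0) \<le> 1 * norm (x - x0)" using that by (intro mult_right_mono) auto
    then show ?thesis using x by (simp add: dist_norm norm_minus_commute)
  qed
  have "F (?\<gamma> 1) = 0"
  proof (rule Gronwall_zero[where \<phi>="\<lambda>t. F (?\<gamma> t)" and \<phi>'="\<lambda>t. dder F (x - x0) (?\<gamma> t)" and C="C * norm (x - x0)"])
    fix t :: real assume t: "0 \<le> t" "t \<le> 1"
    have S: "?\<gamma> t \<in> S" using \<gamma>[OF t] r by auto
    have "(?\<gamma> has_derivative (\<lambda>h. h *\<^sub>R (x - x0))) (at t)" by (auto intro!: derivative_eq_intros)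
    from has_derivative_compose[OF this C_k_on_imp_has_derivative[OF F S]]
    show "((\<lambda>t. F (?\<gamma> t)) has_real_derivative dder F (x - x0) (?\<gamma> t)) (at t)"
      unfolding has_field_derivative_def
      by (rule has_derivative_eq_rhs) (simp add: linear_scale[OF dder_linear[OF F S]] fun_eq_iff)
    show "\<bar>dder F (x - x0) (?\<gamma> t)\<bar> \<le> C * norm (x - x0) * \<bar>F (?\<gamma> t)\<bar>" by (rule bound[OF \<gamma>[OF t]])
  qed (simp add: zero)
  then show ?thesis by simp
qed

lemma positive_11_form_orthogonal_vector:
  fixes \<eta> :: "'n::finite multiform" and s :: "complex^'n"
  assumes \<eta>: "positive_11_form \<eta>" and n: "CARD('n) \<ge> 2" and s: "s \<noteq> 0"
  obtains w where "\<eta> (pair s w) = 0" "\<eta> (pair s (J w)) = 0" "0 < Re (\<eta> (pair w (J w)))"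
proof (rule positive_11_form_herm[OF \<eta>])
  fix H assume H: "\<And>a b. herm H b a = cnj (herm H a b)" "\<And>u. u \<noteq> 0 \<Longrightarrow> 0 < Re (herm H u u)"
    "\<And>v. \<eta> v = of_real (- 2 * Im (herm H (v 0) (v 1)))"
  obtain i where i: "s $ i \<noteq> 0" using s by (auto simp: vec_eq_iff)
  obtain j where j: "j \<noteq> i" using n by (metis card_2_iff' ex_card[of 2 "UNIV::'n set"])
  define w' :: "complex^'n" where "w' = axis j 1"
  \<comment> \<open>The component of a coordinate vector orthogonal to \<open>s\<close>, multiplied
    by \<open>herm H s s\<close> to avoid a division. It is nonzero: if coordinate \<open>i\<close>
    of \<open>w\<close> vanishes, so does the coefficient of \<open>s\<close>, and then coordinate
    \<open>j\<close> is \<open>herm H s s\<close>. A coordinate \<open>j\<close> other than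
    \<open>i\<close> exists because the dimension is at least 2.\<close>
  define w where "w = herm H s s *s w' + (- herm H w' s) *s s"
  have ss: "herm H s s \<noteq> 0" using H(2)[OF s] by auto
  have "herm H w s = 0" by (simp only: w_def herm_add_left herm_scale_left) simp
  then have sw: "herm H s w = 0" using H(1)[of s w] by simp
  have "w \<noteq> 0"
  proof
    assume "w = 0"
    then have "w $ i = 0" "w $ j = 0" by auto
    then show False using i j ss by (auto simp: w_def w'_def axis_def)
  qed
  show thesis
  proof (rule that[of w])
    show "\<eta> (pair s w) = 0" "\<eta> (pair s (J w)) = 0"
      by (simp_all add: H(3) pair_def J_def herm_scale_right sw)
    show "0 < Re (\<eta> (pair w (J w)))" using H(2)[OF \<open>w \<noteq> 0\<close>] by (simp add: H(3) pair_def J_def herm_scale_right)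
  qed
qed

text \<open>The Leibniz rule for d(F \<Omega>) = 0 on three vectors; real coefficients turn it into
  an identity between real numbers.\<close>

lemma ext_d_scaled_2_form:
  fixes \<Omega> :: "complex^'n::finite \<Rightarrow> complex^'n \<Rightarrow> complex^'n \<Rightarrow> real"
  assumes S: "open S" "x \<in> S" and F: "C_k_on (Suc 0) S F" and \<Omega>: "\<And>a b. C_k_on (Suc 0) S (\<lambda>y. \<Omega> y a b)"
    and \<alpha>: "\<And>y w. y \<in> S \<Longrightarrow> \<alpha> y w = of_real (F y * \<Omega> y (w 0) (w 1))"
    and z: "\<And>v. ext_d 2 \<alpha> x v = 0"
  shows "dder F a x * \<Omega> x b c - dder F b x * \<Omega> x a c + dder F c x * \<Omega> x a b =
    - F x * (dder (\<lambda>y. \<Omega> y b c) a x - dder (\<lambda>y. \<Omega> y a c) b x + dder (\<lambda>y. \<Omega> y a b) c x)"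
proof -
  define v :: "nat \<Rightarrow> complex^'n" where "v = (\<lambda>i. if i = 0 then a else if i = 1 then b else c)"
  have d: "coeff_differential \<alpha> x w u = of_real (F x * dder (\<lambda>y. \<Omega> y (w 0) (w 1)) u x + dder F u x * \<Omega> x (w 0) (w 1))" for w u
  proof -
    have "coeff_differential \<alpha> x w u = dder (\<lambda>y. \<alpha> y w) u x" by (simp add: coeff_differential_def dder_def)
    also have "\<dots> = dder (\<lambda>y. of_real (F y * \<Omega> y (w 0) (w 1))) u x" by (rule dder_cong[OF S]) (rule \<alpha>)
    also have "\<dots> = of_real (dder (\<lambda>y. F y * \<Omega> y (w 0) (w 1)) u x)"
      by (rule dder_of_real(2)[OF C_k_on_mult[OF S(1) F \<Omega>] S])
    finally show ?thesis by (simp only: dder_mult[OF S F \<Omega>])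
  qed
  have "(\<Sum>i\<le>2. (-1) ^ i * G i) = G 0 - G 1 + G 2" for G :: "nat \<Rightarrow> complex"
    by (simp add: numeral_2_eq_2)
  then have "0 = complex_of_real ((F x * dder (\<lambda>y. \<Omega> y b c) a x + dder F a x * \<Omega> x b c) -
      (F x * dder (\<lambda>y. \<Omega> y a c) b x + dder F b x * \<Omega> x a c) + (F x * dder (\<lambda>y. \<Omega> y a b) c x + dder F c x * \<Omega> x a b))"
    using z[of v] by (simp add: ext_d_def d omit_def v_def)
  then have "0 = (F x * dder (\<lambda>y. \<Omega> y b c) a x + dder F a x * \<Omega> x b c) -
      (F x * dder (\<lambda>y. \<Omega> y a c) b x + dder F b x * \<Omega> x a c) + (F x * dder (\<lambda>y. \<Omega> y a b) c x + dder F c x * \<Omega> x a b)"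
    by (rule of_real_eq_iff[THEN iffD1, OF trans[OF of_real_0]])
  then show ?thesis by (simp add: algebra_simps)
qed

lemma abs_dder_le:
  fixes F :: "'a::euclidean_space \<Rightarrow> real"
  assumes "(F has_derivative (\<lambda>u. dder F u x)) (at x)"
  shows "\<bar>dder F u x\<bar> \<le> norm u * (\<Sum>b\<in>Basis. \<bar>dder F b x\<bar>)"
proof -
  have "\<bar>dder F u x\<bar> \<le> (\<Sum>b\<in>Basis. \<bar>(u \<bullet> b) * dder F b x\<bar>)"
    by (subst has_derivative_euclidean_sum[OF assms]) (simp only: real_scaleR_def sum_abs)
  also have "\<dots> \<le> (\<Sum>b\<in>Basis. norm u * \<bar>dder F b x\<bar>)"
    unfolding abs_mult by (intro sum_mono mult_right_mono Basis_le_norm) auto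
  finally show ?thesis by (simp add: sum_distrib_left)
qed

lemma positive_11_form_scale:
  assumes "positive_11_form \<eta>" "0 < r"
  shows "positive_11_form (\<lambda>v. of_real r * \<eta> v)"
proof -
  obtain h :: "complex^'a^'a" where h: "\<And>j k. h $ k $ j = cnj (h $ j $ k)"
    "\<And>u. u \<noteq> 0 \<Longrightarrow> 0 < Re (\<Sum>j\<in>UNIV. \<Sum>k\<in>UNIV. h $ j $ k * (u $ j) * cnj (u $ k))"
    "\<eta> = (\<lambda>v. \<i> * (\<Sum>j\<in>UNIV. \<Sum>k\<in>UNIV. h $ j $ k * wedge 1 1 (dz j) (dzbar k) v))"
    using assms(1) unfolding positive_11_form_def by blast
  show ?thesis
    unfolding positive_11_form_def
  proof (intro exI[of _ "\<chi> j k. of_real r * h $ j $ k"] conjI allI impI)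
    fix j k show "(\<chi> j k. of_real r * h $ j $ k) $ k $ j = cnj ((\<chi> j k. of_real r * h $ j $ k) $ j $ k)"
      using h(1)[of k j] by simp
  next
    fix u :: "complex^'a" assume "u \<noteq> 0"
    have "(\<Sum>j\<in>UNIV. \<Sum>k\<in>UNIV. (\<chi> j k. of_real r * h $ j $ k) $ j $ k * (u $ j) * cnj (u $ k)) =
       of_real r * (\<Sum>j\<in>UNIV. \<Sum>k\<in>UNIV. h $ j $ k * (u $ j) * cnj (u $ k))"
      by (simp add: sum_distrib_left mult.assoc)
    then show "0 < Re (\<Sum>j\<in>UNIV. \<Sum>k\<in>UNIV. (\<chi> j k. of_real r * h $ j $ k) $ j $ k * (u $ j) * cnj (u $ k))"
      using h(2)[OF \<open>u \<noteq> 0\<close>] assms(2) by simp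
  next
    show "(\<lambda>v. of_real r * \<eta> v) = (\<lambda>v. \<i> * (\<Sum>j\<in>UNIV. \<Sum>k\<in>UNIV. (\<chi> j k. of_real r * h $ j $ k) $ j $ k * wedge 1 1 (dz j) (dzbar k) v))"
      unfolding h(3) by (simp add: sum_distrib_left mult_ac)
  qed
qed

context hermitian_manifold
begin

text \<open>For \<open>n \<ge> 2\<close> the map \<open>\<xi> \<mapsto> \<xi> \<and> \<omega>\<close> is injective on 1-forms, so \<open>df \<and> \<omega> = - f d\<omega>\<close> bounds \<open>df\<close> by \<open>f\<close>.\<close>

lemma conformal_closed_zero_open:
  assumes n: "CARD('n) \<ge> 2" and f: "C2M f" and z: "vanishes A (d_form 2 (scale_form f \<omega>))" and p0: "f p0 = 0"
  shows "\<exists>T. open T \<and> p0 \<in> T \<and> T \<subseteq> {x. f x = 0}"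
proof -
  obtain c where c: "c \<in> A" "p0 \<in> fst c" by (rule chart_cover)
  define S where "S = chart_image c"
  define F where "F y = f (chart_inv c y)" for y
  define x0 where "x0 = snd c p0"
  define \<Omega> where "\<Omega> y a b = Re (\<omega> c y (pair a b))" for y a b
  have S: "open S" "x0 \<in> S" using chart(2) chart_facts(2) c by (auto simp: S_def x0_def)
  have F0: "F x0 = 0" using chart_facts(1) c p0 by (simp add: F_def x0_def)
  have F: "C_k_on (Suc 0) S F" unfolding S_def F_def[abs_def] by (rule C_k_on_lower[OF C2MD[OF f c(1)]])
  have \<Omega>: "C_k_on r S (\<lambda>y. \<Omega> y a b)" for r a b
    unfolding S_def \<Omega>_def by (intro C_k_on_linear[OF bounded_linear_Re] chart(2) metric_facts(3) c)
  have \<Omega>c: "continuous_on S (\<lambda>y. \<Omega> y a b)" for a b by (rule C_k_on_imp_continuous[OF \<Omega>[of 0]])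
  have \<omega>: "\<omega> c y w = of_real (\<Omega> y (w 0) (w 1))" if "y \<in> S" for y w
    using alt_form_pair[OF metric_facts(1)[OF c(1)], of y w] metric_real[OF c(1), of y] that
    unfolding \<Omega>_def S_def by (metis of_real_Re)
  have id: "dder F a x * \<Omega> x b d - dder F b x * \<Omega> x a d + dder F d x * \<Omega> x a b =
    - F x * (dder (\<lambda>y. \<Omega> y b d) a x - dder (\<lambda>y. \<Omega> y a d) b x + dder (\<lambda>y. \<Omega> y a b) d x)" if x: "x \<in> S" for x a b d
  proof (rule ext_d_scaled_2_form[OF S(1) x F \<Omega>, where \<alpha>="scale_form f \<omega> c"])
    show "scale_form f \<omega> c y w = of_real (F y * \<Omega> y (w 0) (w 1))" if "y \<in> S" for y w
      using \<omega>[OF that] by (simp add: scale_form_def F_def)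
    show "ext_d 2 (scale_form f \<omega> c) x v = 0" for v
      using z c(1) x by (simp add: vanishes_def d_form_def S_def)
  qed
  \<comment> \<open>On the triple \<open>s\<close>, \<open>w\<close>, \<open>J w\<close> the
    identity at \<open>x0\<close> loses two of its three terms with derivatives of \<open>F\<close>
    and determines the derivative in direction \<open>s\<close> alone.\<close>
  have "\<exists>w. \<Omega> x0 s w = 0 \<and> \<Omega> x0 s (J w) = 0 \<and> 0 < \<Omega> x0 w (J w)" if "s \<in> Basis" for s
  proof (rule positive_11_form_orthogonal_vector[OF metric_facts(2)[OF c(1) S(2)[unfolded S_def]] n])
    show "s \<noteq> 0" using that by auto
    fix w assume "\<omega> c x0 (pair s w) = 0" "\<omega> c x0 (pair s (J w)) = 0" "0 < Re (\<omega> c x0 (pair w (J w)))"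
    then show "\<exists>w. \<Omega> x0 s w = 0 \<and> \<Omega> x0 s (J w) = 0 \<and> 0 < \<Omega> x0 w (J w)"
      by (intro exI[of _ w]) (simp add: \<Omega>_def)
  qed
  then obtain w where w: "\<And>s. s \<in> Basis \<Longrightarrow> \<Omega> x0 s (w s) = 0" "\<And>s. s \<in> Basis \<Longrightarrow> \<Omega> x0 s (J (w s)) = 0"
    "\<And>s. s \<in> Basis \<Longrightarrow> 0 < \<Omega> x0 (w s) (J (w s))"
    by metis
  define N where "N = real (card (Basis :: (complex^'n) set))"
  have N: "0 < N" by (simp add: N_def card_gt_0_iff)
  define \<kappa> where "\<kappa> s x = dder (\<lambda>y. \<Omega> y (w s) (J (w s))) s x - dder (\<lambda>y. \<Omega> y s (J (w s))) (w s) x + dder (\<lambda>y. \<Omega> y s (w s)) (J (w s)) x" for s x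
  define P where "P s x = \<Omega> x (w s) (J (w s))" for s x
  \<comment> \<open>Away from \<open>x0\<close> the two other terms reappear, and
    \<open>\<theta> s\<close> bounds their coefficients. It vanishes at \<open>x0\<close>, so near
    \<open>x0\<close> it is below \<open>P s x / (2 * N)\<close>, where \<open>N\<close> is the
    number of real basis vectors.\<close>
  define \<theta> where "\<theta> s x = \<bar>\<Omega> x s (J (w s))\<bar> * norm (w s) + \<bar>\<Omega> x s (w s)\<bar> * norm (J (w s))" for s x
  have Pc: "continuous_on S (P s)" and \<theta>c: "continuous_on S (\<theta> s)" and \<kappa>c: "continuous_on S (\<kappa> s)" for s
    unfolding P_def[abs_def] \<theta>_def[abs_def] \<kappa>_def[abs_def]
    by (intro continuous_intros \<Omega>c C_k_on_imp_continuous[OF C_k_on_dder[OF \<Omega>[of "Suc 0"]]])+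
  have Gc: "continuous_on S (\<lambda>x. P s x / (2 * N) - \<theta> s x)" for s
    using N by (intro continuous_intros Pc \<theta>c) auto
  have "open (\<Inter>s\<in>Basis. S \<inter> (\<lambda>x. P s x / (2 * N) - \<theta> s x) -` {0<..})"
    by (intro open_INT ballI continuous_open_preimage[OF Gc S(1)]) auto
  moreover have "x0 \<in> (\<Inter>s\<in>Basis. S \<inter> (\<lambda>x. P s x / (2 * N) - \<theta> s x) -` {0<..})"
    using w N S(2) by (simp add: P_def \<theta>_def)
  ultimately obtain r where r: "0 < r" "cball x0 r \<subseteq> (\<Inter>s\<in>Basis. S \<inter> (\<lambda>x. P s x / (2 * N) - \<theta> s x) -` {0<..})"
    by (meson open_contains_cball)
  have rS: "cball x0 r \<subseteq> S" using r(2) SOME_Basis by fast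
  have \<theta>P: "\<theta> s x < P s x / (2 * N)" if "x \<in> cball x0 r" "s \<in> Basis" for s x
    using subsetD[OF r(2) that(1)] that(2) by simp
  have P_pos: "0 < P s x" if "x \<in> cball x0 r" "s \<in> Basis" for s x
  proof -
    have "0 \<le> \<theta> s x" by (simp add: \<theta>_def)
    then have "0 < P s x / (2 * N)" using \<theta>P[OF that] by linarith
    then show ?thesis using N by (simp add: zero_less_divide_iff)
  qed
  have "continuous_on (cball x0 r) (\<lambda>x. \<Sum>s\<in>Basis. \<bar>\<kappa> s x\<bar> / P s x)"
    using P_pos by (intro continuous_intros continuous_on_subset[OF \<kappa>c rS] continuous_on_subset[OF Pc rS]) (auto simp: less_imp_neq[symmetric])
  then obtain C where C: "\<And>x. x \<in> cball x0 r \<Longrightarrow> \<bar>\<Sum>s\<in>Basis. \<bar>\<kappa> s x\<bar> / P s x\<bar> \<le> C"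
    by (rule compact_continuous_abs_le[OF compact_cball]) blast
  define m where "m x = (\<Sum>s\<in>Basis. \<bar>dder F s x\<bar>)" for x
  have m0: "0 \<le> m x" for x by (simp add: m_def sum_nonneg)
  have Fu: "\<bar>dder F u x\<bar> \<le> norm u * m x" if "x \<in> S" for u x
    unfolding m_def by (rule abs_dder_le[OF C_k_on_imp_has_derivative[OF F S(1) that]])
  \<comment> \<open>Summed over the \<open>N\<close> basis vectors, the error terms amount to at
    most half of \<open>m x\<close> and are absorbed on the left.\<close>
  have m: "m x \<le> 2 * C * \<bar>F x\<bar>" if x: "x \<in> cball x0 r" for x
  proof -
    have xS: "x \<in> S" using x rS by auto
    have "\<bar>dder F s x\<bar> \<le> m x / (2 * N) + \<bar>F x\<bar> * (\<bar>\<kappa> s x\<bar> / P s x)" if s: "s \<in> Basis" for s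
    proof -
      let ?w = "w s"
      have "dder F s x * P s x = dder F ?w x * \<Omega> x s (J ?w) - dder F (J ?w) x * \<Omega> x s ?w - F x * \<kappa> s x"
        using id[OF xS, of s ?w "J ?w"] by (simp add: P_def \<kappa>_def algebra_simps)
      then have "\<bar>dder F s x\<bar> * P s x \<le> \<bar>dder F ?w x\<bar> * \<bar>\<Omega> x s (J ?w)\<bar> + \<bar>dder F (J ?w) x\<bar> * \<bar>\<Omega> x s ?w\<bar> + \<bar>F x\<bar> * \<bar>\<kappa> s x\<bar>"
        using P_pos[OF x s] by (simp add: abs_mult[symmetric])
      also have "\<dots> \<le> (norm ?w * m x) * \<bar>\<Omega> x s (J ?w)\<bar> + (norm (J ?w) * m x) * \<bar>\<Omega> x s ?w\<bar> + \<bar>F x\<bar> * \<bar>\<kappa> s x\<bar>"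
        by (intro add_mono mult_right_mono Fu xS) auto
      also have "\<dots> = m x * \<theta> s x + \<bar>F x\<bar> * \<bar>\<kappa> s x\<bar>" by (simp add: \<theta>_def algebra_simps)
      also have "\<dots> \<le> m x * (P s x / (2 * N)) + \<bar>F x\<bar> * \<bar>\<kappa> s x\<bar>"
        by (intro add_right_mono mult_left_mono less_imp_le[OF \<theta>P[OF x s]] m0)
      also have "\<dots> = (m x / (2 * N) + \<bar>F x\<bar> * (\<bar>\<kappa> s x\<bar> / P s x)) * P s x"
        using P_pos[OF x s] by (simp add: field_simps)
      finally show ?thesis using P_pos[OF x s] by simp
    qed
    then have "m x \<le> (\<Sum>s\<in>(Basis :: (complex^'n) set). m x / (2 * N) + \<bar>F x\<bar> * (\<bar>\<kappa> s x\<bar> / P s x))"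
      unfolding m_def[of x] by (intro sum_mono) (simp add: m_def)
    also have "\<dots> = m x / 2 + \<bar>F x\<bar> * (\<Sum>s\<in>Basis. \<bar>\<kappa> s x\<bar> / P s x)"
      using N by (simp add: sum.distrib sum_distrib_left N_def)
    also have "\<dots> \<le> m x / 2 + \<bar>F x\<bar> * C"
      using C[OF x] by (intro add_left_mono mult_left_mono) auto
    finally show ?thesis by (simp add: algebra_simps)
  qed
  have Fz: "F x = 0" if x: "x \<in> ball x0 r" for x
  proof (rule zero_near_zero[OF F S(1) _ _ F0 x])
    show "ball x0 r \<subseteq> S" using rS ball_subset_cball by blast
    fix x u assume "x \<in> ball x0 r"
    then have x: "x \<in> cball x0 r" "x \<in> S" using rS by auto
    have "\<bar>dder F u x\<bar> \<le> norm u * (2 * C * \<bar>F x\<bar>)"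
      by (rule order_trans[OF Fu[OF x(2)] mult_left_mono[OF m[OF x(1)] norm_ge_zero]])
    then show "\<bar>dder F u x\<bar> \<le> (2 * C) * norm u * \<bar>F x\<bar>" by (simp add: mult_ac)
  qed
  have "open (chart_inv c ` ball x0 r)"
    using rS ball_subset_cball by (intro open_image_chart_inv c) (auto simp: S_def)
  moreover have "p0 \<in> chart_inv c ` ball x0 r"
    using r(1) chart_facts(1)[OF c] by (intro image_eqI[of _ _ x0]) (auto simp: x0_def)
  moreover have "chart_inv c ` ball x0 r \<subseteq> {x. f x = 0}" using Fz by (auto simp: F_def)
  ultimately show ?thesis by blast
qed

text \<open>Connectedness is used twice: for the zero set and, if this is empty, for the set where
  \<open>f\<close> is positive, which is then also the closed set where it is nonnegative.\<close>

lemma conformal_closed_constant_sign: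
  assumes n: "CARD('n) \<ge> 2" and f: "C2M f" and z: "vanishes A (d_form 2 (scale_form f \<omega>))"
  shows "constant_sign f"
proof -
  note fc = C2M_continuous[OF f]
  have clopen: "T = {} \<or> T = UNIV" if "open T" "closed T" for T :: "'m set"
    using connected_M that unfolding connected_clopen by auto
  have "open {x. f x = 0}"
    unfolding open_subopen[of "{x. f x = 0}"] using conformal_closed_zero_open[OF n f z] by blast
  moreover have "closed {x. f x = 0}" by (intro closed_Collect_eq continuous_on_const fc)
  ultimately consider "{x. f x = 0} = UNIV" | "{x. f x = 0} = {}" using clopen by blast
  then show ?thesis
  proof cases
    case 1 then show ?thesis unfolding constant_sign_def by blast
  next
    case 2
    then have "{x. 0 < f x} = {x. 0 \<le> f x}" by (auto simp: order_le_less)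
    moreover have "open {x. 0 < f x}" by (intro open_Collect_less continuous_on_const fc)
    moreover have "closed {x. 0 \<le> f x}" by (intro closed_Collect_le continuous_on_const fc)
    ultimately have "{x. 0 \<le> f x} = {} \<or> {x. 0 \<le> f x} = UNIV" using clopen by metis
    then show ?thesis using \<open>{x. 0 < f x} = {x. 0 \<le> f x}\<close> unfolding constant_sign_def by (auto simp: not_le)
  qed
qed

lemma kaehler_scale:
  assumes f: "smooth_function A f" and pos: "\<And>x. 0 < f x" and z: "vanishes A (d_form 2 (scale_form f \<omega>))"
  shows "kaehler_metric A (scale_form f \<omega>)"
  unfolding kaehler_metric_def hermitian_metric_def smooth_form_def
proof (intro conjI ballI allI z)
  fix c x assume c: "c \<in> A" and x: "x \<in> chart_image c"
  have "linear (\<lambda>y. of_real (f (chart_inv c x)) * y :: complex)"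
    by (rule bounded_linear.linear[OF bounded_linear_mult_right])
  from alt_form_compose_linear[OF this metric_facts(1)[OF c x]]
  show "alternating_form 2 (scale_form f \<omega> c x)" unfolding alternating_form_eq scale_form_def .
  show "positive_11_form (scale_form f \<omega> c x)"
    using positive_11_form_scale[OF metric_facts(2)[OF c x] pos] unfolding scale_form_def .
next
  fix c v assume c: "c \<in> A"
  show "smooth_on (chart_image c) (\<lambda>x. scale_form f \<omega> c x v)"
    unfolding smooth_on_def scale_form_def
  proof
    fix r
    have "C_k_on r (chart_image c) (\<lambda>y. f (chart_inv c y))"
      using f c by (simp add: smooth_function_def smooth_on_def o_def)
    then show "C_k_on r (chart_image c) (\<lambda>x. complex_of_real (f (chart_inv c x)) * \<omega> c x v)"
      by (intro C_k_on_mult chart(2)[OF c] metric_facts(3)[OF c] C_k_on_linear[OF bounded_linear_of_real])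
  qed
next
  fix c d x v assume c: "c \<in> A" "d \<in> A" and x: "x \<in> overlap c d"
  show "scale_form f \<omega> c x v = scale_form f \<omega> d (transition c d x) (\<lambda>i. frechet_derivative (transition c d) (at x) (v i))"
    unfolding scale_form_def transition(2)[OF c x] dder_def[symmetric] metric_facts(4)[OF c x] ..
qed

lemma conformal_closed_uminus:
  assumes f: "C2M f" and z: "vanishes A (d_form 2 (scale_form f \<omega>))"
  shows "vanishes A (d_form 2 (scale_form (\<lambda>x. - f x) \<omega>))"
  unfolding vanishes_def
proof (intro ballI allI)
  fix c x v assume c: "c \<in> A" and x: "x \<in> chart_image c"
  have C: "C_k_on (Suc 0) (chart_image c) (\<lambda>y. scale_form f \<omega> c y w)" for w
    unfolding scale_form_def using C_k_on_lower[OF C2MD[OF f c]]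
    by (intro C_k_on_mult chart(2)[OF c] metric_facts(3)[OF c] C_k_on_linear[OF bounded_linear_of_real])
  have "coeff_differential (scale_form (\<lambda>x. - f x) \<omega> c) x w u = - coeff_differential (scale_form f \<omega> c) x w u" for w u
    using dder_cmult_complex[OF C chart(2)[OF c] x, of "-1"]
    by (simp add: coeff_differential_def dder_def scale_form_def)
  then have "d_form 2 (scale_form (\<lambda>x. - f x) \<omega>) c x v = - d_form 2 (scale_form f \<omega>) c x v"
    by (simp add: d_form_def ext_d_def sum_negf)
  then show "d_form 2 (scale_form (\<lambda>x. - f x) \<omega>) c x v = 0" using z c x by (simp add: vanishes_def)
qed

end

theorem theorem1p7:
  fixes A :: "('m::t2_space, 'n::finite) chart set"
    and \<omega> :: "('m, 'n) form"
    and f :: "'m \<Rightarrow> real"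
  assumes "complex_atlas A"
    and "compact (UNIV :: 'm set)"
    and "connected (UNIV :: 'm set)"
    and "CARD('n) \<ge> 2"
    and "hermitian_metric A \<omega>"
    and "smooth_function A f"
  shows "(vanishes A (del_delbar_form (2 * (CARD('n) - 1))
                        (scale_form f (form_power \<omega> (CARD('n) - 1)))) \<longrightarrow>
            constant_sign f \<and>
            (\<not> (\<forall>x. f x = 0) \<longrightarrow> ((\<exists>a. \<forall>x. f x = a) \<longleftrightarrow> gauduchon_metric A \<omega>))) \<and>
         (vanishes A (d_form 2 (scale_form f \<omega>)) \<longrightarrow>
            constant_sign f \<and>
            ((\<forall>x. f x = 0) \<or> kaehler_metric A (scale_form f \<omega>) \<or>
             kaehler_metric A (scale_form (\<lambda>x. - f x) \<omega>)))"
proof -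
  define k where "k = CARD('n) - 1"
  have n: "CARD('n) = Suc k" using assms(4) by (simp add: k_def)
  obtain e :: "nat \<Rightarrow> 'n" where e: "bij_betw e {..<Suc k} UNIV"
    using ex_bij_betw_nat_finite[of "UNIV :: 'n set"] n by (auto simp: atLeast0LessThan)
  interpret hermitian_manifold A \<omega> e k
    using assms(1-3,5) e by unfold_locales
  have f: "C2M f" by (rule smooth_function_C2M[OF assms(6)])
  have 1: "constant_sign f \<and> (\<not> (\<forall>x. f x = 0) \<longrightarrow> ((\<exists>a. \<forall>x. f x = a) \<longleftrightarrow> gauduchon_metric A \<omega>))"
    if z: "vanishes A (del_delbar_form (2 * k) (scale_form f (form_power \<omega> k)))"
  proof -
    have sol: "solution f" by (rule del_delbar_vanishes_solution[OF f z])
    show ?thesis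
      using solution_constant_sign[OF sol] solution_gauduchon_constant[OF sol] constant_gauduchon[OF _ _ z] by metis
  qed
  have 2: "constant_sign f \<and> ((\<forall>x. f x = 0) \<or> kaehler_metric A (scale_form f \<omega>) \<or>
             kaehler_metric A (scale_form (\<lambda>x. - f x) \<omega>))"
    if z: "vanishes A (d_form 2 (scale_form f \<omega>))"
  proof -
    have m: "smooth_function A (\<lambda>x. - f x)"
      unfolding smooth_function_def smooth_on_def
    proof (intro ballI allI)
      fix c r assume c: "c \<in> A"
      have "C_k_on r (chart_image c) (\<lambda>y. f (chart_inv c y))"
        using assms(6) c by (simp add: smooth_function_def smooth_on_def o_def)
      from C_k_on_linear[OF bounded_linear_minus[OF bounded_linear_ident] chart(2)[OF c] this]
      show "C_k_on r (chart_image c) ((\<lambda>x. - f x) \<circ> chart_inv c)" by (simp add: o_def)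
    qed
    show ?thesis
      using conformal_closed_constant_sign[OF assms(4) f z] kaehler_scale[OF assms(6) _ z]
        kaehler_scale[OF m _ conformal_closed_uminus[OF f z]]
      unfolding constant_sign_def by (metis neg_0_less_iff_less)
  qed
  show ?thesis using 1 2 unfolding n by simp
qed

end
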